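(* In the operator setting, let $A\in\mathcal{W}(L(\mathcal{X},\mathcal{Y}))$ be invertible with $B=A^{-1}\in L(\mathcal{Y},\mathcal{X})$. Then $B\in\mathcal{W}(L(\mathcal{Y},\mathcal{X}))$ and \[\|B\|_{1,1}\le(2N+1)^d\|B\|_{1,N}\le\frac{\|B\|}{\epsilon_A}\Big(2\psi_A\Big(\frac{\epsilon_A}{\|B\|}\Big)+1\Big)^d,\qquad N=\psi_A\Big(\frac{\epsilon_A}{\|B\|}\Big),\] where $\varkappa(A)=\|A\|\|A^{-1}\|$, $\delta_A=\big(\frac{4\varkappa(A)+3}{4\varkappa(A)+2}\big)^{1/(3d)}$, $\epsilon_A=5^{-d}\Big(16\big(\frac{2\delta_A-1}{\delta_A-1}\big)^d-12\Big)^{-1}$, and $\psi_A:(0,\infty)\to\mathbb{N}$ is \[\psi_A(t)=\min\Big\{K\in\mathbb{N}:\ \Big\|A-\sum_{k\in\mathbb{Z}^d,\,|k|_\infty\le2}\phi^d_{K,k}A\Big\|_{1,K}\le t\Big\}.\]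
   Context: $|k|_\infty=\max_j|k_j|$. Fourier transform $\hat f(\lambda)=\int f(t)e^{-it\cdot\lambda}dt$. A Banach $L^1(\mathbb{R}^d)$-module structure on a Banach space $\mathcal{M}$ associated with a representation $\mathcal{T}:\mathbb{R}^d\to B(\mathcal{M})$ by invertible isometries is a bilinear map $(f,x)\mapsto fx$ with $(f*g)x=f(gx)$, $\|fx\|\le\|f\|_1\|x\|$, $\mathcal{T}(t)(fx)=(f(\cdot+t))x=f(\mathcal{T}(t)x)$, non-degenerate; for $\mathcal{T}$-continuous $x$, $fx=\int f(t)\mathcal{T}(-t)x\,dt$. Operator setting: $\mathcal{X},\mathcal{Y}$ complex Banach spaces; each of $L(\mathcal{X},\mathcal{Y}),L(\mathcal{Y},\mathcal{X}),B(\mathcal{X}),B(\mathcal{Y})$ carries such a module structure with representations $\mathcal{T}_{\mathcal{U}\mathcal{V}}$ satisfying $\mathcal{T}_{\mathcal{U}\mathcal{W}}(t)(BA)=(\mathcal{T}_{\mathcal{V}\mathcal{W}}(t)B)(\mathcal{T}_{\mathcal{U}\mathcal{V}}(t)A)$, and coupled: $A,B$ mutually inverse iff $\mathcal{T}_{\mathcal{X}\mathcal{Y}}(t)A$, $\mathcal{T}_{\mathcal{Y}\mathcal{X}}(t)B$ are, for all $t$. $\hat\phi(\lambda)=\max(1-|\lambda|,0)$; $\phi^d_{N,a}\in L^1(\mathbb{R}^d)$ has $\hat\phi^d_{N,a}(\lambda)=\prod_k\hat\phi((\lambda_k-Na_k)/N)$. $\|A\|_{\mathcal{W}}=\int_{\mathbb{R}^d}\|\phi^d_{1,a}A\|\,da$,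 $\|A\|_{1,N}=5^d\sum_{n\in\mathbb{Z}^d}\|\phi^d_{N,n}A\|$; $\mathcal{W}(L(\mathcal{U},\mathcal{V}))=\{A:\|A\|_{\mathcal{W}}<\infty\}$. $\|B\|$ is the operator norm. *)

theory Defs
  imports "HOL-Analysis.Analysis"
begin

text \<open>The library has no complex normed spaces; a complex Banach space is a real
Banach space with a compatible complex scalar multiplication satisfying the
complex norm axiom.\<close>

class complex_banach = banach +
  fixes cscale :: "complex \<Rightarrow> 'a \<Rightarrow> 'a"
  assumes cscale_of_real: "cscale (complex_of_real r) x = r *\<^sub>R x"
    and cscale_add_right: "cscale c (x + y) = cscale c x + cscale c y"
    and cscale_add_left: "cscale (a + b) x = cscale a x + cscale b x"
    and cscale_mult: "cscale a (cscale b x) = cscale (a * b) x"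
    and norm_cscale: "norm (cscale c x) = cmod c * norm x"

definition cblin :: "('a::complex_banach \<Rightarrow>\<^sub>L 'b::complex_banach) set" where
  "cblin = {A. \<forall>c v. blinfun_apply A (cscale c v) = cscale c (blinfun_apply A v)}"

definition scaleCL :: "complex \<Rightarrow> ('a::complex_banach \<Rightarrow>\<^sub>L 'b::complex_banach) \<Rightarrow> ('a \<Rightarrow>\<^sub>L 'b)" where
  "scaleCL c A = Blinfun (\<lambda>v. cscale c (blinfun_apply A v))"

definition L1norm :: "(real^'n \<Rightarrow> complex) \<Rightarrow> real" where
  "L1norm f = (\<integral>t. norm (f t) \<partial>lborel)"

definition conv :: "(real^'n \<Rightarrow> complex) \<Rightarrow> (real^'n \<Rightarrow> complex) \<Rightarrow> real^'n \<Rightarrow> complex" where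
  "conv f g = (\<lambda>t. \<integral>s. f s * g (t - s) \<partial>lborel)"

definition fourier :: "(real^'n \<Rightarrow> complex) \<Rightarrow> real^'n \<Rightarrow> complex" where
  "fourier f = (\<lambda>w. \<integral>t. f t * exp (- \<i> * complex_of_real (t \<bullet> w)) \<partial>lborel)"

text \<open>A representation of R^d by invertible isometries of L(U,V)
(a group homomorphism into the linear isometries; invertibility follows).\<close>

definition isometric_rep ::
  "(real^'n \<Rightarrow> ('a::complex_banach \<Rightarrow>\<^sub>L 'b::complex_banach) \<Rightarrow> ('a \<Rightarrow>\<^sub>L 'b)) \<Rightarrow> bool" where
  "isometric_rep T \<longleftrightarrow>
     (\<forall>t. \<forall>x\<in>cblin. T t x \<in> cblin) \<and>
     (\<forall>t. \<forall>x\<in>cblin. \<forall>y\<in>cblin. T t (x + y) = T t x + T t y) \<and>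
     (\<forall>t c. \<forall>x\<in>cblin. T t (scaleCL c x) = scaleCL c (T t x)) \<and>
     (\<forall>t. \<forall>x\<in>cblin. norm (T t x) = norm x) \<and>
     (\<forall>x\<in>cblin. T 0 x = x) \<and>
     (\<forall>s t. \<forall>x\<in>cblin. T (s + t) x = T s (T t x))"

definition L1_module ::
  "(real^'n \<Rightarrow> ('a::complex_banach \<Rightarrow>\<^sub>L 'b::complex_banach) \<Rightarrow> ('a \<Rightarrow>\<^sub>L 'b))
   \<Rightarrow> ((real^'n \<Rightarrow> complex) \<Rightarrow> ('a \<Rightarrow>\<^sub>L 'b) \<Rightarrow> ('a \<Rightarrow>\<^sub>L 'b)) \<Rightarrow> bool" where
  "L1_module T act \<longleftrightarrow>
     isometric_rep T \<and>
     (\<forall>f. \<forall>x\<in>cblin. integrable lborel f \<longrightarrow> act f x \<in> cblin) \<and>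
     \<comment> \<open>bilinearity\<close>
     (\<forall>f g. \<forall>x\<in>cblin. integrable lborel f \<longrightarrow> integrable lborel g \<longrightarrow>
        act (\<lambda>t. f t + g t) x = act f x + act g x) \<and>
     (\<forall>f c. \<forall>x\<in>cblin. integrable lborel f \<longrightarrow>
        act (\<lambda>t. c * f t) x = scaleCL c (act f x)) \<and>
     (\<forall>f. \<forall>x\<in>cblin. \<forall>y\<in>cblin. integrable lborel f \<longrightarrow>
        act f (x + y) = act f x + act f y) \<and>
     (\<forall>f c. \<forall>x\<in>cblin. integrable lborel f \<longrightarrow>
        act f (scaleCL c x) = scaleCL c (act f x)) \<and>
     \<comment> \<open>(f*g)x = f(gx)\<close>
     (\<forall>f g. \<forall>x\<in>cblin. integrable lborel f \<longrightarrow> integrable lborel g \<longrightarrow>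
        act (conv f g) x = act f (act g x)) \<and>
     \<comment> \<open>norm bound\<close>
     (\<forall>f. \<forall>x\<in>cblin. integrable lborel f \<longrightarrow> norm (act f x) \<le> L1norm f * norm x) \<and>
     \<comment> \<open>T(t)(fx) = (f(.+t))x = f(T(t)x)\<close>
     (\<forall>f t. \<forall>x\<in>cblin. integrable lborel f \<longrightarrow>
        T t (act f x) = act (\<lambda>s. f (s + t)) x \<and> act (\<lambda>s. f (s + t)) x = act f (T t x)) \<and>
     \<comment> \<open>non-degeneracy\<close>
     (\<forall>x\<in>cblin. (\<forall>f. integrable lborel f \<longrightarrow> act f x = 0) \<longrightarrow> x = 0) \<and>
     \<comment> \<open>for T-continuous x, fx = integral of f(t) T(-t)x dt\<close>
     (\<forall>f. \<forall>x\<in>cblin. integrable lborel f \<longrightarrow> continuous_on UNIV (\<lambda>t. T t x) \<longrightarrow>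
        ((\<lambda>t. scaleCL (f t) (T (- t) x)) has_integral act f x) UNIV)"

definition operator_setting ::
  "(real^'n \<Rightarrow> ('x::complex_banach \<Rightarrow>\<^sub>L 'y::complex_banach) \<Rightarrow> ('x \<Rightarrow>\<^sub>L 'y))
   \<Rightarrow> ((real^'n \<Rightarrow> complex) \<Rightarrow> ('x \<Rightarrow>\<^sub>L 'y) \<Rightarrow> ('x \<Rightarrow>\<^sub>L 'y))
   \<Rightarrow> (real^'n \<Rightarrow> ('y \<Rightarrow>\<^sub>L 'x) \<Rightarrow> ('y \<Rightarrow>\<^sub>L 'x))
   \<Rightarrow> ((real^'n \<Rightarrow> complex) \<Rightarrow> ('y \<Rightarrow>\<^sub>L 'x) \<Rightarrow> ('y \<Rightarrow>\<^sub>L 'x))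
   \<Rightarrow> (real^'n \<Rightarrow> ('x \<Rightarrow>\<^sub>L 'x) \<Rightarrow> ('x \<Rightarrow>\<^sub>L 'x))
   \<Rightarrow> ((real^'n \<Rightarrow> complex) \<Rightarrow> ('x \<Rightarrow>\<^sub>L 'x) \<Rightarrow> ('x \<Rightarrow>\<^sub>L 'x))
   \<Rightarrow> (real^'n \<Rightarrow> ('y \<Rightarrow>\<^sub>L 'y) \<Rightarrow> ('y \<Rightarrow>\<^sub>L 'y))
   \<Rightarrow> ((real^'n \<Rightarrow> complex) \<Rightarrow> ('y \<Rightarrow>\<^sub>L 'y) \<Rightarrow> ('y \<Rightarrow>\<^sub>L 'y)) \<Rightarrow> bool" where
  "operator_setting TXY aXY TYX aYX TXX aXX TYY aYY \<longleftrightarrow>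
     L1_module TXY aXY \<and> L1_module TYX aYX \<and> L1_module TXX aXX \<and> L1_module TYY aYY \<and>
     \<comment> \<open>T_UW(t)(BA) = (T_VW(t)B)(T_UV(t)A), for all U,V,W in {X,Y}\<close>
     (\<forall>t. \<forall>B\<in>cblin. \<forall>A\<in>cblin. TXX t (B o\<^sub>L A) = TXX t B o\<^sub>L TXX t A) \<and>
     (\<forall>t. \<forall>B\<in>cblin. \<forall>A\<in>cblin. TXY t (B o\<^sub>L A) = TXY t B o\<^sub>L TXX t A) \<and>
     (\<forall>t. \<forall>B\<in>cblin. \<forall>A\<in>cblin. TXX t (B o\<^sub>L A) = TYX t B o\<^sub>L TXY t A) \<and>
     (\<forall>t. \<forall>B\<in>cblin. \<forall>A\<in>cblin. TXY t (B o\<^sub>L A) = TYY t B o\<^sub>L TXY t A) \<and>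
     (\<forall>t. \<forall>B\<in>cblin. \<forall>A\<in>cblin. TYX t (B o\<^sub>L A) = TXX t B o\<^sub>L TYX t A) \<and>
     (\<forall>t. \<forall>B\<in>cblin. \<forall>A\<in>cblin. TYY t (B o\<^sub>L A) = TXY t B o\<^sub>L TYX t A) \<and>
     (\<forall>t. \<forall>B\<in>cblin. \<forall>A\<in>cblin. TYX t (B o\<^sub>L A) = TYX t B o\<^sub>L TYY t A) \<and>
     (\<forall>t. \<forall>B\<in>cblin. \<forall>A\<in>cblin. TYY t (B o\<^sub>L A) = TYY t B o\<^sub>L TYY t A) \<and>
     \<comment> \<open>coupling\<close>
     (\<forall>A\<in>cblin. \<forall>B\<in>cblin.
        (B o\<^sub>L A = id_blinfun \<and> A o\<^sub>L B = id_blinfun) \<longleftrightarrow>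
        (\<forall>t. TYX t B o\<^sub>L TXY t A = id_blinfun \<and> TXY t A o\<^sub>L TYX t B = id_blinfun))"

text \<open>phi is the (Fejer) function with Fourier transform max(1-|lambda|,0):
phi(t) = (1/(2 pi)) (sin(t/2)/(t/2))^2.\<close>

definition fejer :: "real \<Rightarrow> real" where
  "fejer t = (if t = 0 then 1 / (2 * pi) else (1 - cos t) / (pi * t\<^sup>2))"

text \<open>phi^d_{N,a}(t) = prod_k N phi(N t_k) e^{i N a_k t_k}; its Fourier transform is
prod_k hat-phi((lambda_k - N a_k)/N).\<close>

definition phi_d :: "nat \<Rightarrow> real^'n \<Rightarrow> real^'n \<Rightarrow> complex" where
  "phi_d N a = (\<lambda>t. \<Prod>j\<in>UNIV. complex_of_real (real N * fejer (real N * t $ j))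
                      * exp (\<i> * complex_of_real (real N * a $ j * t $ j)))"

definition int_vec :: "int^'n \<Rightarrow> real^'n" where
  "int_vec k = (\<chi> j. real_of_int (k $ j))"

definition normW :: "((real^'n \<Rightarrow> complex) \<Rightarrow> ('a \<Rightarrow>\<^sub>L 'b) \<Rightarrow> ('a \<Rightarrow>\<^sub>L 'b))
     \<Rightarrow> ('a::real_normed_vector \<Rightarrow>\<^sub>L 'b::real_normed_vector) \<Rightarrow> ennreal" where
  "normW act A = (\<integral>\<^sup>+ a. ennreal (norm (act (phi_d 1 a) A)) \<partial>lborel)"

definition WienerClass :: "((real^'n \<Rightarrow> complex) \<Rightarrow> ('a \<Rightarrow>\<^sub>L 'b) \<Rightarrow> ('a \<Rightarrow>\<^sub>L 'b))
     \<Rightarrow> ('a::complex_banach \<Rightarrow>\<^sub>L 'b::complex_banach) set" where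
  "WienerClass act = {A \<in> cblin. normW act A < \<infinity>}"

definition norm1N :: "((real^'n \<Rightarrow> complex) \<Rightarrow> ('a \<Rightarrow>\<^sub>L 'b) \<Rightarrow> ('a \<Rightarrow>\<^sub>L 'b))
     \<Rightarrow> nat \<Rightarrow> ('a::real_normed_vector \<Rightarrow>\<^sub>L 'b::real_normed_vector) \<Rightarrow> ennreal" where
  "norm1N act N A = 5 ^ CARD('n) *
     (\<integral>\<^sup>+ n. ennreal (norm (act (phi_d N (int_vec n)) A)) \<partial>count_space (UNIV :: (int^'n) set))"

definition psi :: "((real^'n \<Rightarrow> complex) \<Rightarrow> ('a \<Rightarrow>\<^sub>L 'b) \<Rightarrow> ('a \<Rightarrow>\<^sub>L 'b))
     \<Rightarrow> ('a::real_normed_vector \<Rightarrow>\<^sub>L 'b::real_normed_vector) \<Rightarrow> real \<Rightarrow> nat" where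
  "psi act A t = (LEAST K. 1 \<le> K \<and>
     norm1N act K (A - (\<Sum>k\<in>{k :: int^'n. \<forall>j. \<bar>k $ j\<bar> \<le> 2}. act (phi_d K (int_vec k)) A))
       \<le> ennreal t)"

definition deltaA :: "nat \<Rightarrow> real \<Rightarrow> real" where
  "deltaA d kappa = ((4 * kappa + 3) / (4 * kappa + 2)) powr (1 / (3 * real d))"

definition epsA :: "nat \<Rightarrow> real \<Rightarrow> real" where
  "epsA d kappa = (let \<delta> = deltaA d kappa in
     inverse (5 ^ d) * inverse (16 * ((2 * \<delta> - 1) / (\<delta> - 1)) ^ d - 12))"

end

theory Submission
  imports Defs "HOL-Probability.Sinc_Integral"
begin

text \<open>Fix a direction \<open>v\<close>. On elements whose spectrum lies in a slab \<open>|\<lambda> \<bullet> v - c| \<le> s\<close> the Fourier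
multiplier \<open>\<lambda> \<bullet> v - c\<close> has norm at most \<open>s\<close> (Bernstein), because \<open>x = \<Sum> a\<^sub>k sin\<^sup>2\<^sup>k\<^sup>+\<^sup>1 x\<close> on \<open>[-\<pi>/2, \<pi>/2]\<close> with
\<open>a\<^sub>k \<ge> 0\<close> and \<open>\<Sum> a\<^sub>k = \<pi>/2\<close>, and \<open>sin\<close> is half a difference of two isometries. Hence \<open>r \<mapsto> T(r v) x\<close> is
the sum of an explicit power series on such elements, the multipliers \<open>exp (\<plusminus> \<lambda> \<bullet> v)\<close> (formally
\<open>T(\<plusminus>\<i> v)\<close>) have norm at most \<open>exp (\<plusminus>c + s)\<close>, and evaluating power series at \<open>\<i>\<close> is multiplicative. This
gives the additivity of spectra under products, so that \<open>norm1N\<close> is submultiplicative, and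
exponential decay of \<open>\<phi>\<^sub>N\<^sub>,\<^sub>n B'\<close> for the inverse \<open>B'\<close> of the band-limited part \<open>A' = \<Sum>\<^bsub>|k| \<le> 2\<^esub> \<phi>\<^sub>N\<^sub>,\<^sub>k A\<close>: the
power series of \<open>T(r v) A'\<close> can be inverted for \<open>|r| \<le> 1\<close> as long as \<open>|v|\<close> is small compared with
\<open>1 / (N \<kappa>(A))\<close>. With the decay rate \<open>\<delta>\<^sub>A\<^sup>2\<close> the resulting geometric sum is at most \<open>\<parallel>B\<parallel> / (2 \<epsilon>\<^sub>A)\<close>, and
the Neumann series \<open>B = \<Sum>\<^sub>k B' ((A' - A) B')\<^sup>k\<close> then costs at most another factor 2 in \<open>norm1N\<close>.\<close>

section \<open>The Fejer kernel and its Fourier transform\<close>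

text \<open>An element need not be \<open>T\<close>-continuous, and the integral formula for
  \<open>act f x\<close> is available only for those that are; hence the analysis is carried out on
  kernels, and elements are reached through \<open>act\<close> and non-degeneracy. The band-limited
  part is a sum of 5^d pieces; a bound through the L1 norm of its kernel would put a power of 5 into
  the smallness condition for the decay rate, whereas multiplier bounds relative to
  \<open>norm (act f x)\<close> leave only the condition number there. Nothing is known about the
  spectrum of B, so B' is first produced from B by a Neumann series in operator norm; coupling makes
  T(t) B' the inverse of T(t) A', and so T(r v) B' inherits a power series from T(r v) A'. In a
  product, pieces k and l are seen by the kernel m of the same width only if m - k - l has all
  coordinates in {-2..2}: this is the origin of the factor 5^d in the norm. The constant epsilon is
  calibrated so that the remainder, at most epsilon / norm B, times the norm of B', at most norm B /
  (2 epsilon), is 1/2.\<close>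

lemma fejer_sinc: "fejer t = (sinc (t/2))\<^sup>2 / (2*pi)"
proof (cases "t = 0")
  case False
  have "1 - cos t = 2 * (sin (t/2))\<^sup>2" using cos_double_sin[of "t/2"] by simp
  then show ?thesis using False by (simp add: fejer_def power_divide field_simps)
qed (simp add: fejer_def)

lemma fejer_nonneg: "0 \<le> fejer t"
  by (simp add: fejer_sinc)

lemma fejer_minus: "fejer (-t) = fejer t"
  by (simp add: fejer_def)

lemma continuous_on_fejer [continuous_intros]:
  "continuous_on S f \<Longrightarrow> continuous_on S (\<lambda>x. fejer (f x))"
  unfolding fejer_sinc by (intro continuous_intros) auto

lemma borel_measurable_fejer [measurable]: "fejer \<in> borel_measurable borel"
  by (intro borel_measurable_continuous_onI continuous_intros)

text \<open>Adding the bounds 1/2 for \<open>fejer t\<close> and 1 for \<open>fejer t * t^2\<close>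
  gives an integrable majorant that scales well in the width; it dominates the kernels in
  \<open>ker_L1_continuous\<close>.\<close>

lemma fejer_le: "fejer t \<le> 2 / (1 + t\<^sup>2)"
proof (cases "t = 0")
  case True
  then show ?thesis using pi_gt3 by (simp add: fejer_def field_simps)
next
  case False
  have 1: "fejer t \<le> 1 / 2"
  proof -
    have "\<bar>sinc (t/2)\<bar> \<le> 1" using False abs_sin_x_le_abs_x[of "t/2"] by (simp add: divide_le_eq)
    then have "(sinc (t/2))\<^sup>2 \<le> 1" by (simp add: abs_square_le_1)
    then show ?thesis unfolding fejer_sinc using pi_gt3 by (simp add: field_simps)
  qed
  have "1 - cos t \<le> 2" using cos_ge_minus_one[of t] by simp
  then have "(1 - cos t)/(pi*t\<^sup>2) \<le> 2/(pi*t\<^sup>2)" using False by (intro divide_right_mono) auto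
  also have "\<dots> \<le> 2/(2*t\<^sup>2)" using False pi_gt3 by (intro divide_left_mono mult_right_mono mult_pos_pos) auto
  finally have 2: "fejer t * t\<^sup>2 \<le> 1" using False by (simp add: fejer_def field_simps)
  have "fejer t * (1 + t\<^sup>2) \<le> 2" using 1 2 by (simp add: algebra_simps)
  moreover have "1 + t\<^sup>2 > 0" by (simp add: add_pos_nonneg)
  ultimately show ?thesis by (simp add: pos_le_divide_eq)
qed

text \<open>Integration by parts turns (1 - cos t) / t^2 into sin t / t, so Si t - (1 - cos t) / t
  is an antiderivative of \<open>pi * fejer t\<close>, and the mass comes from the limits of the
  sine integral.\<close>

lemma fejer_integral: "integrable lborel fejer" "(\<integral>t. fejer t \<partial>lborel) = 1"
proof -
  \<comment> \<open>This form of (1 - cos t) / t makes the difference quotient at 0 equal to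
    \<open>pi * fejer h\<close>, so the derivative at 0 follows from continuity of
    \<open>fejer\<close>.\<close>
  define G where "G = (\<lambda>t::real. t * (pi * fejer t))"
  have G: "G t = (1 - cos t) / t" for t by (simp add: G_def fejer_def power2_eq_square)
  have F0: "((\<lambda>t. Si t - G t) has_real_derivative pi * fejer t) (at t)" for t
  proof (cases "t = 0")
    case True
    have "((\<lambda>h. pi * fejer h) \<longlongrightarrow> pi * fejer 0) (at 0)"
      using continuous_on_fejer[of UNIV "\<lambda>x. x"] by (intro tendsto_intros) (auto simp: continuous_on_def)
    then have "((\<lambda>h. (G (0+h) - G 0)/h) \<longlongrightarrow> pi * fejer 0) (at 0)"
      by (rule Lim_transform_eventually) (auto simp: G_def eventually_at_filter)
    then have "(G has_real_derivative pi * fejer 0) (at 0)" by (simp add: DERIV_def)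
    from DERIV_diff[OF DERIV_Si this] show ?thesis using True by (simp add: fejer_def)
  next
    case False
    have "((\<lambda>t. (1 - cos t) / t) has_real_derivative (sin t * t - (1 - cos t))/(t*t)) (at t)"
      using False by (auto intro!: derivative_eq_intros)
    then have "(G has_real_derivative (sin t * t - (1 - cos t))/(t*t)) (at t)" by (simp add: G[abs_def])
    from DERIV_diff[OF DERIV_Si this]
    have "((\<lambda>t. Si t - G t) has_real_derivative (1 - cos t) / (t*t)) (at t)"
      using False by (simp add: field_simps)
    then show ?thesis using False by (simp add: fejer_def power2_eq_square)
  qed
  have Gtop: "(G \<longlongrightarrow> 0) at_top"
  proof (rule Lim_null_comparison)
    show "\<forall>\<^sub>F t in at_top. norm (G t) \<le> 2 / t"
    proof (rule eventually_at_top_linorderI[of 1])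
      fix t :: real assume "1 \<le> t"
      then show "norm (G t) \<le> 2 / t" using cos_ge_minus_one[of t] cos_le_one[of t]
        by (simp add: G divide_right_mono)
    qed
    show "((\<lambda>t::real. 2/t) \<longlongrightarrow> 0) at_top" by (intro tendsto_divide_0[OF tendsto_const] filterlim_at_top_imp_at_infinity filterlim_ident)
  qed
  have top: "((\<lambda>t. Si t - G t) \<longlongrightarrow> pi/2) at_top"
    using tendsto_diff[OF Si_at_top Gtop] by simp
  have odd: "Si t - G t = - (Si (-t) - G (-t))" if "t < 0" for t
    using Si_neg[of "-t"] that by (simp add: G)
  have bot: "((\<lambda>t. Si t - G t) \<longlongrightarrow> -(pi/2)) at_bot"
  proof -
    have "((\<lambda>t. - (Si (-t) - G (-t))) \<longlongrightarrow> -(pi/2)) at_bot"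
      by (intro tendsto_minus filterlim_compose[OF top filterlim_uminus_at_top_at_bot])
    then show ?thesis
      by (rule Lim_transform_eventually) (use odd in \<open>auto intro!: eventually_at_bot_linorderI[of "-1"]\<close>)
  qed
  have cont: "isCont (\<lambda>t. pi * fejer t) x" for x
    using continuous_on_fejer[of UNIV "\<lambda>x. x"] by (intro continuous_intros) (auto simp: continuous_on_eq_continuous_at)
  have *: "set_integrable lborel (einterval (-\<infinity>) \<infinity>) (\<lambda>t. pi * fejer t)"
      "(LBINT t=-\<infinity>..\<infinity>. pi * fejer t) = pi/2 - (-(pi/2))"
    using interval_integral_FTC_nonneg[of "-\<infinity>" "\<infinity>" "\<lambda>t. Si t - G t" "\<lambda>t. pi * fejer t" "-(pi/2)" "pi/2"]
      F0 cont top bot fejer_nonneg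
    by (auto simp: ereal_tendsto_simps1)
  have "integrable lborel (\<lambda>t. pi * fejer t)" using *(1) by (simp add: set_integrable_def)
  then show i: "integrable lborel fejer" by simp
  have "(\<integral>t. pi * fejer t \<partial>lborel) = pi"
    using *(2) by (simp add: interval_lebesgue_integral_def set_lebesgue_integral_def)
  then show "(\<integral>t. fejer t \<partial>lborel) = 1" by simp
qed

section \<open>The triangle function and the one-dimensional transform pair\<close>

definition tri :: "real \<Rightarrow> real" where "tri x = max (1 - \<bar>x\<bar>) 0"

lemma tri_minus: "tri (-x) = tri x"
  and tri_eq_0_iff: "tri x = 0 \<longleftrightarrow> 1 \<le> \<bar>x\<bar>"
  by (auto simp: tri_def)

lemma borel_measurable_tri [measurable]: "tri \<in> borel_measurable borel"
  unfolding tri_def[abs_def] by measurable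

text \<open>By the addition formulas the integrand is half the second difference, at b = x with step
  1, of \<open>b^2 * fejer (b * t)\<close>, whose integral is |b|; half the second difference of |x|
  is the triangle.\<close>

lemma fejer_cos_integral: "(\<integral>t. fejer t * cos (x * t) \<partial>lborel) = tri x"
proof -
  have sc: "integrable lborel (\<lambda>t. b\<^sup>2 * fejer (b * t))" "(\<integral>t. b\<^sup>2 * fejer (b * t) \<partial>lborel) = \<bar>b\<bar>" for b :: real
  proof -
    have "integrable lborel (\<lambda>t. fejer (b * t)) \<and> (\<integral>t. b\<^sup>2 * fejer (b * t) \<partial>lborel) = \<bar>b\<bar>" if "b \<noteq> 0"
    proof -
      have "1 = \<bar>b\<bar> *\<^sub>R (\<integral>t. fejer (0 + b * t) \<partial>lborel)"
        using lborel_integral_real_affine[OF that, of fejer 0] fejer_integral by simp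
      then have "(\<integral>t. fejer (b * t) \<partial>lborel) = 1 / \<bar>b\<bar>" using that by (simp add: field_simps)
      moreover have "b\<^sup>2 = \<bar>b\<bar> * \<bar>b\<bar>" by (simp add: power2_eq_square)
      ultimately show ?thesis
        using lborel_integrable_real_affine[OF fejer_integral(1) that, of 0] that
        by (auto simp: power2_eq_square abs_if)
    qed
    then show "integrable lborel (\<lambda>t. b\<^sup>2 * fejer (b * t))" "(\<integral>t. b\<^sup>2 * fejer (b * t) \<partial>lborel) = \<bar>b\<bar>"
      by (cases "b = 0"; auto)+
  qed
  have eq: "fejer t * cos (x * t) = ((x+1)\<^sup>2 * fejer ((x+1)*t) + (x-1)\<^sup>2 * fejer ((x-1)*t) - 2 * (x\<^sup>2 * fejer (x*t))) / 2" for t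
  proof (cases "t = 0")
    case True then show ?thesis by (simp add: fejer_def field_simps power2_eq_square)
  next
    case False
    have k: "b\<^sup>2 * fejer (b*t) = (1 - cos (b*t)) / (pi * t\<^sup>2)" for b
      using False by (simp add: fejer_def power_mult_distrib)
    have "fejer t = (1 - cos t)/(pi*t\<^sup>2)" using False by (simp add: fejer_def)
    then show ?thesis unfolding k using False
      by (simp only: \<open>fejer t = _\<close>) (simp add: divide_simps, simp add: algebra_simps cos_add cos_diff)
  qed
  have "(\<integral>t. fejer t * cos (x * t) \<partial>lborel) = (\<bar>x+1\<bar> + \<bar>x-1\<bar> - 2*\<bar>x\<bar>)/2"
    unfolding eq using sc[of "x+1"] sc[of "x-1"] sc[of x] by simp
  also have "\<dots> = tri x" by (simp add: tri_def max_def abs_if)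
  finally show ?thesis .
qed

lemma integral_odd: 
  fixes f :: "real \<Rightarrow> real" assumes "\<And>x. f (-x) = - f x"
  shows "(\<integral>t. f t \<partial>lborel) = 0"
  using lborel_integral_real_affine[of "-1" f 0] by (simp add: assms)

lemma integral_cis_even:
  fixes f :: "real \<Rightarrow> real" assumes f: "integrable lborel f" "\<And>x. f (-x) = f x"
  shows "integrable lborel (\<lambda>t. of_real (f t) * cis (x * t))"
    and "(\<integral>t. of_real (f t) * cis (x * t) \<partial>lborel) = of_real (\<integral>t. f t * cos (x * t) \<partial>lborel)"
proof -
  have [measurable]: "f \<in> borel_measurable borel" using f by auto
  have i: "integrable lborel (\<lambda>t. f t * cos (x*t))" "integrable lborel (\<lambda>t. f t * sin (x*t))"
    by (rule Bochner_Integration.integrable_bound[OF f(1)]; auto simp: abs_mult mult_left_le)+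
  have e: "of_real (f t) * cis (x * t) = of_real (f t * cos (x*t)) + \<i> * of_real (f t * sin (x * t))" for t
    by (simp add: complex_eq_iff)
  have z: "(\<integral>t. f t * sin (x * t) \<partial>lborel) = 0" by (rule integral_odd) (simp add: f(2))
  show "integrable lborel (\<lambda>t. of_real (f t) * cis (x * t))"
    unfolding e by (intro Bochner_Integration.integrable_add integrable_mult_right integrable_of_real i)
  have "(\<integral>t. of_real (f t) * cis (x * t) \<partial>lborel) = of_real (\<integral>t. f t * cos (x*t) \<partial>lborel) + \<i> * of_real (\<integral>t. f t * sin (x * t) \<partial>lborel)"
    unfolding e by (subst Bochner_Integration.integral_add) (simp_all only: integral_complex_of_real integral_mult_right_zero integrable_mult_right integrable_of_real i)
  then show "(\<integral>t. of_real (f t) * cis (x * t) \<partial>lborel) = of_real (\<integral>t. f t * cos (x * t) \<partial>lborel)"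
    using z by simp
qed

text \<open>The other half of the transform pair, from explicit antiderivatives on [-1,0] and [0,1].
  It supplies the Fourier integral that \<open>frep\<close> asks for, so no general inversion
  theorem enters.\<close>

lemma tri_cos_integral: "integrable lborel tri" "(\<integral>x. tri x * cos (x * t) \<partial>lborel) = 2 * pi * fejer t"
proof -
  have ind: "tri x * g x = indicator {-1..1} x *\<^sub>R ((1 - \<bar>x\<bar>) * g x)" for x and g :: "real \<Rightarrow> real"
    by (auto simp: tri_def indicator_def)
  have si: "set_integrable lborel {-1..1} (\<lambda>x::real. (1 - \<bar>x\<bar>) * g x)" if "continuous_on UNIV g" for g
    by (intro borel_integrable_atLeastAtMost' continuous_intros continuous_on_subset[OF that]) auto
  show "integrable lborel tri"
  proof -
    have "tri = (\<lambda>x. indicator {-1..1} x *\<^sub>R ((1 - \<bar>x\<bar>) * 1))" using ind[of _ "\<lambda>_. 1"] by auto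
    then show ?thesis using si[of "\<lambda>_. 1"] by (simp add: set_integrable_def)
  qed
  have si': "set_integrable lborel {-1..1} (\<lambda>x::real. (1 - \<bar>x\<bar>) * cos (x*t))"
    by (rule si) (intro continuous_intros)
  have "(\<integral>x. tri x * cos (x * t) \<partial>lborel) = integral {-1..1} (\<lambda>x. (1 - \<bar>x\<bar>) * cos (x*t))"
    unfolding ind[of _ "\<lambda>x. cos (x*t)"] using set_borel_integral_eq_integral(2)[OF si'] by (simp add: set_lebesgue_integral_def)
  also have "\<dots> = 2 * pi * fejer t"
  proof (rule integral_unique, cases "t = 0")
    case True
    have 1: "((\<lambda>x::real. 1 + x) has_integral (0 + 0\<^sup>2/2 - (-1 + (-1)\<^sup>2/2))) {-1..0}"
      by (rule fundamental_theorem_of_calculus) (auto intro!: derivative_eq_intros simp flip: has_real_derivative_iff_has_vector_derivative)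
    have 2: "((\<lambda>x::real. 1 - x) has_integral (1 - 1\<^sup>2/2 - (0 - 0\<^sup>2/2))) {0..1}"
      by (rule fundamental_theorem_of_calculus) (auto intro!: derivative_eq_intros simp flip: has_real_derivative_iff_has_vector_derivative)
    have h1: "((\<lambda>x::real. 1 - \<bar>x\<bar>) has_integral 1/2) {-1..0}"
      by (rule has_integral_eq[rotated], rule 1[simplified]) auto
    have h2: "((\<lambda>x::real. 1 - \<bar>x\<bar>) has_integral 1/2) {0..1}"
      by (rule has_integral_eq[rotated], rule 2[simplified]) auto
    show "((\<lambda>x. (1 - \<bar>x\<bar>) * cos (x*t)) has_integral 2 * pi * fejer t) {-1..1}"
      using has_integral_combine[OF _ _ h1 h2] True by (simp add: fejer_def)
  next
    case False
    define F1 where "F1 = (\<lambda>x. (1+x) * sin (x*t) / t + cos (x*t)/t\<^sup>2)"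
    define F2 where "F2 = (\<lambda>x. (1-x) * sin (x*t) / t - cos (x*t)/t\<^sup>2)"
    have 1: "((\<lambda>x::real. (1 + x) * cos (x*t)) has_integral (F1 0 - F1 (-1))) {-1..0}"
      unfolding F1_def
      by (rule fundamental_theorem_of_calculus) (use False in \<open>auto intro!: derivative_eq_intros simp: field_simps power2_eq_square simp flip: has_real_derivative_iff_has_vector_derivative\<close>)
    have 2: "((\<lambda>x::real. (1 - x) * cos (x*t)) has_integral (F2 1 - F2 0)) {0..1}"
      unfolding F2_def
      by (rule fundamental_theorem_of_calculus) (use False in \<open>auto intro!: derivative_eq_intros simp: field_simps power2_eq_square simp flip: has_real_derivative_iff_has_vector_derivative\<close>)
    have h1: "((\<lambda>x::real. (1 - \<bar>x\<bar>) * cos (x*t)) has_integral (F1 0 - F1 (-1))) {-1..0}"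
      by (rule has_integral_eq[rotated], rule 1) auto
    have h2: "((\<lambda>x::real. (1 - \<bar>x\<bar>) * cos (x*t)) has_integral (F2 1 - F2 0)) {0..1}"
      by (rule has_integral_eq[rotated], rule 2) auto
    have "F1 0 - F1 (-1) + (F2 1 - F2 0) = 2 * pi * fejer t"
      using False by (simp add: F1_def F2_def fejer_def field_simps)
    then show "((\<lambda>x. (1 - \<bar>x\<bar>) * cos (x*t)) has_integral 2 * pi * fejer t) {-1..1}"
      using has_integral_combine[OF _ _ h1 h2] by simp
  qed
  finally show "(\<integral>x. tri x * cos (x * t) \<partial>lborel) = 2 * pi * fejer t" .
qed

section \<open>Product kernels on R^d\<close>

lemma
  fixes f :: "'n::finite \<Rightarrow> real \<Rightarrow> complex"
  assumes f: "\<And>j. integrable lborel (f j)"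
  shows integrable_prod_vec: "integrable lborel (\<lambda>t::real^'n. \<Prod>j\<in>UNIV. f j (t $ j))"
    and integral_prod_vec: "(integral\<^sup>L lborel (\<lambda>t::real^'n. \<Prod>j\<in>UNIV. f j (t $ j))) = (\<Prod>j\<in>UNIV. integral\<^sup>L lborel (f j))"
proof -
  interpret product_sigma_finite "\<lambda>_::real^'n. lborel :: real measure"
    by (simp add: product_sigma_finite_def sigma_finite_lborel)
  have inj: "inj (\<lambda>i::'n. axis i (1::real))" by (auto simp: inj_on_def axis_eq_axis)
  have Basis: "(Basis :: (real^'n) set) = range (\<lambda>i. axis i 1)" by (auto simp: Basis_vec_def)
  \<comment> \<open>The product measure behind \<open>lborel\<close> is indexed by basis vectors,
    the factors by coordinates; \<open>idx\<close> translates.\<close>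
  define idx where "idx = (\<lambda>b::real^'n. SOME i. b = axis i 1)"
  have idx [simp]: "idx (axis i 1) = i" for i
    unfolding idx_def by (rule some_equality) (auto simp: axis_eq_axis)
  have [measurable]: "f j \<in> borel_measurable borel" for j using f[of j] by auto
  have comp: "(\<Sum>b\<in>Basis. x b *\<^sub>R b) $ j = x (axis j 1)" for x :: "real^'n \<Rightarrow> real" and j
    unfolding Basis by (subst sum.reindex[OF inj]) (simp add: axis_def if_distrib[of "\<lambda>y. _ * y"] cong: if_cong)
  have eq: "(\<Prod>j\<in>UNIV. f j ((\<Sum>b\<in>Basis. x b *\<^sub>R b) $ j)) = (\<Prod>b\<in>Basis. f (idx b) (x b))" for x :: "real^'n \<Rightarrow> real"
    unfolding comp unfolding Basis by (subst prod.reindex[OF inj]) simp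
  have i: "integrable (\<Pi>\<^sub>M b\<in>(Basis::(real^'n) set). lborel) (\<lambda>x. \<Prod>b\<in>Basis. f (idx b) (x b))"
    by (rule product_integrable_prod) (auto intro: f)
  have m: "(\<lambda>t::real^'n. \<Prod>j\<in>UNIV. f j (t $ j)) \<in> borel_measurable borel"
    by measurable
  have m2: "(\<lambda>f. \<Sum>b\<in>Basis. f b *\<^sub>R b) \<in> (\<Pi>\<^sub>M b\<in>(Basis::(real^'n) set). lborel) \<rightarrow>\<^sub>M borel"
    by measurable
  show "integrable lborel (\<lambda>t::real^'n. \<Prod>j\<in>UNIV. f j (t $ j))"
    by (subst lborel_eq, subst integrable_distr_eq[OF m2 m]) (simp only: eq i)
  have "(integral\<^sup>L lborel (\<lambda>t::real^'n. \<Prod>j\<in>UNIV. f j (t $ j))) = (\<Prod>b\<in>(Basis::(real^'n) set). integral\<^sup>L lborel (f (idx b)))"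
    by (subst lborel_eq, subst integral_distr[OF m2 m], simp only: eq, rule product_integral_prod) (auto intro: f)
  also have "\<dots> = (\<Prod>j\<in>UNIV. integral\<^sup>L lborel (f j))"
    unfolding Basis by (subst prod.reindex[OF inj]) simp
  finally show "(integral\<^sup>L lborel (\<lambda>t::real^'n. \<Prod>j\<in>UNIV. f j (t $ j))) = (\<Prod>j\<in>UNIV. integral\<^sup>L lborel (f j))" .
qed

text \<open>Unlike \<open>phi_d\<close>, the width is real and the centre is not scaled by it: the
  limit in \<open>act_ker_product_0\<close> moves the width alone, the comparison with
  \<open>normW\<close> moves the centre alone.\<close>

definition ker :: "real \<Rightarrow> real^'n \<Rightarrow> real^'n \<Rightarrow> complex" where
  "ker w c t = (\<Prod>j\<in>UNIV. of_real (w * fejer (w * t $ j)) * cis (c $ j * t $ j))"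

definition ker_hat :: "real \<Rightarrow> real^'n \<Rightarrow> real^'n \<Rightarrow> complex" where
  "ker_hat w c l = (\<Prod>j\<in>UNIV. of_real (tri ((l $ j - c $ j) / w)))"

lemma phi_d_eq_ker: "phi_d N a = ker (real N) (real N *\<^sub>R a)"
  by (simp add: phi_d_def ker_def cis_conv_exp fun_eq_iff)

lemma cis_sum: "finite A \<Longrightarrow> cis (\<Sum>j\<in>A. f j) = (\<Prod>j\<in>A. cis (f j))"
  by (induction A rule: finite_induct) (auto simp: cis_mult[symmetric])

lemma cis_inner: "cis ((l::real^'n) \<bullet> t) = (\<Prod>j\<in>UNIV. cis (l $ j * t $ j))"
  by (simp add: inner_vec_def cis_sum)

lemma scaled_fejer_integral:
  assumes "w > 0"
  shows "integrable lborel (\<lambda>t. of_real (w * fejer (w * t)) * cis (c * t))"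
    and "(\<integral>t. of_real (w * fejer (w * t)) * cis (c * t) \<partial>lborel) = of_real (tri (c / w))"
proof -
  let ?f = "\<lambda>t. of_real (fejer t) * cis (c/w * t)"
  have e: "of_real (w * fejer (w * t)) * cis (c * t) = of_real w * ?f (0 + w * t)" for t
    using assms by (simp add: mult.assoc)
  note I = integral_cis_even[OF fejer_integral(1) fejer_minus, of "c/w", unfolded fejer_cos_integral]
  show "integrable lborel (\<lambda>t. of_real (w * fejer (w * t)) * cis (c * t))"
    unfolding e using assms by (intro integrable_mult_right lborel_integrable_real_affine[OF I(1)]) auto
  have "of_real (tri (c/w)) = \<bar>w\<bar> *\<^sub>R (\<integral>t. ?f (0 + w * t) \<partial>lborel)"
    unfolding I(2)[symmetric] by (rule lborel_integral_real_affine[of w ?f 0]) (use assms in simp)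
  also have "\<dots> = (\<integral>t. of_real (w * fejer (w * t)) * cis (c * t) \<partial>lborel)"
    unfolding e integral_mult_right_zero using assms by (simp add: scaleR_conv_of_real)
  finally show "(\<integral>t. of_real (w * fejer (w * t)) * cis (c * t) \<partial>lborel) = of_real (tri (c / w))" ..
qed

lemma scaled_tri_integral:
  assumes "w > 0"
  shows "integrable lborel (\<lambda>x. of_real (tri ((x - c) / w)) * cis (x * t))"
    and "(\<integral>x. of_real (tri ((x - c) / w)) * cis (x * t) \<partial>lborel) = 2 * pi * of_real (w * fejer (w * t)) * cis (c * t)"
proof -
  let ?f = "\<lambda>x. of_real (tri x) * cis (w * t * x)"
  have e: "of_real (tri ((x - c) / w)) * cis (x * t) = cis (c * t) * ?f (- c / w + (1/w) * x)" for x
  proof -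
    have "- c/w + (1/w) * x = (x - c)/w" using assms by (simp add: field_simps)
    moreover have "c * t + w * t * ((x - c)/w) = x * t" using assms by (simp add: field_simps)
    ultimately show ?thesis by (simp add: cis_mult mult.left_commute)
  qed
  have "(\<integral>x. tri x * cos (w * t * x) \<partial>lborel) = 2 * pi * fejer (w * t)"
    unfolding tri_cos_integral(2)[symmetric] by (simp only: mult.commute)
  note I = integral_cis_even[OF tri_cos_integral(1) tri_minus, of "w*t", unfolded this]
  show "integrable lborel (\<lambda>x. of_real (tri ((x - c) / w)) * cis (x * t))"
    unfolding e using assms by (intro integrable_mult_right lborel_integrable_real_affine[OF I(1)]) auto
  have "of_real (2 * pi * fejer (w*t)) = \<bar>1/w\<bar> *\<^sub>R (\<integral>x. ?f (-c/w + (1/w) * x) \<partial>lborel)"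
    unfolding I(2)[symmetric] by (rule lborel_integral_real_affine[of "1/w" ?f "-c/w"]) (use assms in simp)
  then have "(\<integral>x. ?f (-c/w + (1/w) * x) \<partial>lborel) = of_real w * of_real (2 * pi * fejer (w*t))"
    using assms by (simp add: scaleR_conv_of_real field_simps)
  then show "(\<integral>x. of_real (tri ((x - c) / w)) * cis (x * t) \<partial>lborel) = 2 * pi * of_real (w * fejer (w * t)) * cis (c * t)"
    unfolding e integral_mult_right_zero by simp
qed

lemma ker_integrable: "w > 0 \<Longrightarrow> integrable lborel (ker w c)"
  unfolding ker_def[abs_def] by (rule integrable_prod_vec) (rule scaled_fejer_integral(1))

lemma norm_ker: "w > 0 \<Longrightarrow> of_real (norm (ker w c t)) = ker w 0 t"
  by (simp add: ker_def norm_mult prod_norm[symmetric] fejer_nonneg abs_mult)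

lemma ker_fourier: 
  assumes "w > 0" shows "fourier (ker w c) l = ker_hat w c l"
proof -
  have "fourier (ker w c) l = (\<integral>t. (\<Prod>j\<in>UNIV. of_real (w * fejer (w * t $ j)) * cis ((c $ j - l $ j) * t $ j)) \<partial>lborel)"
    unfolding fourier_def
  proof (rule Bochner_Integration.integral_cong[OF refl])
    fix t :: "real^'a"
    have "exp (- \<i> * complex_of_real (t \<bullet> l)) = cis ((-l) \<bullet> t)"
      by (simp add: cis_conv_exp inner_commute)
    then show "ker w c t * exp (- \<i> * complex_of_real (t \<bullet> l)) = (\<Prod>j\<in>UNIV. of_real (w * fejer (w * t $ j)) * cis ((c $ j - l $ j) * t $ j))"
      unfolding cis_inner ker_def
      by (simp add: prod.distrib[symmetric] mult.assoc cis_mult left_diff_distrib)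
  qed
  also have "\<dots> = (\<Prod>j\<in>UNIV. of_real (tri ((c $ j - l $ j)/w)))"
    using scaled_fejer_integral[OF assms] by (subst integral_prod_vec) (simp_all only:)
  also have "\<dots> = ker_hat w c l"
    unfolding ker_hat_def using tri_minus by (intro prod.cong refl) (metis minus_diff_eq minus_divide_left)
  finally show ?thesis .
qed

text \<open>Since \<open>fejer\<close> is nonnegative, the modulus of the kernel is
  \<open>ker w 0\<close>, whose integral is its transform at 0. Norm 1 makes every kernel act as a
  contraction, so cutting into pieces costs only the number of pieces.\<close>

lemma L1norm_ker:
  fixes c :: "real^'n" assumes "w > 0" shows "L1norm (ker w c) = 1"
proof -
  have "of_real (L1norm (ker w c)) = (\<integral>t. ker w (0::real^'n) t \<partial>lborel)"
    unfolding L1norm_def integral_complex_of_real[symmetric] using norm_ker[OF assms, of c] by simp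
  also have "\<dots> = fourier (ker w (0::real^'n)) 0" by (simp add: fourier_def)
  also have "\<dots> = 1" by (simp add: ker_fourier assms ker_hat_def tri_def)
  finally show ?thesis by simp
qed

lemma
  fixes t c :: "real^'n" assumes "w > 0"
  shows ker_hat_integrable: "integrable lborel (ker_hat w c)"
    and ker_inversion: "ker w c t = (\<integral>l. ker_hat w c l / (2 * pi) ^ CARD('n) * cis (l \<bullet> t) \<partial>lborel)"
proof -
  note I = scaled_tri_integral[OF assms]
  have "integrable lborel (\<lambda>x. complex_of_real (tri ((x - c $ j) / w)))" for j
    using I(1)[of "c $ j" 0] by simp
  then show "integrable lborel (ker_hat w c)"
    unfolding ker_hat_def[abs_def] by (rule integrable_prod_vec)
  have "(\<integral>l. ker_hat w c l / (2 * pi) ^ CARD('n) * cis (l \<bullet> t) \<partial>lborel)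
     = (\<integral>l. (\<Prod>j\<in>UNIV. of_real (tri ((l $ j - c $ j) / w)) * cis (l $ j * t $ j)) \<partial>lborel) / (2 * pi) ^ CARD('n)"
    by (simp add: ker_hat_def cis_inner prod.distrib mult.commute flip: integral_divide_zero)
  also have "\<dots> = (\<Prod>j\<in>(UNIV::'n set). 2 * pi * of_real (w * fejer (w * t $ j)) * cis (c $ j * t $ j)) / (2 * pi) ^ CARD('n)"
    using I by (subst integral_prod_vec) auto
  also have "\<dots> = ker w c t"
    by (simp add: ker_def prod.distrib)
  finally show "ker w c t = (\<integral>l. ker_hat w c l / (2 * pi) ^ CARD('n) * cis (l \<bullet> t) \<partial>lborel)" ..
qed

section \<open>Series\<close>

text \<open>The derivative of arcsin is the binomial series of (1 - x^2)^(-1/2) with coefficients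
  \<open>c n\<close>; integration divides by 2n + 1. Nonnegativity bounds the partial sums at 1 by
  values of arcsin, which gives absolute convergence up to the endpoints; the total mass pi/2 is
  what makes the constant in Bernstein's inequality exact.\<close>

lemma arcsin_power_series:
  obtains a :: "nat \<Rightarrow> real" where "\<And>n. 0 \<le> a n" "a sums (pi/2)"
    "\<And>y. \<bar>y\<bar> \<le> 1 \<Longrightarrow> (\<lambda>n. a n * y ^ (2*n+1)) sums arcsin y"
proof -
  define c where "c = (\<lambda>n. pochhammer (1/2::real) n / fact n)"
  define a where "a = (\<lambda>n. c n / (2 * real n + 1))"
  have c0: "0 \<le> c n" for n by (simp add: c_def pochhammer_nonneg)
  have a0: "0 \<le> a n" for n by (simp add: a_def c0)
  have cs: "(\<lambda>n. c n * z ^ n) sums ((1 - z) powr (-1/2))" if "\<bar>z\<bar> < 1" for z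
  proof -
    have "((-1/2::real) gchoose n) * (-z) ^ n = c n * z ^ n" for n
    proof -
      have "((-1) ^ n * p) * ((-1) ^ n * q) = ((-1) ^ n * (-1) ^ n) * (p * q)" for p q :: real
        by (simp only: mult_ac)
      then have "((-1) ^ n * p) * ((-1) ^ n * q) = p * q" for p q :: real by simp
      moreover have "(-1/2::real) gchoose n = (-1) ^ n * c n"
        using gbinomial_pochhammer[of "-1/2::real" n] by (simp add: c_def)
      ultimately show ?thesis using power_minus[of z n] by simp
    qed
    then show ?thesis using gen_binomial_real[of "-z" "-1/2"] that by simp
  qed
  have ac: "a n \<le> c n" for n
    unfolding a_def using c0[of n] by (simp add: divide_le_eq algebra_simps)
  have as: "summable (\<lambda>n. a n * z ^ n)" if "\<bar>z\<bar> < 1" for z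
  proof (rule summable_comparison_test')
    show "summable (\<lambda>n. c n * \<bar>z\<bar> ^ n)" using cs[of "\<bar>z\<bar>"] that by (auto simp: sums_iff)
    show "norm (a n * z ^ n) \<le> c n * \<bar>z\<bar> ^ n" if "n \<ge> 0" for n
      using a0[of n] ac[of n] by (auto simp: abs_mult power_abs intro!: mult_right_mono)
  qed
  \<comment> \<open>Splitting off x turns the odd series into a power series in z = x^2.\<close>
  define G where "G = (\<lambda>z. \<Sum>n. a n * z ^ n)"
  define F where "F = (\<lambda>x. x * G (x\<^sup>2))"
  have Gd: "(G has_real_derivative (\<Sum>n. diffs a n * z ^ n)) (at z)" if "\<bar>z\<bar> < 1" for z
  proof -
    have "norm z < norm ((1 + \<bar>z\<bar>)/2)" and "\<bar>(1+\<bar>z\<bar>)/2\<bar> < 1" using that by (auto simp: abs_if field_simps)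
    from termdiffs_strong[OF as[OF this(2)] this(1)] show ?thesis by (simp add: G_def)
  qed
  have zG: "(\<lambda>n. real n * a n * z ^ n) sums (z * (\<Sum>n. diffs a n * z ^ n))" if "\<bar>z\<bar> < 1" for z
  proof -
    have "summable (\<lambda>n. diffs a n * z ^ n)"
    proof (rule termdiff_converges)
      show "norm z < 1" using that by simp
      show "summable (\<lambda>n. a n * x ^ n)" if "norm x < 1" for x using as that by simp
    qed
    from sums_mult[OF diffs_equiv[OF this], of z]
    have "(\<lambda>n. z * (of_nat n * a n * z ^ (n - Suc 0))) sums (z * (\<Sum>n. diffs a n * z ^ n))" .
    moreover have "z * (of_nat n * a n * z ^ (n - Suc 0)) = real n * a n * z ^ n" for n
      by (cases n) auto
    ultimately show ?thesis by simp
  qed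
  have sq: "\<bar>x\<^sup>2\<bar> < 1" if "\<bar>x\<bar> < 1" for x :: real using that by (simp add: abs_square_less_1)
  have Fd: "(F has_real_derivative inverse (sqrt (1 - x\<^sup>2))) (at x)" if x: "\<bar>x\<bar> < 1" for x
  proof -
    let ?D = "\<Sum>n. diffs a n * (x\<^sup>2) ^ n"
    have "(F has_real_derivative (1 * G (x\<^sup>2) + (?D * (2 * x)) * x)) (at x)"
      unfolding F_def by (intro DERIV_mult DERIV_ident DERIV_chain'[of "\<lambda>x. x\<^sup>2" _ _ _ G] Gd sq x) (auto intro!: derivative_eq_intros)
    moreover have "1 * G (x\<^sup>2) + (?D * (2 * x)) * x = inverse (sqrt (1 - x\<^sup>2))"
    proof (rule sums_unique2)
      have "(\<lambda>n. a n * (x\<^sup>2) ^ n + 2 * (real n * a n * (x\<^sup>2) ^ n)) sums (G (x\<^sup>2) + 2 * (x\<^sup>2 * ?D))"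
        unfolding G_def by (intro sums_add sums_mult zG sq x summable_sums as)
      moreover have "a n * (x\<^sup>2) ^ n + 2 * (real n * a n * (x\<^sup>2) ^ n) = c n * (x\<^sup>2) ^ n" for n
      proof -
        have "a n + 2 * real n * a n = a n * (2 * real n + 1)" by (simp add: algebra_simps)
        also have "\<dots> = c n" by (simp add: a_def add_nonneg_eq_0_iff)
        finally have "a n + 2 * real n * a n = c n" .
        then have "c n * (x\<^sup>2)^n = (a n + 2 * real n * a n) * (x\<^sup>2) ^ n" by simp
        then show ?thesis by (simp add: algebra_simps)
      qed
      ultimately show "(\<lambda>n. c n * (x\<^sup>2) ^ n) sums (1 * G (x\<^sup>2) + (?D * (2 * x)) * x)"
        by (simp add: power2_eq_square algebra_simps)
      have "x\<^sup>2 < 1" using sq[OF x] by simp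
      then have "(1 - x\<^sup>2) powr (-1/2) = inverse (sqrt (1 - x\<^sup>2))"
        by (simp add: powr_minus powr_half_sqrt)
      then show "(\<lambda>n. c n * (x\<^sup>2) ^ n) sums inverse (sqrt (1 - x\<^sup>2))" using cs[OF sq[OF x]] by simp
    qed
    ultimately show ?thesis by simp
  qed
  have Farc: "F x = arcsin x" if x: "\<bar>x\<bar> < 1" for x
  proof -
    have "\<exists>C. \<forall>x\<in>{-1<..<1}. F x - arcsin x = C"
    proof (rule has_field_derivative_zero_constant)
      fix x :: real assume "x \<in> {-1<..<1}"
      then have "\<bar>x\<bar> < 1" by auto
      then have "((\<lambda>x. F x - arcsin x) has_real_derivative inverse (sqrt (1 - x\<^sup>2)) - inverse (sqrt (1 - x\<^sup>2))) (at x)"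
        by (intro DERIV_diff Fd DERIV_arcsin) auto
      then show "((\<lambda>x. F x - arcsin x) has_real_derivative 0) (at x within {-1<..<1})"
        by (auto intro: has_field_derivative_at_within)
    qed auto
    then obtain C where C: "\<And>x. x \<in> {-1<..<1} \<Longrightarrow> F x - arcsin x = C" by auto
    have "C = 0" using C[of 0] by (simp add: F_def)
    then show ?thesis using C[of x] x by (simp add: abs_less_iff)
  qed
  have Fs: "(\<lambda>n. a n * x ^ (2*n+1)) sums F x" if x: "\<bar>x\<bar> < 1" for x
  proof -
    have "(\<lambda>n. x * (a n * (x\<^sup>2) ^ n)) sums F x"
      unfolding F_def G_def by (intro sums_mult summable_sums as sq x)
    then show ?thesis by (simp add: power_mult mult.left_commute)
  qed
  \<comment> \<open>For 0 < x < 1 the partial sums are at most arcsin x, hence at most pi/2; then x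
    increases to 1.\<close>
  have part: "(\<Sum>n<N. a n) \<le> pi/2" for N
  proof (rule tendsto_upperbound)
    show "((\<lambda>x. \<Sum>n<N. a n * x ^ (2*n+1)) \<longlongrightarrow> (\<Sum>n<N. a n)) (at_left 1)"
      by (rule tendsto_eq_rhs[of _ "\<Sum>n<N. a n * 1 ^ (2*n+1)"]) (intro tendsto_intros, simp)
    have "eventually (\<lambda>x::real. x \<in> {0<..<1}) (at_left 1)" by (rule eventually_at_leftI[of 0]) auto
    then show "\<forall>\<^sub>F x in at_left 1. (\<Sum>n<N. a n * x ^ (2*n+1)) \<le> pi/2"
    proof eventually_elim
      case (elim x)
      then have x: "\<bar>x\<bar> < 1" by auto
      have "(\<Sum>n<N. a n * x ^ (2*n+1)) \<le> (\<Sum>n. a n * x ^ (2*n+1))"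
        by (rule sum_le_suminf) (use elim Fs[OF x] a0 in \<open>auto simp: sums_iff\<close>)
      also have "\<dots> = arcsin x" using Fs[OF x] Farc[OF x] by (simp add: sums_iff)
      also have "\<dots> \<le> pi/2" using elim by (intro arcsin_ubound) auto
      finally show ?case .
    qed
  qed simp
  have sa: "summable a"
  proof (rule bounded_imp_summable)
    show "(\<Sum>k\<le>n. a k) \<le> pi/2" for n using part[of "Suc n"] by (simp only: lessThan_Suc_atMost)
  qed (rule a0)
  define H where "H = (\<lambda>x. \<Sum>n. a n * x ^ (2*n+1))"
  have dom: "\<bar>a n * x ^ (2*n+1)\<bar> \<le> a n" if "\<bar>x\<bar> \<le> 1" for n x
    using that a0[of n] power_le_one[of "\<bar>x\<bar>" "2*n+1"] by (simp only: abs_mult power_abs abs_of_nonneg mult_left_le abs_ge_zero)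
  have sH: "(\<lambda>n. a n * x ^ (2*n+1)) sums H x" if "\<bar>x\<bar> \<le> 1" for x
    unfolding H_def by (intro summable_sums summable_comparison_test'[OF sa]) (use dom[OF that] in auto)
  have cH: "continuous_on {-1..1} H"
  proof (rule uniform_limit_theorem)
    show "uniform_limit {-1..1} (\<lambda>N x. \<Sum>n<N. a n * x ^ (2*n+1)) H sequentially"
      unfolding H_def by (rule Weierstrass_m_test[OF _ sa]) (use dom in auto)
    show "\<forall>\<^sub>F N in sequentially. continuous_on {-1..1} (\<lambda>x. \<Sum>n<N. a n * x ^ (2*n+1))"
      by (intro always_eventually allI continuous_intros)
  qed simp
  \<comment> \<open>Both sides are continuous on the closed interval and agree inside, hence also at
    the endpoints.\<close>
  have Heq: "H x = arcsin x" if "x \<in> {-1..1}" for x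
  proof (rule continuous_constant_on_closure[of "{-1<..<1}" "\<lambda>x. H x - arcsin x" 0 x, simplified])
    show "continuous_on {-1..1} (\<lambda>x. H x - arcsin x)" by (intro continuous_intros cH) auto
    show "H x = arcsin x" if "-1 < x \<and> x < 1" for x
      using sH[of x] Fs[of x] Farc[of x] that by (auto simp: sums_iff)
    show "-1 \<le> x \<and> x \<le> 1" using that by simp
  qed
  show ?thesis
  proof
    show "a sums (pi/2)" using sH[of 1] Heq[of 1] by simp
    show "(\<lambda>n. a n * y ^ (2*n+1)) sums arcsin y" if "\<bar>y\<bar> \<le> 1" for y
      using sH[OF that] Heq[of y] that by (auto simp: abs_le_iff)
  qed (rule a0)
qed

text \<open>The factors live in different operator spaces, so the product is a bounded bilinear map.
  The terms in the square outside the triangle are dominated by the corresponding terms for the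
  norms, which vanish in the limit by the real Cauchy product.\<close>

lemma bilinear_Cauchy_product_sums:
  fixes a :: "nat \<Rightarrow> 'a::banach" and b :: "nat \<Rightarrow> 'b::banach" and prod :: "'a \<Rightarrow> 'b \<Rightarrow> 'c::banach"
  assumes bl: "bounded_bilinear prod"
    and a: "summable (\<lambda>n. norm (a n))" and b: "summable (\<lambda>n. norm (b n))"
  shows "summable (\<lambda>n. norm (\<Sum>i\<le>n. prod (a i) (b (n - i))))"
    and "(\<lambda>n. \<Sum>i\<le>n. prod (a i) (b (n - i))) sums prod (suminf a) (suminf b)"
proof -
  interpret bounded_bilinear prod by fact
  obtain K where K: "K > 0" "\<And>x y. norm (prod x y) \<le> norm x * norm y * K" using pos_bounded by blast
  have le: "norm (\<Sum>i\<le>n. prod (a i) (b (n - i))) \<le> K * (\<Sum>i\<le>n. norm (a i) * norm (b (n - i)))" for n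
    unfolding sum_distrib_left by (rule sum_norm_le) (use K(2) in \<open>simp add: mult.commute\<close>)
  have sN: "summable (\<lambda>n. \<Sum>i\<le>n. norm (a i) * norm (b (n - i)))"
    by (rule summable_Cauchy_product) (use a b in auto)
  show S: "summable (\<lambda>n. norm (\<Sum>i\<le>n. prod (a i) (b (n - i))))"
    by (rule summable_comparison_test'[OF summable_mult[OF sN, of K]]) (use le in auto)
  define sq where "sq = (\<lambda>n::nat. {..<n} \<times> {..<n})"
  define tr where "tr = (\<lambda>n::nat. {(i,j). i + j < n})"
  have fin: "finite (sq n)" "finite (tr n)" "tr n \<subseteq> sq n" for n
  proof -
    show "tr n \<subseteq> sq n" by (auto simp: sq_def tr_def)
    show "finite (sq n)" by (simp add: sq_def)
    then show "finite (tr n)" using \<open>tr n \<subseteq> sq n\<close> finite_subset by blast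
  qed
  have lim_sq: "(\<lambda>n. \<Sum>(i,j)\<in>sq n. prod (a i) (b j)) \<longlonglongrightarrow> prod (suminf a) (suminf b)"
  proof -
    have "(\<lambda>n. prod (\<Sum>i<n. a i) (\<Sum>j<n. b j)) \<longlonglongrightarrow> prod (suminf a) (suminf b)"
      by (rule tendsto[OF summable_LIMSEQ[OF summable_norm_cancel[OF a]] summable_LIMSEQ[OF summable_norm_cancel[OF b]]])
    moreover have "prod (\<Sum>i<n. a i) (\<Sum>j<n. b j) = (\<Sum>(i,j)\<in>sq n. prod (a i) (b j))" for n
      unfolding sq_def sum.cartesian_product[symmetric] sum_left sum_right by (rule sum.swap)
    ultimately show ?thesis by simp
  qed
  have "(\<lambda>n. (\<Sum>(i,j)\<in>sq n. norm (a i) * norm (b j)) - (\<Sum>(i,j)\<in>tr n. norm (a i) * norm (b j))) \<longlonglongrightarrow> (\<Sum>n. norm (a n)) * (\<Sum>n. norm (b n)) - (\<Sum>n. norm (a n)) * (\<Sum>n. norm (b n))"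
  proof (rule tendsto_diff)
    have "(\<lambda>n. (\<Sum>i<n. norm (a i)) * (\<Sum>j<n. norm (b j))) \<longlonglongrightarrow> (\<Sum>n. norm (a n)) * (\<Sum>n. norm (b n))"
      by (intro tendsto_mult summable_LIMSEQ a b)
    then show "(\<lambda>n. (\<Sum>(i,j)\<in>sq n. norm (a i) * norm (b j))) \<longlonglongrightarrow> (\<Sum>n. norm (a n)) * (\<Sum>n. norm (b n))"
      by (simp add: sq_def sum_product sum.cartesian_product)
    show "(\<lambda>n. (\<Sum>(i,j)\<in>tr n. norm (a i) * norm (b j))) \<longlonglongrightarrow> (\<Sum>n. norm (a n)) * (\<Sum>n. norm (b n))"
      unfolding tr_def sum.triangle_reindex using Cauchy_product_sums[of "\<lambda>n. norm (a n)" "\<lambda>n. norm (b n)"] a b by (simp add: sums_def)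
  qed
  then have lim0: "(\<lambda>n. K * ((\<Sum>(i,j)\<in>sq n. norm (a i) * norm (b j)) - (\<Sum>(i,j)\<in>tr n. norm (a i) * norm (b j)))) \<longlonglongrightarrow> 0"
    by (intro tendsto_mult_right_zero) simp
  have "(\<lambda>n. (\<Sum>(i,j)\<in>sq n. prod (a i) (b j)) - (\<Sum>(i,j)\<in>tr n. prod (a i) (b j))) \<longlonglongrightarrow> 0"
  proof (rule Lim_null_comparison[OF _ lim0], rule always_eventually, rule allI)
    fix n
    have "norm ((\<Sum>(i,j)\<in>sq n. prod (a i) (b j)) - (\<Sum>(i,j)\<in>tr n. prod (a i) (b j)))
        = norm (\<Sum>(i,j)\<in>sq n - tr n. prod (a i) (b j))"
      by (simp add: sum_diff[OF fin(1) fin(3)])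
    also have "\<dots> \<le> (\<Sum>(i,j)\<in>sq n - tr n. K * (norm (a i) * norm (b j)))"
      by (rule sum_norm_le) (use K(2) in \<open>auto simp: mult.commute\<close>)
    also have "\<dots> = K * (\<Sum>(i,j)\<in>sq n - tr n. norm (a i) * norm (b j))"
      by (simp add: sum_distrib_left case_prod_unfold)
    also have "\<dots> = K * ((\<Sum>(i,j)\<in>sq n. norm (a i) * norm (b j)) - (\<Sum>(i,j)\<in>tr n. norm (a i) * norm (b j)))"
      by (simp add: sum_diff[OF fin(1) fin(3)])
    finally show "norm ((\<Sum>(i,j)\<in>sq n. prod (a i) (b j)) - (\<Sum>(i,j)\<in>tr n. prod (a i) (b j))) \<le> \<dots>" .
  qed
  from tendsto_diff[OF lim_sq this] have "(\<lambda>n. \<Sum>(i,j)\<in>tr n. prod (a i) (b j)) \<longlonglongrightarrow> prod (suminf a) (suminf b)"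
    by simp
  then show "(\<lambda>n. \<Sum>i\<le>n. prod (a i) (b (n - i))) sums prod (suminf a) (suminf b)"
    unfolding tr_def sum.triangle_reindex sums_def .
qed

text \<open>Series known to agree only for real s are identified coefficientwise; this is what
  permits evaluation at the imaginary unit.\<close>

lemma power_series_coeff_unique:
  fixes a b :: "nat \<Rightarrow> 'a::banach"
  assumes a: "summable (\<lambda>n. norm (a n))" and b: "summable (\<lambda>n. norm (b n))"
    and eq: "\<And>s::real. \<bar>s\<bar> \<le> 1 \<Longrightarrow> (\<Sum>n. s ^ n *\<^sub>R a n) = (\<Sum>n. s ^ n *\<^sub>R b n)"
  shows "a n = b n"
proof -
  define d where "d = (\<lambda>n. a n - b n)"
  have d: "summable (\<lambda>n. norm (d n))"
    by (rule summable_comparison_test'[OF summable_add[OF a b]]) (simp add: d_def norm_triangle_ineq4)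
  have sm: "summable (\<lambda>n. s ^ n *\<^sub>R f n)" if "summable (\<lambda>n. norm (f n))" "\<bar>s\<bar> \<le> 1" for s :: real and f :: "nat \<Rightarrow> 'a"
    by (rule summable_comparison_test'[OF that(1)]) (use that(2) in \<open>simp add: power_abs power_le_one mult_left_le_one_le\<close>)
  have z: "(\<Sum>n. s ^ n *\<^sub>R d n) = 0" if "\<bar>s\<bar> \<le> 1" for s :: real
    using suminf_diff[OF sm[OF a that] sm[OF b that]] eq[OF that] by (simp add: d_def scaleR_diff_right)
  have "d n = 0" for n
  proof (induction n rule: less_induct)
    case (less n)
    \<comment> \<open>With the earlier coefficients zero, division by s^n leaves a series that
      vanishes for small s > 0; by continuity its value at 0, which is \<open>d n\<close>, vanishes
      too.\<close>
    define g where "g = (\<lambda>k. d (k + n))"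
    have g: "summable (\<lambda>k. norm (g k))" unfolding g_def using d by (subst summable_iff_shift)
    have g0: "(\<Sum>k. s ^ k *\<^sub>R g k) = 0" if s: "\<bar>s\<bar> \<le> 1" "s \<noteq> 0" for s :: real
    proof -
      have "0 = (\<Sum>k. s ^ (k+n) *\<^sub>R d (k+n)) + (\<Sum>k<n. s ^ k *\<^sub>R d k)"
        using suminf_split_initial_segment[OF sm[OF d s(1)], of n] z[OF s(1)] by simp
      also have "(\<Sum>k<n. s ^ k *\<^sub>R d k) = 0" using less by simp
      also have "(\<Sum>k. s ^ (k+n) *\<^sub>R d (k+n)) = s ^ n *\<^sub>R (\<Sum>k. s ^ k *\<^sub>R g k)"
        using suminf_scaleR_right[OF sm[OF g s(1)], of "s ^ n"] by (simp add: g_def power_add mult.commute)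
      finally show ?thesis using s by simp
    qed
    have cont: "continuous_on {-1..1} (\<lambda>s::real. \<Sum>k. s ^ k *\<^sub>R g k)"
    proof (rule uniform_limit_theorem)
      show "uniform_limit {-1..1} (\<lambda>N s. \<Sum>k<N. s ^ k *\<^sub>R g k) (\<lambda>s. \<Sum>k. s ^ k *\<^sub>R g k) sequentially"
        by (rule Weierstrass_m_test[OF _ g]) (auto simp: power_abs abs_le_iff intro!: mult_left_le_one_le power_le_one)
    qed (auto intro!: always_eventually continuous_intros)
    have "(\<Sum>k. (0::real) ^ k *\<^sub>R g k) = 0"
    proof (rule continuous_constant_on_closure[of "{0<..<1}" "\<lambda>s. \<Sum>k. s ^ k *\<^sub>R g k"])
      show "continuous_on (closure {0<..<1}) (\<lambda>s::real. \<Sum>k. s ^ k *\<^sub>R g k)"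
        by (rule continuous_on_subset[OF cont]) auto
    qed (auto intro: g0)
    moreover have "(\<Sum>k. (0::real) ^ k *\<^sub>R g k) = g 0"
      using suminf_finite[of "{0}" "\<lambda>k. (0::real) ^ k *\<^sub>R g k"] by (simp add: power_0_left)
    ultimately show "d n = 0" by (simp add: g_def)
  qed
  then show ?thesis by (simp add: d_def)
qed

section \<open>Complex operators and modules\<close>

lemma bounded_linear_cscale: "bounded_linear (cscale c :: 'a::complex_banach \<Rightarrow> 'a)"
proof (rule bounded_linear_intro)
  show "cscale c (r *\<^sub>R x) = r *\<^sub>R cscale c x" for r and x :: 'a
    by (simp add: cscale_of_real[symmetric] cscale_mult mult.commute)
  show "norm (cscale c x) \<le> norm x * cmod c" for x :: 'a by (simp add: norm_cscale mult.commute)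
qed (rule cscale_add_right)

lemma scaleCL_apply: "blinfun_apply (scaleCL c A) v = cscale c (blinfun_apply A v)"
  unfolding scaleCL_def
  by (rule arg_cong[where f="\<lambda>f. f v"], rule bounded_linear_Blinfun_apply)
     (rule bounded_linear_compose[OF bounded_linear_cscale blinfun.bounded_linear_right])

lemma norm_scaleCL_le: "norm (scaleCL c A) \<le> cmod c * norm A"
  by (rule norm_blinfun_bound)
     (auto simp: scaleCL_apply norm_cscale mult.assoc intro!: mult_left_mono norm_blinfun)

lemma scaleCL_of_real: "scaleCL (of_real r) A = r *\<^sub>R A"
  by (rule blinfun_eqI) (simp add: scaleCL_apply cscale_of_real blinfun.scaleR_left)

lemma scaleCL_0 [simp]: "scaleCL 0 A = 0" using scaleCL_of_real[of 0 A] by simp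

lemma scaleCL_add_right: "scaleCL c (A + B) = scaleCL c A + scaleCL c B"
  by (rule blinfun_eqI) (simp add: scaleCL_apply blinfun.add_left cscale_add_right)

lemma scaleCL_sum: "scaleCL c (\<Sum>i\<in>S. A i) = (\<Sum>i\<in>S. scaleCL c (A i))"
proof (induction S rule: infinite_finite_induct)
  have "scaleCL c (0 :: 'a \<Rightarrow>\<^sub>L 'b) = 0"
    by (metis add_cancel_right_right scaleCL_add_right)
  then show "scaleCL c (sum A {}) = (\<Sum>i\<in>{}. scaleCL c (A i))"
    and "infinite S \<Longrightarrow> scaleCL c (sum A S) = (\<Sum>i\<in>S. scaleCL c (A i))" for S by auto
qed (auto simp: scaleCL_add_right)

lemma scaleCL_compose:
  "A \<in> cblin \<Longrightarrow> scaleCL a A o\<^sub>L scaleCL b B = scaleCL (a * b) (A o\<^sub>L B)"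
  by (rule blinfun_eqI) (simp add: scaleCL_apply cblin_def cscale_mult)

lemma
  shows cblin_add: "A \<in> cblin \<Longrightarrow> B \<in> cblin \<Longrightarrow> A + B \<in> cblin"
    and cblin_scaleCL: "A \<in> cblin \<Longrightarrow> scaleCL c A \<in> cblin"
    and cblin_compose: "C \<in> cblin \<Longrightarrow> A \<in> cblin \<Longrightarrow> C o\<^sub>L A \<in> cblin"
  by (simp_all add: cblin_def blinfun.add_left cscale_add_right scaleCL_apply cscale_mult mult.commute)

lemma cblin_scaleR: "A \<in> cblin \<Longrightarrow> r *\<^sub>R A \<in> cblin"
  using cblin_scaleCL[of A "of_real r"] by (simp add: scaleCL_of_real)

lemma cblin_0: "0 \<in> cblin"
  using bounded_linear_cscale linear_0 bounded_linear.linear by (fastforce simp: cblin_def)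

lemma cblin_uminus: "A \<in> cblin \<Longrightarrow> - A \<in> cblin"
  using cblin_scaleR[of A "-1"] by simp

lemma cblin_diff: "A \<in> cblin \<Longrightarrow> B \<in> cblin \<Longrightarrow> A - B \<in> cblin"
  using cblin_add[OF _ cblin_uminus, of A B] by simp

lemma cblin_sum: "(\<And>i. i \<in> S \<Longrightarrow> A i \<in> cblin) \<Longrightarrow> sum A S \<in> cblin"
  by (induction S rule: infinite_finite_induct) (auto intro: cblin_0 cblin_add)

lemma closed_cblin: "closed (cblin :: ('a::complex_banach \<Rightarrow>\<^sub>L 'b::complex_banach) set)"
  unfolding cblin_def
  by (intro closed_Collect_all closed_Collect_eq continuous_intros
       bounded_linear.continuous_on[OF bounded_linear_cscale])

lemma cblin_sums:
  assumes "\<And>n. A n \<in> cblin" "A sums B" shows "B \<in> cblin"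
  by (rule closed_sequentially[OF closed_cblin _ assms(2)[unfolded sums_def]]) (auto intro: cblin_sum assms)

lemma cblin_inverse:
  assumes A: "A \<in> cblin" and BA: "B o\<^sub>L A = id_blinfun" and AB: "A o\<^sub>L B = id_blinfun"
  shows "B \<in> cblin"
proof -
  have "A (B v) = v" "B (A w) = w" for v w
    using arg_cong[OF AB, of "\<lambda>f. blinfun_apply f v"] arg_cong[OF BA, of "\<lambda>f. blinfun_apply f w"] by simp_all
  then show ?thesis using A unfolding cblin_def by (auto, metis)
qed

lemma L1norm_nonneg: "0 \<le> L1norm f" by (simp add: L1norm_def)

lemma
  fixes g :: "nat \<Rightarrow> real^'n \<Rightarrow> complex"
  assumes g: "\<And>k. integrable lborel (g k)" "summable (\<lambda>k. L1norm (g k))" "\<And>t. summable (\<lambda>k. norm (g k t))"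
  shows integrable_series: "integrable lborel (\<lambda>t. \<Sum>k. g k t)"
    and L1norm_series_le: "L1norm (\<lambda>t. \<Sum>k. g k t) \<le> (\<Sum>k. L1norm (g k))"
proof -
  show i: "integrable lborel (\<lambda>t. \<Sum>k. g k t)"
    by (rule integrable_suminf) (use g in \<open>auto simp: L1norm_def\<close>)
  have i2: "integrable lborel (\<lambda>t. \<Sum>k. norm (g k t))"
    by (rule integrable_suminf) (use g in \<open>auto simp: L1norm_def\<close>)
  have "L1norm (\<lambda>t. \<Sum>k. g k t) \<le> (\<integral>t. (\<Sum>k. norm (g k t)) \<partial>lborel)"
    unfolding L1norm_def by (rule integral_mono) (use i i2 g(3) in \<open>auto intro: summable_norm\<close>)
  also have "\<dots> = (\<Sum>k. L1norm (g k))"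
    unfolding L1norm_def by (rule integral_suminf) (use g in \<open>auto simp: L1norm_def\<close>)
  finally show "L1norm (\<lambda>t. \<Sum>k. g k t) \<le> (\<Sum>k. L1norm (g k))" .
qed

section \<open>One module: algebra and continuity of the action\<close>

locale L1_mod =
  fixes T :: "real^'n \<Rightarrow> ('a::complex_banach \<Rightarrow>\<^sub>L 'b::complex_banach) \<Rightarrow> ('a \<Rightarrow>\<^sub>L 'b)"
    and act :: "(real^'n \<Rightarrow> complex) \<Rightarrow> ('a \<Rightarrow>\<^sub>L 'b) \<Rightarrow> ('a \<Rightarrow>\<^sub>L 'b)"
  assumes L1_module: "L1_module T act"
begin

lemma
  shows T_norm: "x \<in> cblin \<Longrightarrow> norm (T t x) = norm x"
    and T_zero: "x \<in> cblin \<Longrightarrow> T 0 x = x"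
  using L1_module by (simp_all add: L1_module_def isometric_rep_def)

lemmas module_axioms = L1_module[unfolded L1_module_def]

lemma act_cblin: "integrable lborel f \<Longrightarrow> x \<in> cblin \<Longrightarrow> act f x \<in> cblin"
  using module_axioms[THEN conjunct2, THEN conjunct1] by simp

lemma act_add_left: "integrable lborel f \<Longrightarrow> integrable lborel g \<Longrightarrow> x \<in> cblin \<Longrightarrow> act (\<lambda>t. f t + g t) x = act f x + act g x"
  using module_axioms[THEN conjunct2, THEN conjunct2, THEN conjunct1] by simp

lemma act_cmult: "integrable lborel f \<Longrightarrow> x \<in> cblin \<Longrightarrow> act (\<lambda>t. c * f t) x = scaleCL c (act f x)"
  using module_axioms[THEN conjunct2, THEN conjunct2, THEN conjunct2, THEN conjunct1] by simp

lemma act_add: "integrable lborel f \<Longrightarrow> x \<in> cblin \<Longrightarrow> y \<in> cblin \<Longrightarrow> act f (x + y) = act f x + act f y"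
  using module_axioms[THEN conjunct2, THEN conjunct2, THEN conjunct2, THEN conjunct2, THEN conjunct1] by simp

lemma act_scaleCL: "integrable lborel f \<Longrightarrow> x \<in> cblin \<Longrightarrow> act f (scaleCL c x) = scaleCL c (act f x)"
  using module_axioms[THEN conjunct2, THEN conjunct2, THEN conjunct2, THEN conjunct2, THEN conjunct2, THEN conjunct1] by simp

lemmas module_axioms2 = module_axioms[THEN conjunct2, THEN conjunct2, THEN conjunct2, THEN conjunct2, THEN conjunct2, THEN conjunct2]

lemma act_conv: "integrable lborel f \<Longrightarrow> integrable lborel g \<Longrightarrow> x \<in> cblin \<Longrightarrow> act (conv f g) x = act f (act g x)"
  using module_axioms2[THEN conjunct1] by simp

lemma act_norm: "integrable lborel f \<Longrightarrow> x \<in> cblin \<Longrightarrow> norm (act f x) \<le> L1norm f * norm x"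
  using module_axioms2[THEN conjunct2, THEN conjunct1] by simp

lemma
  assumes "integrable lborel f" "x \<in> cblin"
  shows T_act: "T t (act f x) = act (\<lambda>s. f (s + t)) x"
    and act_T: "act (\<lambda>s. f (s + t)) x = act f (T t x)"
  using module_axioms2[THEN conjunct2, THEN conjunct2, THEN conjunct1, rule_format, OF assms(2,1), of t] by auto

lemma act_nondegenerate: "x \<in> cblin \<Longrightarrow> (\<And>f. integrable lborel f \<Longrightarrow> act f x = 0) \<Longrightarrow> x = 0"
  using module_axioms2[THEN conjunct2, THEN conjunct2, THEN conjunct2, THEN conjunct1] by blast

lemma act_scaleR: "integrable lborel f \<Longrightarrow> x \<in> cblin \<Longrightarrow> act f (r *\<^sub>R x) = r *\<^sub>R act f x"
  using act_scaleCL[of f x "of_real r"] by (simp add: scaleCL_of_real)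

lemma act_zero_left: "x \<in> cblin \<Longrightarrow> act (\<lambda>t. 0) x = 0"
  using act_cmult[of "\<lambda>t. 0" x 0] by simp

lemma act_zero: "integrable lborel f \<Longrightarrow> act f 0 = 0"
  using act_scaleR[of f 0 0] by (simp add: cblin_0)

lemma act_diff: "integrable lborel f \<Longrightarrow> x \<in> cblin \<Longrightarrow> y \<in> cblin \<Longrightarrow> act f (x - y) = act f x - act f y"
  using act_add[of f x "(-1) *\<^sub>R y"] act_scaleR[of f y "-1"] by (simp add: cblin_uminus)

lemma act_diff_left:
  assumes "integrable lborel f" "integrable lborel g" "x \<in> cblin"
  shows "act (\<lambda>t. f t - g t) x = act f x - act g x"
  using act_add_left[of f "\<lambda>t. -1 * g t" x] act_cmult[of g x "-1"] assms scaleCL_of_real[of "-1" "act g x"] by simp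

lemma act_sum: "integrable lborel f \<Longrightarrow> (\<And>i. i \<in> S \<Longrightarrow> x i \<in> cblin) \<Longrightarrow> act f (\<Sum>i\<in>S. x i) = (\<Sum>i\<in>S. act f (x i))"
  by (induction S rule: infinite_finite_induct) (auto simp: act_zero act_add cblin_sum)

lemma act_sum_left: "(\<And>i. i \<in> S \<Longrightarrow> integrable lborel (f i)) \<Longrightarrow> x \<in> cblin \<Longrightarrow> act (\<lambda>t. \<Sum>i\<in>S. f i t) x = (\<Sum>i\<in>S. act (f i) x)"
  by (induction S rule: infinite_finite_induct) (auto simp: act_zero_left act_add_left)

lemma act_sums:
  assumes f: "integrable lborel f" and x: "\<And>n. x n \<in> cblin" "x sums s"
  shows "(\<lambda>n. act f (x n)) sums act f s"
  unfolding sums_def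
proof (rule LIM_zero_cancel, rule Lim_null_comparison)
  have s: "s \<in> cblin" by (rule cblin_sums[OF x])
  show "\<forall>\<^sub>F n in sequentially. norm ((\<Sum>i<n. act f (x i)) - act f s) \<le> L1norm f * norm ((\<Sum>i<n. x i) - s)"
    by (intro always_eventually allI, subst act_sum[symmetric, OF f x(1)], subst act_diff[symmetric])
       (auto intro!: act_norm f s x cblin_sum cblin_diff)
  have "(\<lambda>n. (\<Sum>i<n. x i) - s) \<longlonglongrightarrow> 0" using x(2) by (simp add: sums_def LIM_zero_iff)
  then show "(\<lambda>n. L1norm f * norm ((\<Sum>i<n. x i) - s)) \<longlonglongrightarrow> 0"
    by (intro tendsto_mult_right_zero tendsto_norm_zero)
qed

lemma act_series_left:
  assumes g: "\<And>k. integrable lborel (g k)" "summable (\<lambda>k. L1norm (g k))" "\<And>t. summable (\<lambda>k. norm (g k t))"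
    and x: "x \<in> cblin"
  shows "(\<lambda>k. act (g k) x) sums act (\<lambda>t. \<Sum>k. g k t) x"
  unfolding sums_def
proof (rule LIM_zero_cancel, rule Lim_null_comparison, intro always_eventually allI)
  fix n
  note i = integrable_series[OF g]
  have sh: "(\<Sum>k. g k t) - (\<Sum>k<n. g k t) = (\<Sum>k. g (k+n) t)" for t
    using suminf_split_initial_segment[OF summable_norm_cancel[OF g(3)[of t]], of n] by simp
  have "norm ((\<Sum>k<n. act (g k) x) - act (\<lambda>t. \<Sum>k. g k t) x) = norm (act (\<lambda>t. (\<Sum>k. g k t) - (\<Sum>k<n. g k t)) x)"
    by (subst act_diff_left) (auto simp: act_sum_left g x i norm_minus_commute)
  also have "\<dots> \<le> L1norm (\<lambda>t. (\<Sum>k. g k t) - (\<Sum>k<n. g k t)) * norm x"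
    by (rule act_norm) (use i g x in auto)
  also have "\<dots> \<le> (\<Sum>k. L1norm (g (k+n))) * norm x"
    unfolding sh by (intro mult_right_mono L1norm_series_le)
      (use g in \<open>auto simp: summable_iff_shift[of "\<lambda>k. L1norm (g k)"] summable_iff_shift[of "\<lambda>k. norm (g k _)"]\<close>)
  finally show "norm ((\<Sum>k<n. act (g k) x) - act (\<lambda>t. \<Sum>k. g k t) x) \<le> (\<Sum>k. L1norm (g (k+n))) * norm x" .
next
  show "(\<lambda>n. (\<Sum>k. L1norm (g (k+n))) * norm x) \<longlonglongrightarrow> 0"
    by (intro tendsto_mult_left_zero suminf_exist_split2[OF g(2)])
qed

end

section \<open>Fourier multipliers\<close>

text \<open>\<open>P\<close> is the Fourier transform of \<open>f\<close> divided by \<open>(2\<pi>)\<^sup>d\<close>.\<close>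

definition frep :: "(real^'n \<Rightarrow> complex) \<Rightarrow> (real^'n \<Rightarrow> complex) \<Rightarrow> bool" where
  "frep f P \<longleftrightarrow> integrable lborel f \<and> integrable lborel P \<and> (\<forall>t. f t = (\<integral>l. P l * cis (l \<bullet> t) \<partial>lborel))"

lemma frepI: "integrable lborel f \<Longrightarrow> integrable lborel P \<Longrightarrow> (\<And>t. f t = (\<integral>l. P l * cis (l \<bullet> t) \<partial>lborel)) \<Longrightarrow> frep f P"
  by (auto simp: frep_def)

lemma frepD:
  assumes "frep f P"
  shows "integrable lborel f" "integrable lborel P" "f t = (\<integral>l. P l * cis (l \<bullet> t) \<partial>lborel)"
  using assms by (auto simp: frep_def)

lemma frep_unique: "frep f P \<Longrightarrow> frep g P \<Longrightarrow> f = g"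
  by (auto simp: frep_def)

lemma frep_cmult: "frep f P \<Longrightarrow> frep (\<lambda>t. c * f t) (\<lambda>l. c * P l)"
  by (rule frepI) (auto simp: frepD(1,2), simp add: frepD(3) mult.assoc)

lemma frep_0: "frep (\<lambda>_. 0) (\<lambda>_. 0)"
  by (auto simp: frep_def)

lemma borel_measurable_cis [measurable]: "cis \<in> borel_measurable borel"
  by (intro borel_measurable_continuous_onI continuous_on_cis continuous_on_id)

lemma integrable_mult_cis:
  fixes t :: "real^'n"
  assumes "integrable lborel P" shows "integrable lborel (\<lambda>l. P l * cis (l \<bullet> t))"
proof -
  have [measurable]: "P \<in> borel_measurable borel" using assms by auto
  show ?thesis by (rule Bochner_Integration.integrable_bound[OF assms]) (auto simp: norm_mult)
qed

lemma frep_add: 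
  assumes "frep f P" "frep g Q" shows "frep (\<lambda>t. f t + g t) (\<lambda>l. P l + Q l)"
proof (rule frepI)
  show "f t + g t = (\<integral>l. (P l + Q l) * cis (l \<bullet> t) \<partial>lborel)" for t
    unfolding frepD(3)[OF assms(1)] frepD(3)[OF assms(2)]
    by (simp add: distrib_right integrable_mult_cis frepD(2)[OF assms(1)] frepD(2)[OF assms(2)])
qed (use frepD(1,2)[OF assms(1)] frepD(1,2)[OF assms(2)] in auto)

lemma frep_sum: 
  assumes "\<And>i. i \<in> S \<Longrightarrow> frep (f i) (P i)" shows "frep (\<lambda>t. \<Sum>i\<in>S. f i t) (\<lambda>l. \<Sum>i\<in>S. P i l)"
  using assms by (induction S rule: infinite_finite_induct) (auto simp: frep_0 frep_add)

lemma frep_ker: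
  fixes c :: "real^'n"
  assumes "w > 0" shows "frep (ker w c) (\<lambda>l. ker_hat w c l / (2 * pi) ^ CARD('n))"
  unfolding frep_def using ker_integrable[OF assms] ker_hat_integrable[OF assms] ker_inversion[OF assms]
  by auto

lemma
  fixes f :: "real^'n \<Rightarrow> complex"
  shows integrable_translate: "integrable lborel f \<Longrightarrow> integrable lborel (\<lambda>t. f (t + s))"
    and integral_translate: "(\<integral>t. f (t + s) \<partial>lborel) = (\<integral>t. f t \<partial>lborel)"
proof -
  have d: "lborel = distr lborel borel (\<lambda>t::real^'n. t + s)"
  proof -
    have "(\<lambda>t. t + s) = (+) s" by (auto simp: add.commute)
    then show ?thesis using lborel_distr_plus[of s] by simp
  qed
  show "integrable lborel (\<lambda>t. f (t + s))" if "integrable lborel f"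
  proof -
    have "integrable (distr lborel borel (\<lambda>t. t + s)) f" using that d by simp
    then show ?thesis by (subst (asm) integrable_distr_eq) (use that in auto)
  qed
  show "(\<integral>t. f (t + s) \<partial>lborel) = (\<integral>t. f t \<partial>lborel)"
  proof (cases "f \<in> borel_measurable borel")
    case True
    then show ?thesis by (subst (2) d, subst integral_distr) auto
  next
    case False
    have "\<not> integrable lborel f" using False by auto
    moreover have "\<not> integrable lborel (\<lambda>t. f (t + s))"
    proof
      assume "integrable lborel (\<lambda>t. f (t + s))"
      then have [measurable]: "(\<lambda>t. f (t + s)) \<in> borel_measurable borel" by auto
      have "(\<lambda>t. f ((t - s) + s)) \<in> borel_measurable borel" by measurable
      with False show False by simp
    qed
    ultimately show ?thesis by (simp add: not_integrable_integral_eq)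
  qed
qed

lemma L1norm_translate: "L1norm (\<lambda>t. f (t + s)) = L1norm f"
proof -
  have "complex_of_real (L1norm (\<lambda>t. f (t + s))) = complex_of_real (L1norm f)"
    unfolding L1norm_def integral_complex_of_real[symmetric] by (rule integral_translate)
  then show ?thesis by simp
qed

lemma L1norm_add_le:
  assumes "integrable lborel f" "integrable lborel g"
  shows "L1norm (\<lambda>t. f t + g t) \<le> L1norm f + L1norm g"
proof -
  have "L1norm (\<lambda>t. f t + g t) \<le> (\<integral>t. norm (f t) + norm (g t) \<partial>lborel)"
    unfolding L1norm_def by (rule integral_mono) (use assms in \<open>auto intro: norm_triangle_ineq\<close>)
  then show ?thesis using assms by (simp add: L1norm_def)
qed

lemma L1norm_cmult: "L1norm (\<lambda>t. c * f t) = norm c * L1norm f"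
  by (simp add: L1norm_def norm_mult)

text \<open>Together with \<open>T_act\<close> this identifies \<open>T (s *\<^sub>R v)\<close> with
  the Fourier multiplier cis (s (l . v)); all multipliers below are built from these
  isometries.\<close>

lemma frep_translate:
  assumes "frep f P" shows "frep (\<lambda>t. f (t + s *\<^sub>R v)) (\<lambda>l. cis (s * (l \<bullet> v)) * P l)"
proof -
  have P: "integrable lborel P" and [measurable]: "P \<in> borel_measurable borel" using assms by (auto simp: frep_def)
  have "integrable lborel (\<lambda>l. P l * cis (l \<bullet> (s *\<^sub>R v)))" by (rule integrable_mult_cis[OF P])
  then have 1: "integrable lborel (\<lambda>l. cis (s * (l \<bullet> v)) * P l)" by (simp add: mult.commute)
  have 2: "f (t + s *\<^sub>R v) = (\<integral>l. cis (s * (l \<bullet> v)) * P l * cis (l \<bullet> t) \<partial>lborel)" for t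
  proof -
    have "P l * cis (l \<bullet> (t + s *\<^sub>R v)) = cis (s * (l \<bullet> v)) * P l * cis (l \<bullet> t)" for l
      by (simp add: inner_add_right cis_mult[symmetric])
    then show ?thesis unfolding frepD(3)[OF assms] by (intro Bochner_Integration.integral_cong refl)
  qed
  show ?thesis by (rule frepI[OF integrable_translate[OF frepD(1)[OF assms]] 1 2])
qed

text \<open>Two kinds of summability interact: the sup bounds on \<open>I\<close> sum the transforms
  and, pointwise, the kernels; the L1 bounds, which do not follow from them, make the summed kernel
  integrable. Only values of the multipliers on \<open>I\<close> matter, since \<open>P\<close>
  vanishes elsewhere.\<close>

lemma frep_series:
  fixes P :: "real^'n \<Rightarrow> complex" and g :: "nat \<Rightarrow> real^'n \<Rightarrow> complex"
  assumes f: "frep f P" and supp: "\<And>l. P l \<noteq> 0 \<Longrightarrow> l \<bullet> v \<in> I"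
    and g: "\<And>k. frep (g k) (\<lambda>l. m k (l \<bullet> v) * P l)" "\<And>k. L1norm (g k) \<le> C k * L1norm f"
    and C: "\<And>k. 0 \<le> C k" "summable C" "\<And>k r. r \<in> I \<Longrightarrow> norm (m k r) \<le> C k"
    and M: "M \<in> borel_measurable borel" "\<And>r. r \<in> I \<Longrightarrow> (\<lambda>k. m k r) sums M r"
  shows "\<And>t. summable (\<lambda>k. norm (g k t))" "summable (\<lambda>k. L1norm (g k))"
    and "frep (\<lambda>t. \<Sum>k. g k t) (\<lambda>l. M (l \<bullet> v) * P l)"
proof -
  have P: "integrable lborel P" and [measurable]: "P \<in> borel_measurable borel" using f by (auto simp: frep_def)
  note [measurable] = M(1)
  have mP: "integrable lborel (\<lambda>l. m k (l \<bullet> v) * P l)" for k using g(1) by (auto simp: frep_def)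
  have le: "norm (m k (l \<bullet> v) * P l) \<le> C k * norm (P l)" for k l
    using C(3)[of "l \<bullet> v" k] supp[of l] by (cases "P l = 0") (auto simp: norm_mult mult_right_mono)
  have int_le: "(\<integral>l. norm (m k (l \<bullet> v) * P l) \<partial>lborel) \<le> C k * L1norm P" for k
    unfolding L1norm_def
    by (subst integral_mult_right_zero[symmetric], rule integral_mono) (use mP P le in auto)
  have gt: "norm (g k t) \<le> C k * L1norm P" for k t
  proof -
    have "norm (g k t) \<le> (\<integral>l. norm (m k (l \<bullet> v) * P l * cis (l \<bullet> t)) \<partial>lborel)"
      using g(1)[of k] unfolding frep_def by simp
    then show ?thesis using int_le[of k] by (simp add: norm_mult)
  qed
  show S1: "summable (\<lambda>k. norm (g k t))" for t
    by (rule summable_comparison_test'[OF summable_mult2[OF C(2), of "L1norm P"]]) (use gt in auto)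
  show S2: "summable (\<lambda>k. L1norm (g k))"
    by (rule summable_comparison_test'[OF summable_mult2[OF C(2), of "L1norm f"]])
       (use g(2) in \<open>auto simp: abs_of_nonneg L1norm_nonneg\<close>)
  have gi: "integrable lborel (g k)" for k using g(1) by (auto simp: frep_def)
  have Mb: "norm (M (l \<bullet> v) * P l) \<le> suminf C * norm (P l)" for l
  proof (cases "P l = 0")
    case False
    then have I: "l \<bullet> v \<in> I" using supp by auto
    have s: "summable (\<lambda>k. norm (m k (l \<bullet> v)))" by (rule summable_comparison_test'[OF C(2)]) (use C(3)[OF I] in auto)
    have "norm (M (l \<bullet> v)) \<le> (\<Sum>k. norm (m k (l \<bullet> v)))"
      using summable_norm[OF s] M(2)[OF I] by (simp add: sums_iff)
    also have "\<dots> \<le> suminf C" by (rule suminf_le) (use C I s in auto)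
    finally show ?thesis by (simp add: norm_mult mult_right_mono)
  qed simp
  have Mi: "integrable lborel (\<lambda>l. M (l \<bullet> v) * P l)"
    by (rule Bochner_Integration.integrable_bound[of _ "\<lambda>l. suminf C * norm (P l)"])
       (use P Mb in \<open>auto intro: order_trans[OF _ abs_ge_self]\<close>)
  have rep: "(\<Sum>k. g k t) = (\<integral>l. M (l \<bullet> v) * P l * cis (l \<bullet> t) \<partial>lborel)" for t
  proof -
    have "(\<Sum>k. g k t) = (\<Sum>k. \<integral>l. m k (l \<bullet> v) * P l * cis (l \<bullet> t) \<partial>lborel)"
      using g(1) by (simp add: frep_def)
    also have "\<dots> = (\<integral>l. (\<Sum>k. m k (l \<bullet> v) * P l * cis (l \<bullet> t)) \<partial>lborel)"
    proof (rule integral_suminf[symmetric])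
      show "integrable lborel (\<lambda>l. m k (l \<bullet> v) * P l * cis (l \<bullet> t))" for k
        by (rule integrable_mult_cis[OF mP])
      show "AE l in lborel. summable (\<lambda>k. norm (m k (l \<bullet> v) * P l * cis (l \<bullet> t)))"
        by (intro AE_I2 summable_comparison_test'[OF summable_mult2[OF C(2)]]) (use le in \<open>auto simp: norm_mult\<close>)
      show "summable (\<lambda>k. \<integral>l. norm (m k (l \<bullet> v) * P l * cis (l \<bullet> t)) \<partial>lborel)"
        by (rule summable_comparison_test'[OF summable_mult2[OF C(2), of "L1norm P"]])
           (use int_le in \<open>auto simp: norm_mult abs_of_nonneg\<close>)
    qed
    also have "\<dots> = (\<integral>l. M (l \<bullet> v) * P l * cis (l \<bullet> t) \<partial>lborel)"
    proof (rule Bochner_Integration.integral_cong[OF refl])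
      fix l
      show "(\<Sum>k. m k (l \<bullet> v) * P l * cis (l \<bullet> t)) = M (l \<bullet> v) * P l * cis (l \<bullet> t)"
      proof (cases "P l = 0")
        case False
        then show ?thesis using M(2)[OF supp[OF False]] by (intro sums_unique[symmetric] sums_mult2)
      qed simp
    qed
    finally show ?thesis .
  qed
  show "frep (\<lambda>t. \<Sum>k. g k t) (\<lambda>l. M (l \<bullet> v) * P l)"
    unfolding frep_def using integrable_series[OF gi S2 S1] Mi rep by auto
qed

section \<open>Multipliers bounded relative to the action of the kernel\<close>

context L1_mod begin

text \<open>\<open>m\<close>, applied to \<open>\<lambda> \<bullet> v\<close>, acts with norm at most \<open>C\<close> on everything whose spectrum satisfies
\<open>\<lambda> \<bullet> v \<in> I\<close>. The last conjunct is not implied by the \<open>L\<^sup>1\<close> bound: it compares with \<open>act f x\<close>, not with \<open>x\<close>,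
which is what keeps the constants free of the \<open>L\<^sup>1\<close> norm of the kernel \<open>f\<close>.\<close>

definition mbound :: "real^'n \<Rightarrow> real set \<Rightarrow> (real \<Rightarrow> complex) \<Rightarrow> real \<Rightarrow> bool" where
  "mbound v I m C \<longleftrightarrow> m \<in> borel_measurable borel \<and> 0 \<le> C \<and> (\<forall>r\<in>I. norm (m r) \<le> C) \<and>
     (\<forall>f P. frep f P \<longrightarrow> (\<forall>l. P l \<noteq> 0 \<longrightarrow> l \<bullet> v \<in> I) \<longrightarrow>
        (\<exists>g. frep g (\<lambda>l. m (l \<bullet> v) * P l) \<and> L1norm g \<le> C * L1norm f \<and>
             (\<forall>x\<in>cblin. norm (act g x) \<le> C * norm (act f x))))"

lemma mboundE:
  assumes "mbound v I m C" "frep f P" "\<And>l. P l \<noteq> 0 \<Longrightarrow> l \<bullet> v \<in> I"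
  obtains g where "frep g (\<lambda>l. m (l \<bullet> v) * P l)" "L1norm g \<le> C * L1norm f"
    "\<And>x. x \<in> cblin \<Longrightarrow> norm (act g x) \<le> C * norm (act f x)"
  using assms unfolding mbound_def by blast

text \<open>The translated kernel acts as \<open>T\<close> applied after \<open>act f\<close>, so
  isometry gives the constant 1 relative to \<open>norm (act f x)\<close>; the other rules inherit
  this form by algebra and limits.\<close>

lemma mbound_cis: "mbound v I (\<lambda>r. cis (s * r)) 1"
  unfolding mbound_def
proof (intro conjI ballI allI impI)
  fix f P :: "real^'n \<Rightarrow> complex" assume f: "frep f P"
  have fi: "integrable lborel f" by (rule frepD[OF f])
  have "norm (act (\<lambda>t. f (t + s *\<^sub>R v)) x) = norm (act f x)" if "x \<in> cblin" for x
    using T_norm[OF act_cblin[OF fi that]] by (simp add: T_act[OF fi that])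
  then show "\<exists>g. frep g (\<lambda>l. cis (s * (l \<bullet> v)) * P l) \<and> L1norm g \<le> 1 * L1norm f \<and>
             (\<forall>x\<in>cblin. norm (act g x) \<le> 1 * norm (act f x))"
    using frep_translate[OF f, of s v]
    by (intro exI[of _ "\<lambda>t. f (t + s *\<^sub>R v)"]) (auto simp: L1norm_translate)
qed auto

lemma mbound_cmult:
  assumes "mbound v I m C" shows "mbound v I (\<lambda>r. c * m r) (norm c * C)"
  unfolding mbound_def
proof (intro conjI ballI allI impI)
  fix f P assume f: "frep f P" and supp: "\<forall>l. P l \<noteq> 0 \<longrightarrow> l \<bullet> v \<in> I"
  obtain g where g: "frep g (\<lambda>l. m (l \<bullet> v) * P l)" "L1norm g \<le> C * L1norm f"
    "\<And>x. x \<in> cblin \<Longrightarrow> norm (act g x) \<le> C * norm (act f x)"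
    using mboundE[OF assms f] supp by blast
  have gi: "integrable lborel g" using g(1) by (simp add: frep_def)
  have "norm (act (\<lambda>t. c * g t) x) \<le> norm c * C * norm (act f x)" if "x \<in> cblin" for x
    unfolding act_cmult[OF gi that]
    using norm_scaleCL_le[of c "act g x"] mult_left_mono[OF g(3)[OF that], of "norm c"] by (simp add: mult.assoc)
  then show "\<exists>g. frep g (\<lambda>l. c * m (l \<bullet> v) * P l) \<and> L1norm g \<le> norm c * C * L1norm f \<and>
             (\<forall>x\<in>cblin. norm (act g x) \<le> norm c * C * norm (act f x))"
    using frep_cmult[OF g(1), of c] g(2)
    by (intro exI[of _ "\<lambda>t. c * g t"]) (auto simp: mult.assoc L1norm_cmult mult_left_mono)
qed (use assms in \<open>auto simp: mbound_def norm_mult intro!: mult_left_mono\<close>)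

lemma mbound_mult:
  assumes 1: "mbound v I m C" and 2: "mbound v I n D" shows "mbound v I (\<lambda>r. m r * n r) (C * D)"
  unfolding mbound_def
proof (intro conjI ballI allI impI)
  have C: "0 \<le> C" using 1 by (simp add: mbound_def)
  fix f P assume f: "frep f P" and supp: "\<forall>l. P l \<noteq> 0 \<longrightarrow> l \<bullet> v \<in> I"
  obtain g where g: "frep g (\<lambda>l. n (l \<bullet> v) * P l)" "L1norm g \<le> D * L1norm f"
    "\<And>x. x \<in> cblin \<Longrightarrow> norm (act g x) \<le> D * norm (act f x)"
    using mboundE[OF 2 f] supp by blast
  obtain h where h: "frep h (\<lambda>l. m (l \<bullet> v) * (n (l \<bullet> v) * P l))" "L1norm h \<le> C * L1norm g"
    "\<And>x. x \<in> cblin \<Longrightarrow> norm (act h x) \<le> C * norm (act g x)"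
  proof (rule mboundE[OF 1 g(1)])
    show "n (l \<bullet> v) * P l \<noteq> 0 \<Longrightarrow> l \<bullet> v \<in> I" for l using supp by auto
  qed blast
  have "L1norm h \<le> C * D * L1norm f" using h(2) mult_left_mono[OF g(2) C] by (simp add: mult.assoc)
  moreover have "norm (act h x) \<le> C * D * norm (act f x)" if "x \<in> cblin" for x
    using h(3)[OF that] mult_left_mono[OF g(3)[OF that] C] by (simp add: mult.assoc)
  ultimately show "\<exists>g. frep g (\<lambda>l. m (l \<bullet> v) * n (l \<bullet> v) * P l) \<and> L1norm g \<le> C * D * L1norm f \<and>
             (\<forall>x\<in>cblin. norm (act g x) \<le> C * D * norm (act f x))"
    using h(1) by (auto simp: mult.assoc)
qed (use assms in \<open>auto simp: mbound_def norm_mult intro!: mult_mono\<close>)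

lemma mbound_add:
  assumes 1: "mbound v I m C" and 2: "mbound v I n D" shows "mbound v I (\<lambda>r. m r + n r) (C + D)"
  unfolding mbound_def
proof (intro conjI ballI allI impI)
  fix f P assume f: "frep f P" and supp: "\<forall>l. P l \<noteq> 0 \<longrightarrow> l \<bullet> v \<in> I"
  obtain g where g: "frep g (\<lambda>l. n (l \<bullet> v) * P l)" "L1norm g \<le> D * L1norm f"
    "\<And>x. x \<in> cblin \<Longrightarrow> norm (act g x) \<le> D * norm (act f x)"
    using mboundE[OF 2 f] supp by blast
  obtain h where h: "frep h (\<lambda>l. m (l \<bullet> v) * P l)" "L1norm h \<le> C * L1norm f"
    "\<And>x. x \<in> cblin \<Longrightarrow> norm (act h x) \<le> C * norm (act f x)"
    using mboundE[OF 1 f] supp by blast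
  have i: "integrable lborel g" "integrable lborel h" using g(1) h(1) by (auto simp: frep_def)
  have "L1norm (\<lambda>t. h t + g t) \<le> L1norm h + L1norm g"
    by (rule L1norm_add_le[OF i(2,1)])
  moreover have "norm (act (\<lambda>t. h t + g t) x) \<le> (C + D) * norm (act f x)" if "x \<in> cblin" for x
    using norm_triangle_ineq[of "act h x" "act g x"] g(3)[OF that] h(3)[OF that]
    by (simp add: act_add_left i that distrib_right)
  ultimately show "\<exists>g. frep g (\<lambda>l. (m (l \<bullet> v) + n (l \<bullet> v)) * P l) \<and> L1norm g \<le> (C + D) * L1norm f \<and>
             (\<forall>x\<in>cblin. norm (act g x) \<le> (C + D) * norm (act f x))"
    using frep_add[OF h(1) g(1)] g(2) h(2) by (intro exI[of _ "\<lambda>t. h t + g t"]) (auto simp: distrib_right)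
next
  show "norm (m r + n r) \<le> C + D" if "r \<in> I" for r
    using assms that by (auto simp: mbound_def intro: norm_triangle_mono)
qed (use assms in \<open>auto simp: mbound_def\<close>)

lemma mbound_power:
  assumes "mbound v I m C" shows "mbound v I (\<lambda>r. m r ^ k) (C ^ k)"
proof (induction k)
  case 0 then show ?case using mbound_cis[of v I 0] by simp
next
  case (Suc k) then show ?case using mbound_mult[OF assms] by simp
qed

text \<open>Besides summing, this rule changes a multiplier off \<open>I\<close>, since the series
  has to represent \<open>M\<close> only there. In this way a linear function inherits a bound from
  trigonometric ones.\<close>

lemma mbound_suminf:
  assumes m: "\<And>k. mbound v I (m k) (C k)" and C: "summable C"
    and M: "M \<in> borel_measurable borel" "\<And>r. r \<in> I \<Longrightarrow> (\<lambda>k. m k r) sums M r"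
  shows "mbound v I M (suminf C)"
  unfolding mbound_def
proof (intro conjI ballI allI impI)
  have C0: "0 \<le> C k" and mC: "r \<in> I \<Longrightarrow> norm (m k r) \<le> C k" for k r using m[of k] by (auto simp: mbound_def)
  show "0 \<le> suminf C" by (rule suminf_nonneg[OF C]) (rule C0)
  show "norm (M r) \<le> suminf C" if "r \<in> I" for r
  proof -
    have s: "summable (\<lambda>k. norm (m k r))" by (rule summable_comparison_test'[OF C]) (use mC that in auto)
    have "norm (M r) \<le> (\<Sum>k. norm (m k r))"
      using summable_norm[OF s] M(2)[OF that] by (simp add: sums_iff)
    also have "\<dots> \<le> suminf C" by (rule suminf_le) (use C mC that s in auto)
    finally show ?thesis .
  qed
  fix f P assume f: "frep f P" and supp: "\<forall>l. P l \<noteq> 0 \<longrightarrow> l \<bullet> v \<in> I"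
  have "\<exists>g. frep g (\<lambda>l. m k (l \<bullet> v) * P l) \<and> L1norm g \<le> C k * L1norm f \<and>
             (\<forall>x\<in>cblin. norm (act g x) \<le> C k * norm (act f x))" for k
    using m[of k] f supp unfolding mbound_def by blast
  then obtain g where g: "\<And>k. frep (g k) (\<lambda>l. m k (l \<bullet> v) * P l)" "\<And>k. L1norm (g k) \<le> C k * L1norm f"
      "\<And>k x. x \<in> cblin \<Longrightarrow> norm (act (g k) x) \<le> C k * norm (act f x)" by metis
  note S = frep_series[OF f supp[rule_format] g(1,2) C0 C mC M]
  have gi: "integrable lborel (g k)" for k using g(1) by (auto simp: frep_def)
  have "L1norm (\<lambda>t. \<Sum>k. g k t) \<le> (\<Sum>k. L1norm (g k))"
    by (rule L1norm_series_le[OF gi S(2,1)])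
  also have "\<dots> \<le> suminf C * L1norm f"
    by (subst suminf_mult2[OF C], rule suminf_le) (use g(2) S(2) summable_mult2[OF C] in auto)
  finally have 1: "L1norm (\<lambda>t. \<Sum>k. g k t) \<le> suminf C * L1norm f" .
  have 2: "norm (act (\<lambda>t. \<Sum>k. g k t) x) \<le> suminf C * norm (act f x)" if x: "x \<in> cblin" for x
  proof -
    note s = act_series_left[OF gi S(2,1) x]
    have sn: "summable (\<lambda>k. norm (act (g k) x))"
      by (rule summable_comparison_test'[OF summable_mult2[OF C, of "norm (act f x)"]]) (use g(3) x in auto)
    have "norm (act (\<lambda>t. \<Sum>k. g k t) x) \<le> (\<Sum>k. norm (act (g k) x))"
      using summable_norm[OF sn] s by (simp add: sums_iff)
    also have "\<dots> \<le> suminf C * norm (act f x)"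
      by (subst suminf_mult2[OF C], rule suminf_le) (use g(3) x sn summable_mult2[OF C] in auto)
    finally show ?thesis .
  qed
  show "\<exists>g. frep g (\<lambda>l. M (l \<bullet> v) * P l) \<and> L1norm g \<le> suminf C * L1norm f \<and>
             (\<forall>x\<in>cblin. norm (act g x) \<le> suminf C * norm (act f x))"
    using S(3) 1 2 by blast
qed (rule M(1))

end

lemma exp_series_summable: "summable (\<lambda>n. (x::real) ^ n / fact n)"
  using summable_exp_generic[of x] by (simp add: scaleR_conv_of_real divide_inverse mult.commute)

context L1_mod begin

lemma mbound_sin: "mbound v I (\<lambda>r. of_real (sin (h * (r - c)))) 1"
proof -
  have "mbound v I (\<lambda>r. (cis (-h*c) / (2*\<i>)) * cis (h * r) + (- cis (h*c) / (2*\<i>)) * cis ((-h) * r))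
      (norm (cis (-h*c) / (2*\<i>)) * 1 + norm (- cis (h*c) / (2*\<i>)) * 1)"
    by (intro mbound_add mbound_cmult mbound_cis)
  moreover have "(cis (-h*c) / (2*\<i>)) * cis (h * r) + (- cis (h*c) / (2*\<i>)) * cis ((-h) * r) = of_real (sin (h * (r - c)))" for r
  proof -
    have "cis (-h*c) * cis (h * r) = cis (h * (r - c))" "cis (h*c) * cis ((-h) * r) = cis (-(h * (r - c)))"
      by (simp_all add: cis_mult algebra_simps)
    moreover have "(p / d) * q + (- p' / d) * q' = (p * q - p' * q') / d" for p q p' q' d :: complex
      by (simp add: diff_divide_distrib)
    ultimately have "(cis (-h*c) / (2*\<i>)) * cis (h * r) + (- cis (h*c) / (2*\<i>)) * cis ((-h) * r) = (cis (h * (r - c)) - cis (-(h * (r - c)))) / (2*\<i>)"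
      by (simp only:)
    also have "\<dots> = of_real (sin (h * (r - c)))"
      by (simp add: complex_eq_iff cis.code)
    finally show ?thesis .
  qed
  moreover have "norm (cis (-h*c) / (2*\<i>)) * 1 + norm (- cis (h*c) / (2*\<i>)) * 1 = 1"
    by (simp add: norm_divide norm_mult)
  ultimately show ?thesis by simp
qed

lemma mbound_shift:
  assumes "0 \<le> s" shows "mbound v {c-s..c+s} (\<lambda>r. of_real (r - c)) s"
proof (cases "s = 0")
  \<comment> \<open>Here the slab is the single value c, where the multiplier vanishes; the zero
    series represents it. The scale \<open>h\<close> of the other case would be pi / 0.\<close>
  case True
  have "mbound v {c-s..c+s} (\<lambda>r. of_real (r - c)) (suminf (\<lambda>k::nat. norm (0::complex) * 1))"
    by (rule mbound_suminf[OF mbound_cmult[OF mbound_cis[of v _ 0]]]) (use True in \<open>auto simp: sums_0\<close>)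
  then show ?thesis using True by simp
next
  case False
  with assms have s: "s > 0" by simp
  obtain a :: "nat \<Rightarrow> real" where a: "\<And>n. 0 \<le> a n" "a sums (pi/2)"
    "\<And>y. \<bar>y\<bar> \<le> 1 \<Longrightarrow> (\<lambda>n. a n * y ^ (2*n+1)) sums arcsin y"
    using arcsin_power_series by blast
  \<comment> \<open>This scale maps the slab onto [-pi/2, pi/2], where arcsin inverts sin; the
    coefficients \<open>a n / h\<close> then add up to (pi/2) / h = s.\<close>
  define h where "h = pi / (2 * s)"
  have h: "h > 0" using s by (simp add: h_def)
  have "mbound v {c-s..c+s} (\<lambda>r. of_real (r - c)) (suminf (\<lambda>n. norm (complex_of_real (a n / h)) * 1 ^ (2*n+1)))"
  proof (rule mbound_suminf[OF mbound_cmult[OF mbound_power[OF mbound_sin]]])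
    show "summable (\<lambda>n. norm (complex_of_real (a n / h)) * 1 ^ (2*n+1))"
      using a(1) h sums_summable[OF sums_divide[OF a(2), of h]] by (simp add: norm_divide)
    fix r assume r: "r \<in> {c-s..c+s}"
    have "\<bar>r - c\<bar> \<le> s" using r by auto
    then have "h * \<bar>r - c\<bar> \<le> h * s" using h by (intro mult_left_mono) auto
    also have "\<dots> = pi/2" using s by (simp add: h_def)
    finally have "\<bar>h * (r - c)\<bar> \<le> pi/2" using h by (simp add: abs_mult)
    then have "arcsin (sin (h * (r - c))) = h * (r - c)" by (intro arcsin_sin) auto
    with a(3)[of "sin (h * (r - c))"] have "(\<lambda>n. a n * sin (h * (r - c)) ^ (2*n+1)) sums (h * (r - c))" by simp
    from sums_divide[OF this, of h] have "(\<lambda>n. a n / h * sin (h * (r - c)) ^ (2*n+1)) sums (r - c)"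
      using h by simp
    then show "(\<lambda>n. of_real (a n / h) * of_real (sin (h * (r - c))) ^ (2*n+1)) sums complex_of_real (r - c)"
      by (subst (asm) sums_of_real_iff[symmetric, where 'a=complex]) (simp only: of_real_mult of_real_power)
  qed auto
  also have "(\<lambda>n. norm (complex_of_real (a n / h)) * 1 ^ (2*n+1)) = (\<lambda>n. a n / h)"
    using a(1) h by (auto simp: norm_divide)
  also have "suminf (\<lambda>n. a n / h) = s"
    using sums_divide[OF a(2), of h] s by (simp add: sums_iff h_def)
  finally show ?thesis .
qed

lemma mbound_exp:
  assumes "0 \<le> s" shows "mbound v {c-s..c+s} (\<lambda>r. exp (z * of_real (r - c))) (exp (norm z * s))"
proof -
  have "mbound v {c-s..c+s} (\<lambda>r. exp (z * of_real (r - c))) (suminf (\<lambda>n. norm (z ^ n / fact n) * s ^ n))"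
  proof (rule mbound_suminf[OF mbound_cmult[OF mbound_power[OF mbound_shift[OF assms]]]])
    have "(\<lambda>n. norm (z ^ n / fact n) * s ^ n) = (\<lambda>n. (norm z * s) ^ n /\<^sub>R fact n)"
      by (auto simp: norm_divide norm_power power_mult_distrib divide_simps)
    then show "summable (\<lambda>n. norm (z ^ n / fact n) * s ^ n)"
      using exp_converges[of "norm z * s"] by (simp add: sums_iff)
    show "(\<lambda>k. z ^ k / fact k * of_real (r - c) ^ k) sums exp (z * of_real (r - c))" for r
      using exp_converges[of "z * of_real (r - c)"]
      by (simp add: power_mult_distrib scaleR_conv_of_real divide_inverse mult_ac)
  qed auto
  also have "suminf (\<lambda>n. norm (z ^ n / fact n) * s ^ n) = exp (norm z * s)"
  proof -
    have "(\<lambda>n. norm (z ^ n / fact n) * s ^ n) = (\<lambda>n. (norm z * s) ^ n /\<^sub>R fact n)"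
      by (auto simp: norm_divide norm_power power_mult_distrib divide_simps)
    then show ?thesis using exp_converges[of "norm z * s"] by (simp add: sums_iff)
  qed
  finally show ?thesis .
qed

text \<open>Factoring out the value at the centre and expanding only in r - c gives the supremum of
  the exponential over the slab. An expansion in r itself would give exp (|c| + s) and lose all
  decay.\<close>

lemma
  assumes "0 \<le> s"
  shows mbound_exp_pos: "mbound v {c-s..c+s} (\<lambda>r. exp (of_real r)) (exp (c + s))"
    and mbound_exp_neg: "mbound v {c-s..c+s} (\<lambda>r. exp (- of_real r)) (exp (- c + s))"
proof -
  have "mbound v {c-s..c+s} (\<lambda>r. exp (of_real c) * exp (1 * of_real (r - c))) (norm (exp (complex_of_real c)) * exp (norm (1::complex) * s))"
    by (intro mbound_cmult mbound_exp assms)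
  then show "mbound v {c-s..c+s} (\<lambda>r. exp (of_real r)) (exp (c + s))"
    by (simp add: exp_add[symmetric] del: exp_of_real)
  have "mbound v {c-s..c+s} (\<lambda>r. exp (- of_real c) * exp ((-1) * of_real (r - c))) (norm (exp (- complex_of_real c)) * exp (norm (-1::complex) * s))"
    by (intro mbound_cmult mbound_exp assms)
  then show "mbound v {c-s..c+s} (\<lambda>r. exp (- of_real r)) (exp (- c + s))"
    by (simp add: exp_add[symmetric] del: exp_of_real)
qed

section \<open>Power series in a fixed direction and their values at the imaginary unit\<close>

lemma mbound_id:
  assumes "0 \<le> s" shows "mbound v {c-s..c+s} (\<lambda>r. of_real r) (\<bar>c\<bar> + s)"
proof -
  have "mbound v {c-s..c+s} (\<lambda>r. of_real c * cis (0 * r) + of_real (r - c)) (norm (complex_of_real c) * 1 + s)"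
    by (intro mbound_add mbound_cmult mbound_cis mbound_shift assms)
  then show ?thesis by simp
qed

text \<open>One family of kernels, whose multipliers are the Taylor terms of exp (i (l . v)), serves
  every z in the unit disc. Real z gives the translates of \<open>f\<close>, hence \<open>T\<close>;
  z = i gives the multiplier exp (- (l . v)). The sum is identified with \<open>h\<close> because
  both have the same transform.\<close>

lemma kernel_expansion:
  assumes f: "frep f P" and supp: "\<And>l. P l \<noteq> 0 \<Longrightarrow> l \<bullet> v \<in> {c-s..c+s}" and s: "0 \<le> s"
  obtains g where "\<And>n. frep (g n) (\<lambda>l. (\<i> * of_real (l \<bullet> v)) ^ n / fact n * P l)"
    "\<And>n x. x \<in> cblin \<Longrightarrow> norm (act (g n) x) \<le> (\<bar>c\<bar> + s) ^ n / fact n * norm (act f x)"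
    "\<And>z h x. norm z \<le> 1 \<Longrightarrow> frep h (\<lambda>l. exp (\<i> * z * of_real (l \<bullet> v)) * P l) \<Longrightarrow> x \<in> cblin \<Longrightarrow>
       (\<lambda>n. scaleCL (z ^ n) (act (g n) x)) sums act h x"
proof -
  define m where "m = (\<lambda>n r. (\<i> ^ n / fact n) * complex_of_real r ^ n)"
  have mb: "mbound v {c-s..c+s} (m n) (norm (\<i> ^ n / fact n) * (\<bar>c\<bar> + s) ^ n)" for n
    unfolding m_def by (intro mbound_cmult mbound_power mbound_id s)
  define C where "C = (\<lambda>n. (\<bar>c\<bar> + s) ^ n / fact n)"
  have C: "norm (\<i> ^ n / fact n) * (\<bar>c\<bar> + s) ^ n = C n" for n
    by (simp add: C_def norm_divide norm_power)
  have C0: "0 \<le> C n" for n using s by (simp add: C_def)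
  have Cs: "summable C" unfolding C_def by (rule exp_series_summable)
  have "\<exists>g. frep g (\<lambda>l. m n (l \<bullet> v) * P l) \<and> L1norm g \<le> C n * L1norm f \<and>
             (\<forall>x\<in>cblin. norm (act g x) \<le> C n * norm (act f x))" for n
    using mb[of n, unfolded C] f supp unfolding mbound_def by blast
  then obtain g where g: "\<And>k. frep (g k) (\<lambda>l. m k (l \<bullet> v) * P l)" "\<And>k. L1norm (g k) \<le> C k * L1norm f"
      "\<And>k x. x \<in> cblin \<Longrightarrow> norm (act (g k) x) \<le> C k * norm (act f x)" by metis
  have gi: "integrable lborel (g k)" for k by (rule frepD[OF g(1)])
  have m_eq: "m n r = (\<i> * of_real r) ^ n / fact n" for n r by (simp add: m_def power_mult_distrib)
  have mC: "norm (m n r) \<le> C n" if "r \<in> {c-s..c+s}" for n r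
    using mb[of n] that unfolding C mbound_def by blast
  show ?thesis
  proof
    show "frep (g n) (\<lambda>l. (\<i> * of_real (l \<bullet> v)) ^ n / fact n * P l)" for n using g(1)[of n] by (simp add: m_eq)
    show "norm (act (g n) x) \<le> (\<bar>c\<bar> + s) ^ n / fact n * norm (act f x)" if "x \<in> cblin" for n x
      using g(3)[OF that, of n] by (simp add: C_def)
    fix z h and x :: "'a \<Rightarrow>\<^sub>L 'b" assume z: "norm (z::complex) \<le> 1" and h: "frep h (\<lambda>l. exp (\<i> * z * of_real (l \<bullet> v)) * P l)" and x: "x \<in> cblin"
    have zn: "norm (z ^ n) \<le> 1" for n using z by (simp add: norm_power power_le_one)
    have zg: "frep (\<lambda>t. z ^ k * g k t) (\<lambda>l. (z ^ k * m k (l \<bullet> v)) * P l)" for k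
      using frep_cmult[OF g(1), of "z ^ k" k] by (simp add: mult.assoc)
    have zL: "L1norm (\<lambda>t. z ^ k * g k t) \<le> C k * L1norm f" for k
      unfolding L1norm_cmult using mult_mono[OF zn[of k] g(2)[of k]] L1norm_nonneg[of "g k"] by simp
    have zC: "norm (z ^ k * m k r) \<le> C k" if "r \<in> {c-s..c+s}" for k r
      using mult_mono[OF zn[of k] mC[OF that, of k]] by (simp add: norm_mult)
    have zs: "(\<lambda>k. z ^ k * m k r) sums exp (\<i> * z * of_real r)" for r
      using exp_converges[of "\<i> * z * of_real r"] unfolding m_eq
      by (simp add: power_mult_distrib scaleR_conv_of_real divide_inverse mult_ac)
    note S = frep_series[OF f supp zg zL C0 Cs zC _ zs]
    have "h = (\<lambda>t. \<Sum>k. z ^ k * g k t)"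
      by (rule frep_unique[OF h S(3)]) measurable
    moreover have "(\<lambda>k. act (\<lambda>t. z ^ k * g k t) x) sums act (\<lambda>t. \<Sum>k. z ^ k * g k t) x"
      by (rule act_series_left[OF _ S(2,1) x]) (auto intro: gi)
    ultimately show "(\<lambda>n. scaleCL (z ^ n) (act (g n) x)) sums act h x"
      by (simp add: act_cmult gi x)
  qed
qed

text \<open>A property of the element and not of a kernel: products and inverses inherit it although
  they are not given in the form \<open>act f x\<close>. Absolute summability of the coefficients
  gives meaning to the value at the imaginary unit.\<close>

definition expands :: "real^'n \<Rightarrow> ('a \<Rightarrow>\<^sub>L 'b) \<Rightarrow> (nat \<Rightarrow> 'a \<Rightarrow>\<^sub>L 'b) \<Rightarrow> bool" where
  "expands v u a \<longleftrightarrow> (\<forall>n. a n \<in> cblin) \<and> summable (\<lambda>n. norm (a n)) \<and>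
     (\<forall>s. \<bar>s\<bar> \<le> 1 \<longrightarrow> (\<lambda>n. s ^ n *\<^sub>R a n) sums T (s *\<^sub>R v) u)"

text \<open>\<open>y\<close> plays the role of T(i v) applied to \<open>act f x\<close>; its bound
  comes from the multiplier exp (- (l . v)). The coefficient bounds feed the smallness condition of
  \<open>expands_inverse\<close>.\<close>

lemma expands_act:
  assumes f: "frep f P" and supp: "\<And>l. P l \<noteq> 0 \<Longrightarrow> l \<bullet> v \<in> {c-s..c+s}" and s: "0 \<le> s" and x: "x \<in> cblin"
  obtains a y where "expands v (act f x) a" "\<And>n. norm (a n) \<le> (\<bar>c\<bar> + s) ^ n / fact n * norm (act f x)"
    "(\<lambda>n. scaleCL (\<i> ^ n) (a n)) sums y" "norm y \<le> exp (- c + s) * norm (act f x)"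
proof -
  obtain g where g: "\<And>n. frep (g n) (\<lambda>l. (\<i> * of_real (l \<bullet> v)) ^ n / fact n * P l)"
    "\<And>n x. x \<in> cblin \<Longrightarrow> norm (act (g n) x) \<le> (\<bar>c\<bar> + s) ^ n / fact n * norm (act f x)"
    "\<And>z h x. norm z \<le> 1 \<Longrightarrow> frep h (\<lambda>l. exp (\<i> * z * of_real (l \<bullet> v)) * P l) \<Longrightarrow> x \<in> cblin \<Longrightarrow>
       (\<lambda>n. scaleCL (z ^ n) (act (g n) x)) sums act h x"
    using kernel_expansion[OF f supp s] by blast
  obtain h where h: "frep h (\<lambda>l. exp (- of_real (l \<bullet> v)) * P l)"
    "\<And>x. x \<in> cblin \<Longrightarrow> norm (act h x) \<le> exp (- c + s) * norm (act f x)"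
    using mboundE[OF mbound_exp_neg[OF s] f supp] by blast
  define a where "a = (\<lambda>n. act (g n) x)"
  show ?thesis
  proof
    show "norm (a n) \<le> (\<bar>c\<bar> + s) ^ n / fact n * norm (act f x)" for n
      unfolding a_def by (rule g(2)[OF x])
    show "(\<lambda>n. scaleCL (\<i> ^ n) (a n)) sums act h x"
      unfolding a_def by (rule g(3)) (use h x in auto)
    show "norm (act h x) \<le> exp (- c + s) * norm (act f x)" by (rule h(2)[OF x])
    show "expands v (act f x) a"
      unfolding expands_def
    proof (intro conjI allI impI)
      show "a n \<in> cblin" for n unfolding a_def by (rule act_cblin[OF frepD(1)[OF g(1)] x])
      show "summable (\<lambda>n. norm (a n))"
        by (rule summable_comparison_test'[OF summable_mult2[OF exp_series_summable[of "\<bar>c\<bar> + s"], of "norm (act f x)"]])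
           (use g(2)[OF x] in \<open>auto simp: a_def\<close>)
      fix r :: real assume r: "\<bar>r\<bar> \<le> 1"
      have "frep (\<lambda>t. f (t + r *\<^sub>R v)) (\<lambda>l. exp (\<i> * of_real r * of_real (l \<bullet> v)) * P l)"
        using frep_translate[OF f, of r v] by (simp add: cis_conv_exp mult.assoc)
      from g(3)[OF _ this x] r
      show "(\<lambda>n. r ^ n *\<^sub>R a n) sums T (r *\<^sub>R v) (act f x)"
        by (simp add: a_def T_act[OF frepD(1)[OF f] x] scaleCL_of_real flip: of_real_power)
    qed
  qed
qed

text \<open>Morally \<open>act f Z = act k (T(\<i> v) Z)\<close>, where \<open>k\<close> is \<open>f\<close> multiplied by \<open>exp (\<lambda> \<bullet> v)\<close> on the Fourier
side, and \<open>y = T(\<i> v) Z\<close> is the value of the power series of \<open>Z\<close> at \<open>\<i>\<close>.\<close>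

lemma transfer_bound:
  assumes f: "frep f P" and supp: "\<And>l. P l \<noteq> 0 \<Longrightarrow> l \<bullet> v \<in> {c-s..c+s}" and s: "0 \<le> s"
    and Z: "Z \<in> cblin" "expands v Z z" "(\<lambda>n. scaleCL (\<i> ^ n) (z n)) sums y"
  shows "norm (act f Z) \<le> exp (c + s) * L1norm f * norm y"
proof -
  obtain k where k: "frep k (\<lambda>l. exp (of_real (l \<bullet> v)) * P l)" "L1norm k \<le> exp (c + s) * L1norm f"
    using mboundE[OF mbound_exp_pos[OF s] f supp] by blast
  have ki: "integrable lborel k" by (rule frepD[OF k(1)])
  have supp_k: "l \<bullet> v \<in> {c-s..c+s}" if "exp (complex_of_real (l \<bullet> v)) * P l \<noteq> 0" for l
    using that supp by auto
  obtain g where g: "\<And>n. frep (g n) (\<lambda>l. (\<i> * of_real (l \<bullet> v)) ^ n / fact n * (exp (of_real (l \<bullet> v)) * P l))"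
    "\<And>n x. x \<in> cblin \<Longrightarrow> norm (act (g n) x) \<le> (\<bar>c\<bar> + s) ^ n / fact n * norm (act k x)"
    "\<And>z h x. norm z \<le> 1 \<Longrightarrow> frep h (\<lambda>l. exp (\<i> * z * of_real (l \<bullet> v)) * (exp (of_real (l \<bullet> v)) * P l)) \<Longrightarrow> x \<in> cblin \<Longrightarrow>
       (\<lambda>n. scaleCL (z ^ n) (act (g n) x)) sums act h x"
    using kernel_expansion[OF k(1) supp_k s] by blast
  have zc: "z n \<in> cblin" for n using Z(2) by (simp add: expands_def)
  have zs: "summable (\<lambda>n. norm (z n))" using Z(2) by (simp add: expands_def)
  \<comment> \<open>For real r the action of the kernel k(. + r v) on \<open>Z\<close> is expanded
    twice: through the kernel and, by \<open>act_T\<close>, through the series of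
    \<open>Z\<close>.\<close>
  have coeff: "act (g n) Z = act k (z n)" for n
  proof (rule power_series_coeff_unique)
    show "summable (\<lambda>n. norm (act (g n) Z))"
      by (rule summable_comparison_test'[OF summable_mult2[OF exp_series_summable[of "\<bar>c\<bar> + s"], of "norm (act k Z)"]])
           (use g(2)[OF Z(1)] in auto)
    show "summable (\<lambda>n. norm (act k (z n)))"
      by (rule summable_comparison_test'[OF summable_mult[OF zs, of "L1norm k"]])
         (use act_norm[OF ki zc] in auto)
    fix r :: real assume r: "\<bar>r\<bar> \<le> 1"
    have "frep (\<lambda>t. k (t + r *\<^sub>R v)) (\<lambda>l. exp (\<i> * of_real r * of_real (l \<bullet> v)) * (exp (of_real (l \<bullet> v)) * P l))"
      using frep_translate[OF k(1), of r v] by (simp add: cis_conv_exp mult.assoc)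
    from g(3)[OF _ this Z(1)] r have 1: "(\<lambda>n. r ^ n *\<^sub>R act (g n) Z) sums act (\<lambda>t. k (t + r *\<^sub>R v)) Z"
      by (simp add: scaleCL_of_real flip: of_real_power)
    have "(\<lambda>n. act k (r ^ n *\<^sub>R z n)) sums act k (T (r *\<^sub>R v) Z)"
      by (rule act_sums[OF ki]) (use Z(2) r zc in \<open>auto simp: expands_def intro: cblin_scaleR\<close>)
    then have 2: "(\<lambda>n. r ^ n *\<^sub>R act k (z n)) sums act (\<lambda>t. k (t + r *\<^sub>R v)) Z"
      by (simp add: act_scaleR ki zc act_T[OF ki Z(1)])
    show "(\<Sum>n. r ^ n *\<^sub>R act (g n) Z) = (\<Sum>n. r ^ n *\<^sub>R act k (z n))"
      using 1 2 by (simp add: sums_iff)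
  qed
  \<comment> \<open>At z = i the factor exp (i z (l . v)) is exp (- (l . v)) and undoes the weight
    carried by \<open>k\<close>.\<close>
  have "frep f (\<lambda>l. exp (\<i> * \<i> * of_real (l \<bullet> v)) * (exp (of_real (l \<bullet> v)) * P l))"
    using f by (simp add: mult.assoc[symmetric] exp_add[symmetric] del: exp_of_real)
  from g(3)[OF _ this Z(1)] have "(\<lambda>n. scaleCL (\<i> ^ n) (act (g n) Z)) sums act f Z" by simp
  moreover have "(\<lambda>n. act k (scaleCL (\<i> ^ n) (z n))) sums act k y"
    by (rule act_sums[OF ki _ Z(3)]) (intro cblin_scaleCL zc)
  ultimately have "act f Z = act k y"
    by (simp add: coeff act_scaleCL ki zc sums_iff)
  also have "norm \<dots> \<le> L1norm k * norm y"
    by (rule act_norm[OF ki cblin_sums[OF _ Z(3)]]) (intro cblin_scaleCL zc)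
  also have "\<dots> \<le> exp (c + s) * L1norm f * norm y" by (intro mult_right_mono k(2)) simp
  finally show ?thesis .
qed

end

section \<open>Products, inverses and disjoint spectra\<close>

text \<open>One Cauchy product at a general z of the unit disc covers both claims: real z, where it
  meets the multiplicativity of \<open>T\<close>, and z = i, where no operator T(i v) is at hand and
  the coefficients take its place.\<close>

lemma expands_compose:
  assumes "L1_mod T1 act1" "L1_mod T2 act2" "L1_mod T3 act3"
    and mult: "\<And>t. T3 t (X o\<^sub>L Y) = T1 t X o\<^sub>L T2 t Y"
    and X: "L1_mod.expands T1 v X a" "(\<lambda>n. scaleCL (\<i> ^ n) (a n)) sums p"
    and Y: "L1_mod.expands T2 v Y b" "(\<lambda>n. scaleCL (\<i> ^ n) (b n)) sums q"
  shows "L1_mod.expands T3 v (X o\<^sub>L Y) (\<lambda>n. \<Sum>i\<le>n. a i o\<^sub>L b (n - i))"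
    and "(\<lambda>n. scaleCL (\<i> ^ n) (\<Sum>i\<le>n. a i o\<^sub>L b (n - i))) sums (p o\<^sub>L q)"
proof -
  interpret M1: L1_mod T1 act1 by fact
  interpret M2: L1_mod T2 act2 by fact
  interpret M3: L1_mod T3 act3 by fact
  note bl = bounded_bilinear_blinfun_compose
  have a: "a n \<in> cblin" "summable (\<lambda>n. norm (a n))" for n using X(1) by (auto simp: M1.expands_def)
  have b: "b n \<in> cblin" "summable (\<lambda>n. norm (b n))" for n using Y(1) by (auto simp: M2.expands_def)
  have sc: "summable (\<lambda>n. norm (scaleCL (z ^ n) (u n)))" if "norm z \<le> 1" "summable (\<lambda>n. norm (u n))"
    for z :: complex and u :: "nat \<Rightarrow> 'x::complex_banach \<Rightarrow>\<^sub>L 'y::complex_banach"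
  proof (rule summable_comparison_test'[OF that(2)])
    fix n
    have "norm (scaleCL (z ^ n) (u n)) \<le> norm (z ^ n) * norm (u n)" by (rule norm_scaleCL_le)
    also have "\<dots> \<le> 1 * norm (u n)" using that(1) by (intro mult_right_mono) (auto simp: norm_power power_le_one)
    finally show "norm (norm (scaleCL (z ^ n) (u n))) \<le> norm (u n)" by simp
  qed
  have prod: "(\<lambda>n. scaleCL (z ^ n) (\<Sum>i\<le>n. a i o\<^sub>L b (n - i))) sums (suminf (\<lambda>n. scaleCL (z ^ n) (a n)) o\<^sub>L suminf (\<lambda>n. scaleCL (z ^ n) (b n)))"
    if z: "norm z \<le> 1" for z
  proof -
    have "(\<lambda>n. \<Sum>i\<le>n. scaleCL (z ^ i) (a i) o\<^sub>L scaleCL (z ^ (n - i)) (b (n - i))) sums (suminf (\<lambda>n. scaleCL (z ^ n) (a n)) o\<^sub>L suminf (\<lambda>n. scaleCL (z ^ n) (b n)))"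
      by (rule bilinear_Cauchy_product_sums(2)[OF bl sc[OF z a(2)] sc[OF z b(2)]])
    moreover have "(\<Sum>i\<le>n. scaleCL (z ^ i) (a i) o\<^sub>L scaleCL (z ^ (n - i)) (b (n - i))) = scaleCL (z ^ n) (\<Sum>i\<le>n. a i o\<^sub>L b (n - i))" for n
      unfolding scaleCL_sum by (rule sum.cong) (auto simp: scaleCL_compose[OF a(1)] simp flip: power_add)
    ultimately show ?thesis by simp
  qed
  show "(\<lambda>n. scaleCL (\<i> ^ n) (\<Sum>i\<le>n. a i o\<^sub>L b (n - i))) sums (p o\<^sub>L q)"
    using prod[of \<i>] X(2) Y(2) by (simp add: sums_iff)
  show "M3.expands v (X o\<^sub>L Y) (\<lambda>n. \<Sum>i\<le>n. a i o\<^sub>L b (n - i))"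
    unfolding M3.expands_def
  proof (intro conjI allI impI)
    show "(\<Sum>i\<le>n. a i o\<^sub>L b (n - i)) \<in> cblin" for n by (intro cblin_sum cblin_compose a b)
    show "summable (\<lambda>n. norm (\<Sum>i\<le>n. a i o\<^sub>L b (n - i)))"
      by (rule bilinear_Cauchy_product_sums(1)[OF bl a(2) b(2)])
    fix s :: real assume s: "\<bar>s\<bar> \<le> 1"
    have 1: "(\<Sum>n. scaleCL (complex_of_real s ^ n) (a n)) = T1 (s *\<^sub>R v) X"
      using X(1) s by (simp add: M1.expands_def sums_iff scaleCL_of_real flip: of_real_power)
    have 2: "(\<Sum>n. scaleCL (complex_of_real s ^ n) (b n)) = T2 (s *\<^sub>R v) Y"
      using Y(1) s by (simp add: M2.expands_def sums_iff scaleCL_of_real flip: of_real_power)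
    show "(\<lambda>n. s ^ n *\<^sub>R (\<Sum>i\<le>n. a i o\<^sub>L b (n - i))) sums T3 (s *\<^sub>R v) (X o\<^sub>L Y)"
      using prod[of "of_real s"] s unfolding 1 2 mult by (simp add: scaleCL_of_real flip: of_real_power)
  qed
qed

text \<open>Power series coefficients of the inverse of \<open>\<Sum> a\<^sub>n r\<^sup>n\<close>, where \<open>B\<close> is the inverse of \<open>a\<^sub>0\<close>.\<close>

fun inverse_coeff :: "(nat \<Rightarrow> 'a::real_normed_vector \<Rightarrow>\<^sub>L 'b::real_normed_vector) \<Rightarrow> ('b \<Rightarrow>\<^sub>L 'a) \<Rightarrow> nat \<Rightarrow> ('b \<Rightarrow>\<^sub>L 'a)" where
  "inverse_coeff a B 0 = B"
| "inverse_coeff a B (Suc n) = - (B o\<^sub>L (\<Sum>i\<le>n. a (Suc i) o\<^sub>L inverse_coeff a B (n - i)))"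

text \<open>By the recursion the partial sums S of the norms satisfy S <= norm B + q S, which gives
  the geometric bound without estimates of single coefficients. The series is
  \<open>T2 (s *\<^sub>R v) B\<close> by uniqueness of inverses: the latter is a left inverse of
  \<open>T1 (s *\<^sub>R v) A\<close>, the series a right inverse.\<close>

lemma expands_inverse:
  assumes "L1_mod T1 act1" "L1_mod T2 act2"
    and A: "A \<in> cblin" "L1_mod.expands T1 v A a" and B: "B \<in> cblin" "A o\<^sub>L B = id_blinfun"
    and inv: "\<And>t. T2 t B o\<^sub>L T1 t A = id_blinfun"
    and q: "norm B * (\<Sum>n. norm (a (Suc n))) \<le> q" "q < 1"
  obtains b where "L1_mod.expands T2 v B b" "(\<Sum>n. norm (b n)) \<le> norm B / (1 - q)"
proof -
  interpret M1: L1_mod T1 act1 by fact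
  interpret M2: L1_mod T2 act2 by fact
  define b where "b = inverse_coeff a B"
  have ac: "a n \<in> cblin" and as: "summable (\<lambda>n. norm (a n))" for n using A(2) by (auto simp: M1.expands_def)
  have as1: "summable (\<lambda>n. norm (a (Suc n)))" using as by (subst summable_Suc_iff)
  \<comment> \<open>At s = 0 only the term n = 0 survives; hence \<open>B\<close> inverts the
    constant coefficient.\<close>
  have a0: "a 0 = A"
  proof -
    have "(\<lambda>n. 0 ^ n *\<^sub>R a n) sums A"
      using A(2) M1.T_zero[OF A(1)] unfolding M1.expands_def by (metis abs_zero scaleR_zero_left zero_le_one)
    moreover have "(\<lambda>n. (0::real) ^ n *\<^sub>R a n) sums a 0"
    proof -
      have "(\<lambda>n. (0::real) ^ n *\<^sub>R a n) = (\<lambda>n. if n = 0 then a n else 0)" by (auto simp: power_0_left)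
      then show ?thesis using sums_single[of 0 a] by simp
    qed
    ultimately show ?thesis using sums_unique2 by blast
  qed
  have bc: "b n \<in> cblin" for n
  proof (induction n rule: less_induct)
    case (less n)
    then show ?case
      by (cases n) (auto simp: b_def B intro!: cblin_uminus cblin_compose cblin_sum ac)
  qed
  have bS: "norm (b (Suc n)) \<le> norm B * (\<Sum>i\<le>n. norm (a (Suc i)) * norm (b (n - i)))" for n
  proof -
    have "norm (b (Suc n)) \<le> norm B * norm (\<Sum>i\<le>n. a (Suc i) o\<^sub>L b (n - i))"
      unfolding b_def by (simp add: norm_blinfun_compose)
    also have "\<dots> \<le> norm B * (\<Sum>i\<le>n. norm (a (Suc i)) * norm (b (n - i)))"
      by (intro mult_left_mono sum_norm_le norm_blinfun_compose) auto
    finally show ?thesis .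
  qed
  have part: "(\<Sum>k<N. norm (b k)) \<le> norm B / (1 - q)" for N
  proof -
    have "(\<Sum>k<Suc N. norm (b k)) = norm B + (\<Sum>n<N. norm (b (Suc n)))"
      unfolding sum.lessThan_Suc_shift by (simp add: b_def)
    also have "(\<Sum>n<N. norm (b (Suc n))) \<le> (\<Sum>n<N. norm B * (\<Sum>i\<le>n. norm (a (Suc i)) * norm (b (n - i))))"
      by (rule sum_mono) (rule bS)
    also have "\<dots> = norm B * (\<Sum>(i,j)\<in>{(i,j). i + j < N}. norm (a (Suc i)) * norm (b j))"
      unfolding sum.triangle_reindex sum_distrib_left ..
    \<comment> \<open>Enlarging the triangle to the square makes the double sum factor.\<close>
    also have "\<dots> \<le> norm B * (\<Sum>(i,j)\<in>{..<N} \<times> {..<N}. norm (a (Suc i)) * norm (b j))"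
      by (intro mult_left_mono sum_mono2) auto
    also have "\<dots> = norm B * ((\<Sum>i<N. norm (a (Suc i))) * (\<Sum>j<N. norm (b j)))"
      by (simp add: sum_product sum.cartesian_product)
    also have "\<dots> \<le> norm B * ((\<Sum>i. norm (a (Suc i))) * (\<Sum>j<N. norm (b j)))"
      by (intro mult_left_mono mult_right_mono sum_le_suminf as1) (auto intro: sum_nonneg)
    also have "\<dots> \<le> q * (\<Sum>j<N. norm (b j))"
      using mult_right_mono[OF q(1), of "\<Sum>j<N. norm (b j)"] by (simp add: sum_nonneg mult.assoc)
    finally have "(\<Sum>k<N. norm (b k)) + norm (b N) \<le> norm B + q * (\<Sum>j<N. norm (b j))" by simp
    then have "(1 - q) * (\<Sum>k<N. norm (b k)) \<le> norm B" by (simp add: algebra_simps) (smt (verit) norm_ge_zero)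
    then show ?thesis using q(2) by (simp add: pos_le_divide_eq mult.commute)
  qed
  have bs: "summable (\<lambda>n. norm (b n))"
  proof (rule bounded_imp_summable)
    show "(\<Sum>k\<le>n. norm (b k)) \<le> norm B / (1 - q)" for n using part[of "Suc n"] by (simp only: lessThan_Suc_atMost)
  qed simp
  have conv: "(\<Sum>i\<le>n. a i o\<^sub>L b (n - i)) = (if n = 0 then id_blinfun else 0)" for n
  proof (cases n)
    case 0 then show ?thesis by (simp add: a0 b_def B)
  next
    case (Suc k)
    let ?S = "\<Sum>i\<le>k. a (Suc i) o\<^sub>L b (k - i)"
    have "(\<Sum>i\<le>Suc k. a i o\<^sub>L b (Suc k - i)) = (A o\<^sub>L b (Suc k)) + ?S"
      unfolding sum.atMost_Suc_shift by (simp add: a0)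
    also have "A o\<^sub>L b (Suc k) = - ((A o\<^sub>L B) o\<^sub>L ?S)"
      by (rule blinfun_eqI) (simp add: b_def blinfun.minus_left blinfun.minus_right)
    also have "\<dots> = - ?S" unfolding B by (rule blinfun_eqI) (simp add: blinfun.minus_left)
    finally show ?thesis using Suc by simp
  qed
  show ?thesis
  proof
    show "(\<Sum>n. norm (b n)) \<le> norm B / (1 - q)" by (rule suminf_le_const[OF bs part])
    show "M2.expands v B b"
      unfolding M2.expands_def
    proof (intro conjI allI impI bc bs)
      fix s :: real assume s: "\<bar>s\<bar> \<le> 1"
      have as': "summable (\<lambda>n. norm (s ^ n *\<^sub>R a n))"
        by (rule summable_comparison_test'[OF as]) (use s in \<open>simp add: power_abs power_le_one mult_left_le_one_le\<close>)
      have bs': "summable (\<lambda>n. norm (s ^ n *\<^sub>R b n))"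
        by (rule summable_comparison_test'[OF bs]) (use s in \<open>simp add: power_abs power_le_one mult_left_le_one_le\<close>)
      define C where "C = (\<Sum>n. s ^ n *\<^sub>R b n)"
      have TA: "(\<Sum>n. s ^ n *\<^sub>R a n) = T1 (s *\<^sub>R v) A" using A(2) s by (simp add: M1.expands_def sums_iff)
      have "(\<Sum>i\<le>n. (s ^ i *\<^sub>R a i) o\<^sub>L (s ^ (n - i) *\<^sub>R b (n - i))) = (if n = 0 then id_blinfun else 0)" for n
      proof -
        have "(\<Sum>i\<le>n. (s ^ i *\<^sub>R a i) o\<^sub>L (s ^ (n - i) *\<^sub>R b (n - i))) = s ^ n *\<^sub>R (\<Sum>i\<le>n. a i o\<^sub>L b (n - i))"
          unfolding scaleR_sum_right
          by (rule sum.cong) (auto simp: bounded_bilinear.scaleR_left[OF bounded_bilinear_blinfun_compose] bounded_bilinear.scaleR_right[OF bounded_bilinear_blinfun_compose] simp flip: power_add)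
        then show ?thesis by (simp add: conv)
      qed
      with bilinear_Cauchy_product_sums(2)[OF bounded_bilinear_blinfun_compose as' bs']
      have "(\<lambda>n. if n = 0 then id_blinfun else 0) sums (T1 (s *\<^sub>R v) A o\<^sub>L C)" by (simp add: TA C_def)
      then have id: "T1 (s *\<^sub>R v) A o\<^sub>L C = id_blinfun"
        using sums_single[of 0 "\<lambda>_. id_blinfun"] sums_unique2 by blast
      have "T2 (s *\<^sub>R v) B = T2 (s *\<^sub>R v) B o\<^sub>L (T1 (s *\<^sub>R v) A o\<^sub>L C)"
        unfolding id by (rule blinfun_eqI) simp
      also have "\<dots> = (T2 (s *\<^sub>R v) B o\<^sub>L T1 (s *\<^sub>R v) A) o\<^sub>L C" by (rule blinfun_eqI) simp
      also have "\<dots> = C" unfolding inv by (rule blinfun_eqI) simp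
      finally show "(\<lambda>n. s ^ n *\<^sub>R b n) sums T2 (s *\<^sub>R v) B"
        unfolding C_def using summable_sums[OF summable_norm_cancel[OF bs']] by simp
    qed
  qed
qed

text \<open>A varying width serves the limit for touching spectra, a varying centre the
  measurability of \<open>act (ker 1 a) x\<close> in \<open>a\<close>. Widths in [w/2, w] share a
  common majorant.\<close>

lemma ker_L1_continuous:
  fixes c :: "real^'n" and C :: "nat \<Rightarrow> real^'n"
  assumes w: "w > 0" "\<And>i. w/2 \<le> W i" "\<And>i. W i \<le> w" "W \<longlonglongrightarrow> w" and c: "C \<longlonglongrightarrow> c"
  shows "(\<lambda>i. L1norm (\<lambda>t. ker (W i) (C i) t - ker w c t)) \<longlonglongrightarrow> 0"
proof -
  define d where "d = (\<lambda>t. 2 * w / (1 + (w/2 * t)\<^sup>2))"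
  have W0: "W i > 0" for i using w(1) w(2)[of i] by linarith
  have "integrable lborel (\<lambda>x::real. inverse (1 + x\<^sup>2))"
    using integrable_inverse_1_plus_square by (simp add: set_integrable_def)
  from lborel_integrable_real_affine[OF this, of "w/2" 0] w(1)
  have "integrable lborel (\<lambda>t. 2 * w * inverse (1 + (w/2 * t)\<^sup>2))" by simp
  moreover have "d = (\<lambda>t. 2 * w * inverse (1 + (w/2 * t)\<^sup>2))" unfolding d_def by (simp only: divide_inverse)
  ultimately have "integrable lborel d" by (simp only:)
  then have "integrable lborel (\<lambda>t. complex_of_real (d t))"
    by (rule integrable_of_real)
  then have "integrable lborel (\<lambda>t::real^'n. \<Prod>j\<in>UNIV. complex_of_real (d (t $ j)))"
    by (rule integrable_prod_vec)
  then have Di: "integrable lborel (\<lambda>t::real^'n. 2 * norm (\<Prod>j\<in>UNIV. complex_of_real (d (t $ j))))"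
    by (intro integrable_mult_right integrable_norm)
  have bound: "norm (ker u b t) \<le> norm (\<Prod>j\<in>UNIV. complex_of_real (d (t $ j)))" if u: "w/2 \<le> u" "u \<le> w" for u and b t :: "real^'n"
  proof -
    have d0: "0 \<le> d r" for r using w(1) by (simp add: d_def)
    have "norm (ker u b t) = (\<Prod>j\<in>UNIV. u * fejer (u * t $ j))"
      using u w(1) by (simp add: ker_def norm_mult prod_norm[symmetric] fejer_nonneg abs_mult)
    also have "\<dots> \<le> (\<Prod>j\<in>UNIV. d (t $ j))"
    proof (rule prod_mono, intro conjI)
      fix j
      show "0 \<le> u * fejer (u * t $ j)" using u w(1) fejer_nonneg by simp
      have "(w/2)\<^sup>2 \<le> u\<^sup>2" using u w(1) by (intro power_mono) auto
      then have "(w/2 * t $ j)\<^sup>2 \<le> (u * t $ j)\<^sup>2" by (simp only: power_mult_distrib mult_right_mono zero_le_power2)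
      then have "2 / (1 + (u * t $ j)\<^sup>2) \<le> 2 / (1 + (w/2 * t $ j)\<^sup>2)"
        by (intro divide_left_mono mult_pos_pos) (auto simp: add_pos_nonneg)
      then have "fejer (u * t $ j) \<le> 2 / (1 + (w/2 * t $ j)\<^sup>2)" using fejer_le order_trans by blast
      then have "u * fejer (u * t $ j) \<le> w * (2 / (1 + (w/2 * t $ j)\<^sup>2))"
        using u w(1) fejer_nonneg by (intro mult_mono) auto
      then show "u * fejer (u * t $ j) \<le> d (t $ j)" by (simp add: d_def mult.commute)
    qed
    also have "\<dots> = norm (\<Prod>j\<in>UNIV. complex_of_real (d (t $ j)))"
      by (simp add: prod_norm[symmetric] d0)
    finally show ?thesis .
  qed
  have "(\<lambda>i. L1norm (\<lambda>t. ker (W i) (C i) t - ker w c t)) \<longlonglongrightarrow> integral\<^sup>L lborel (\<lambda>t::real^'n. 0)"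
    unfolding L1norm_def
  proof (rule integral_dominated_convergence[OF _ _ Di])
    show "(\<lambda>t. norm (ker (W i) (C i) t - ker w c t)) \<in> borel_measurable lborel" for i
      using ker_integrable[OF W0, of i "C i"] ker_integrable[OF w(1), of c] by auto
    show "AE t in lborel. (\<lambda>i. norm (ker (W i) (C i) t - ker w c t)) \<longlonglongrightarrow> 0"
    proof (rule AE_I2)
      fix t :: "real^'n"
      have f: "isCont fejer x" for x
        using continuous_on_fejer[of UNIV "\<lambda>x. x"] by (simp add: continuous_on_eq_continuous_at)
      have "(\<lambda>i. ker (W i) (C i) t) \<longlonglongrightarrow> ker w c t"
        unfolding ker_def
        by (intro tendsto_intros isCont_tendsto_compose[OF f] w c)
      then show "(\<lambda>i. norm (ker (W i) (C i) t - ker w c t)) \<longlonglongrightarrow> 0"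
        by (intro tendsto_norm_zero) (simp add: LIM_zero_iff)
    qed
    show "AE t in lborel. norm (norm (ker (W i) (C i) t - ker w c t)) \<le> 2 * norm (\<Prod>j\<in>UNIV. complex_of_real (d (t $ j)))" for i
    proof (rule AE_I2)
      fix t :: "real^'n"
      have "norm (ker (W i) (C i) t - ker w c t) \<le> norm (ker (W i) (C i) t) + norm (ker w c t)"
        by (rule norm_triangle_ineq4)
      then show "norm (norm (ker (W i) (C i) t - ker w c t)) \<le> 2 * norm (\<Prod>j\<in>UNIV. complex_of_real (d (t $ j)))"
        using bound[OF w(2,3), of i "C i" t] bound[of w c t] w(1) by simp
    qed
  qed simp
  then show ?thesis by simp
qed

lemma (in L1_mod) act_ker_tendsto:
  assumes w: "w > 0" "\<And>i. w/2 \<le> W i" "\<And>i. W i \<le> w" "W \<longlonglongrightarrow> w" and c: "C \<longlonglongrightarrow> c" and x: "x \<in> cblin"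
  shows "(\<lambda>i. act (ker (W i) (C i)) x) \<longlonglongrightarrow> act (ker w c) x"
proof (rule LIM_zero_cancel, rule Lim_null_comparison)
  have W0: "W i > 0" for i using w(1) w(2)[of i] by linarith
  show "\<forall>\<^sub>F i in sequentially. norm (act (ker (W i) (C i)) x - act (ker w c) x) \<le> L1norm (\<lambda>t. ker (W i) (C i) t - ker w c t) * norm x"
    by (intro always_eventually allI, subst act_diff_left[symmetric])
       (auto intro!: act_norm ker_integrable W0 w x)
  show "(\<lambda>i. L1norm (\<lambda>t. ker (W i) (C i) t - ker w c t) * norm x) \<longlonglongrightarrow> 0"
    by (intro tendsto_mult_left_zero ker_L1_continuous w c)
qed

lemma ker_hat_support: "w > 0 \<Longrightarrow> ker_hat w c l \<noteq> 0 \<Longrightarrow> \<bar>l $ j - c $ j\<bar> < w"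
  by (auto simp: ker_hat_def tri_eq_0_iff not_le)

lemma ker_hat_support_axis:
  fixes c l :: "real^'n"
  assumes "w > 0" "ker_hat w c l / K \<noteq> 0"
  shows "l \<bullet> axis j r \<in> {r * c $ j - \<bar>r\<bar> * w..r * c $ j + \<bar>r\<bar> * w}"
proof -
  have "\<bar>l $ j - c $ j\<bar> \<le> w" using ker_hat_support[OF assms(1), of c l j] assms(2) by auto
  then have "\<bar>r\<bar> * \<bar>l $ j - c $ j\<bar> \<le> \<bar>r\<bar> * w" by (rule mult_left_mono) simp
  then have "\<bar>r * l $ j - r * c $ j\<bar> \<le> \<bar>r\<bar> * w" by (simp add: abs_mult[symmetric] right_diff_distrib)
  moreover have "l \<bullet> axis j r = r * l $ j" by (simp add: inner_axis mult.commute)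
  ultimately show ?thesis by (auto simp: abs_le_iff)
qed

text \<open>Equality is allowed in the gap condition, where the spectra touch: the exponential bound only
settles kernels of smaller width, and the limit over the width does the rest.\<close>

lemma act_ker_product_0:
  fixes c1 c2 c3 :: "real^'n"
  assumes M: "L1_mod T1 act1" "L1_mod T2 act2" "L1_mod T3 act3"
    and mult: "\<And>t X Y. X \<in> cblin \<Longrightarrow> Y \<in> cblin \<Longrightarrow> T3 t (X o\<^sub>L Y) = T1 t X o\<^sub>L T2 t Y"
    and X: "X \<in> cblin" and Y: "Y \<in> cblin" and w: "w > 0"
    and gap: "3 * w \<le> \<bar>c3 $ j - c1 $ j - c2 $ j\<bar>"
  shows "act3 (ker w c3) (act1 (ker w c1) X o\<^sub>L act2 (ker w c2) Y) = 0"
proof -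
  interpret M1: L1_mod T1 act1 by fact
  interpret M2: L1_mod T2 act2 by fact
  interpret M3: L1_mod T3 act3 by fact
  define x y where "x = act1 (ker w c1) X" and "y = act2 (ker w c2) Y"
  have xc: "x \<in> cblin" unfolding x_def by (rule M1.act_cblin[OF ker_integrable[OF w] X])
  have yc: "y \<in> cblin" unfolding y_def by (rule M2.act_cblin[OF ker_integrable[OF w] Y])
  define D where "D = c3 $ j - c1 $ j - c2 $ j"
  \<comment> \<open>Additivity of spectra along coordinate j: the value of the product at i is the
    product of the values, so the centres c1 and c2 are subtracted from c3. The real r is free; it
    will tend to infinity in modulus with sign opposite to \<open>D\<close>.\<close>
  have bound: "norm (act3 (ker u c3) (x o\<^sub>L y)) \<le> exp (r * D + \<bar>r\<bar> * (u + 2 * w)) * (norm x * norm y)" if u: "u > 0" for u r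
  proof -
    let ?v = "axis j r :: real^'n"
    have nn: "0 \<le> \<bar>r\<bar> * w" using w by simp
    have supp: "l \<bullet> ?v \<in> {r * c $ j - \<bar>r\<bar> * u..r * c $ j + \<bar>r\<bar> * u}"
      if "u > 0" "ker_hat u c l / complex_of_real ((2 * pi) ^ CARD('n)) \<noteq> 0" for c l u
      using that by (rule ker_hat_support_axis)
    obtain a p where a: "M1.expands ?v x a" "(\<lambda>n. scaleCL (\<i> ^ n) (a n)) sums p"
      "norm p \<le> exp (- (r * c1 $ j) + \<bar>r\<bar> * w) * norm x"
      by (rule M1.expands_act[OF frep_ker[OF w, of c1] supp[OF w, of c1] nn X, folded x_def]) (assumption, rule that)
    obtain b q where b: "M2.expands ?v y b" "(\<lambda>n. scaleCL (\<i> ^ n) (b n)) sums q"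
      "norm q \<le> exp (- (r * c2 $ j) + \<bar>r\<bar> * w) * norm y"
      by (rule M2.expands_act[OF frep_ker[OF w, of c2] supp[OF w, of c2] nn Y, folded y_def]) (assumption, rule that)
    note E = expands_compose[OF M mult[OF xc yc] a(1,2) b(1,2)]
    have "norm (act3 (ker u c3) (x o\<^sub>L y)) \<le> exp (r * c3 $ j + \<bar>r\<bar> * u) * L1norm (ker u c3) * norm (p o\<^sub>L q)"
      by (rule M3.transfer_bound[OF frep_ker[OF u] supp[OF u] _ cblin_compose[OF xc yc] E]) (use u in auto)
    also have "\<dots> \<le> exp (r * c3 $ j + \<bar>r\<bar> * u) * (norm p * norm q)"
      by (simp add: L1norm_ker[OF u] norm_blinfun_compose)
    also have "\<dots> \<le> exp (r * c3 $ j + \<bar>r\<bar> * u) * ((exp (- (r * c1 $ j) + \<bar>r\<bar> * w) * norm x) * (exp (- (r * c2 $ j) + \<bar>r\<bar> * w) * norm y))"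
      by (intro mult_left_mono mult_mono a b) auto
    also have "\<dots> = exp ((r * c3 $ j + \<bar>r\<bar> * u) + (- (r * c1 $ j) + \<bar>r\<bar> * w) + (- (r * c2 $ j) + \<bar>r\<bar> * w)) * (norm x * norm y)"
      by (simp only: exp_add mult_ac)
    also have "(r * c3 $ j + \<bar>r\<bar> * u) + (- (r * c1 $ j) + \<bar>r\<bar> * w) + (- (r * c2 $ j) + \<bar>r\<bar> * w) = r * D + \<bar>r\<bar> * (u + 2 * w)"
      by (simp add: D_def algebra_simps)
    finally show ?thesis .
  qed
  have strict: "act3 (ker u c3) (x o\<^sub>L y) = 0" if u: "u > 0" "u < w" for u
  proof -
    define g where "g = \<bar>D\<bar> - (u + 2 * w)"
    have g: "g > 0" using gap u by (simp add: g_def D_def)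
    have le: "norm (act3 (ker u c3) (x o\<^sub>L y)) \<le> exp (- g) ^ n * (norm x * norm y)" for n
    proof -
      \<comment> \<open>With r = - n sgn D the exponent is - n (|D| - u - 2 w), which for n > 0 is
        negative because u < w and |D| is at least 3 w.\<close>
      have "(- sgn D * real n) * D + \<bar>- sgn D * real n\<bar> * (u + 2 * w) = real n * (- g)"
      proof -
        have "D \<noteq> 0" using gap w by (auto simp: D_def)
        then show ?thesis by (auto simp: g_def sgn_if abs_mult algebra_simps)
      qed
      then show ?thesis using bound[OF u(1), of "- sgn D * real n"] exp_of_nat_mult[of n "- g"] by simp
    qed
    have "(\<lambda>n. exp (- g) ^ n * (norm x * norm y)) \<longlonglongrightarrow> 0"
      by (intro tendsto_mult_left_zero LIMSEQ_realpow_zero) (use g in auto)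
    then have "norm (act3 (ker u c3) (x o\<^sub>L y)) \<le> 0"
      by (rule LIMSEQ_le_const) (use le in auto)
    then show ?thesis by simp
  qed
  \<comment> \<open>Starts at w/2, as \<open>act_ker_tendsto\<close> requires, and stays strictly
    below w.\<close>
  define W where "W = (\<lambda>i. w * (1 - 1 / real (i + 2)))"
  have "(\<lambda>i. act3 (ker (W i) c3) (x o\<^sub>L y)) \<longlonglongrightarrow> act3 (ker w c3) (x o\<^sub>L y)"
  proof (rule M3.act_ker_tendsto[OF w _ _ _ tendsto_const cblin_compose[OF xc yc]])
    show "w/2 \<le> W i" "W i \<le> w" for i using w by (auto simp: W_def field_simps)
    have "(\<lambda>i. 1 / real (i + 2)) \<longlonglongrightarrow> 0"
      using LIMSEQ_ignore_initial_segment[OF lim_1_over_n, of 2] by simp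
    then have "(\<lambda>i. w * (1 - 1 / real (i + 2))) \<longlonglongrightarrow> w * (1 - 0)" by (intro tendsto_intros)
    then show "W \<longlonglongrightarrow> w" by (simp add: W_def)
  qed
  moreover have "act3 (ker (W i) c3) (x o\<^sub>L y) = 0" for i
    by (rule strict) (use w in \<open>auto simp: W_def field_simps intro: add_pos_nonneg\<close>)
  ultimately show ?thesis unfolding x_def y_def by (simp add: LIMSEQ_const_iff)
qed

section \<open>Convolution and non-degeneracy\<close>

lemma integral_affine_vec:
  fixes f :: "real^'n \<Rightarrow> 'b::{banach, second_countable_topology}"
  assumes [measurable]: "f \<in> borel_measurable borel" and c: "c \<noteq> 0"
  shows "(\<integral>x. f x \<partial>lborel) = \<bar>c\<bar> ^ CARD('n) *\<^sub>R (\<integral>x. f (t + c *\<^sub>R x) \<partial>lborel)"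
proof -
  have "(lborel :: (real^'n) measure) = density (distr lborel borel (\<lambda>x. t + c *\<^sub>R x)) (\<lambda>_. ennreal (\<bar>c\<bar>^CARD('n)))"
    using lborel_affine[OF c, of t] by (simp add: ennreal_power)
  then have "(\<integral>x. f x \<partial>lborel) = (\<integral>x. f x \<partial>density (distr lborel borel (\<lambda>x. t + c *\<^sub>R x)) (\<lambda>_. ennreal (\<bar>c\<bar>^CARD('n))))"
    by simp
  also have "\<dots> = \<bar>c\<bar> ^ CARD('n) *\<^sub>R (\<integral>x. f (t + c *\<^sub>R x) \<partial>lborel)"
    by (subst integral_density) (auto simp: integral_distr)
  finally show ?thesis .
qed

lemma conv_commute:
  assumes "integrable lborel f" "integrable lborel g"
  shows "conv f g = conv g f"
proof
  fix t
  have [measurable]: "f \<in> borel_measurable borel" "g \<in> borel_measurable borel" using assms by auto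
  show "conv f g t = conv g f t"
    unfolding conv_def
    by (subst integral_affine_vec[of _ "-1" t]) (auto simp: mult.commute)
qed

text \<open>Only one factor has to be a Fourier integral; Fubini then inserts the transform of the
  other. Thus a kernel whose transform is 0 or 1 on the support of \<open>P\<close> acts there as
  zero or as the identity.\<close>

lemma conv_frep:
  assumes f: "integrable lborel f" and g: "frep g P"
  shows "conv f g t = (\<integral>l. fourier f l * P l * cis (l \<bullet> t) \<partial>lborel)"
proof -
  have P: "integrable lborel P" using g by (rule frepD)
  have [measurable]: "f \<in> borel_measurable borel" "P \<in> borel_measurable borel" using f P by auto
  let ?h = "\<lambda>s l. f s * (P l * cis (l \<bullet> (t - s)))"
  have i: "integrable (lborel \<Otimes>\<^sub>M lborel) (case_prod ?h)"
  proof (rule lborel_pair.Fubini_integrable)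
    show "AE s in lborel. integrable lborel (\<lambda>l. case_prod ?h (s, l))"
      by (auto intro!: AE_I2 integrable_mult_right integrable_mult_cis P)
    show "integrable lborel (\<lambda>s. \<integral>l. norm (case_prod ?h (s, l)) \<partial>lborel)"
      using f by (simp add: norm_mult)
  qed measurable
  have "conv f g t = (\<integral>s. (\<integral>l. ?h s l \<partial>lborel) \<partial>lborel)"
    unfolding conv_def frepD(3)[OF g] by simp
  also have "\<dots> = (\<integral>l. (\<integral>s. ?h s l \<partial>lborel) \<partial>lborel)"
    using lborel_pair.Fubini_integral[OF i] by simp
  also have "\<dots> = (\<integral>l. fourier f l * P l * cis (l \<bullet> t) \<partial>lborel)"
  proof (rule Bochner_Integration.integral_cong[OF refl])
    fix l
    have "?h s l = (f s * exp (- \<i> * complex_of_real (s \<bullet> l))) * (P l * cis (l \<bullet> t))" for s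
      by (simp add: cis_conv_exp inner_diff_right right_diff_distrib exp_diff exp_minus inner_commute field_simps)
    then have "(\<integral>s. ?h s l \<partial>lborel) = fourier f l * (P l * cis (l \<bullet> t))"
      unfolding fourier_def by (simp only: integral_mult_left_zero)
    then show "(\<integral>s. ?h s l \<partial>lborel) = fourier f l * P l * cis (l \<bullet> t)"
      by (simp only: mult.assoc)
  qed
  finally show ?thesis .
qed

context L1_mod begin

lemma act_commute:
  assumes "integrable lborel f" "integrable lborel g" "x \<in> cblin"
  shows "act f (act g x) = act g (act f x)"
  using assms conv_commute[of f g] act_conv by metis

lemma act_act_0:
  assumes "integrable lborel f" "frep g P" "x \<in> cblin" "\<And>l. P l \<noteq> 0 \<Longrightarrow> fourier f l = 0"
  shows "act f (act g x) = 0"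
proof -
  have "conv f g t = 0" for t
    unfolding conv_frep[OF assms(1,2)] using assms(4)
    by (subst Bochner_Integration.integral_cong[OF refl, of _ _ "\<lambda>_. 0"]) (metis mult_eq_0_iff, simp)
  then have "conv f g = (\<lambda>t. 0)" by auto
  then show ?thesis using act_conv[OF assms(1) frepD(1)[OF assms(2)] assms(3)] act_zero_left[OF assms(3)] by simp
qed

lemma act_act_id:
  assumes "integrable lborel f" "frep g P" "x \<in> cblin" "\<And>l. P l \<noteq> 0 \<Longrightarrow> fourier f l = 1"
  shows "act f (act g x) = act g x"
proof -
  have "conv f g t = g t" for t
    unfolding conv_frep[OF assms(1,2)] frepD(3)[OF assms(2)] using assms(4)
    by (intro Bochner_Integration.integral_cong refl) (metis mult_1 mult_eq_0_iff)
  then have "conv f g = g" by auto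
  then show ?thesis using act_conv[OF assms(1) frepD(1)[OF assms(2)] assms(3)] by simp
qed

end

section \<open>Translation in L1 and \<open>T\<close>-continuity\<close>

lemma L1_translation_approx:
  fixes f :: "real^'n \<Rightarrow> complex"
  assumes f: "integrable lborel f" and S: "S \<longlonglongrightarrow> 0"
    and g: "\<And>e. e > 0 \<Longrightarrow> \<exists>g. integrable lborel g \<and> L1norm (\<lambda>t. f t - g t) \<le> e \<and> (\<lambda>i. L1norm (\<lambda>t. g (t + S i) - g t)) \<longlonglongrightarrow> 0"
  shows "(\<lambda>i. L1norm (\<lambda>t. f (t + S i) - f t)) \<longlonglongrightarrow> 0"
proof (rule LIMSEQ_I)
  fix e :: real assume e: "e > 0"
  obtain g where g: "integrable lborel g" "L1norm (\<lambda>t. f t - g t) \<le> e/3" "(\<lambda>i. L1norm (\<lambda>t. g (t + S i) - g t)) \<longlonglongrightarrow> 0"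
    using g[of "e/3"] e by auto
  obtain N where "\<forall>i\<ge>N. norm (L1norm (\<lambda>t. g (t + S i) - g t) - 0) < e/3"
    using LIMSEQ_D[OF g(3), of "e/3"] e by auto
  then have N: "L1norm (\<lambda>t. g (t + S i) - g t) < e/3" if "i \<ge> N" for i
    using that by (auto simp: abs_less_iff)
  have le: "L1norm (\<lambda>t. f (t + s) - f t) \<le> L1norm (\<lambda>t. f t - g t) + L1norm (\<lambda>t. g (t + s) - g t) + L1norm (\<lambda>t. f t - g t)" for s
  proof -
    have i: "integrable lborel (\<lambda>t. f (t + s) - g (t + s))" "integrable lborel (\<lambda>t. g (t + s) - g t)" "integrable lborel (\<lambda>t. g t - f t)"
      using f g(1) by (auto intro!: integrable_translate)
    have "L1norm (\<lambda>t. f (t + s) - f t) = L1norm (\<lambda>t. ((f (t + s) - g (t + s)) + (g (t + s) - g t)) + (g t - f t))" by simp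
    also have "\<dots> \<le> L1norm (\<lambda>t. (f (t + s) - g (t + s)) + (g (t + s) - g t)) + L1norm (\<lambda>t. g t - f t)"
      by (intro L1norm_add_le Bochner_Integration.integrable_add i)
    also have "\<dots> \<le> (L1norm (\<lambda>t. f (t + s) - g (t + s)) + L1norm (\<lambda>t. g (t + s) - g t)) + L1norm (\<lambda>t. g t - f t)"
      by (intro add_right_mono L1norm_add_le i)
    also have "L1norm (\<lambda>t. f (t + s) - g (t + s)) = L1norm (\<lambda>t. f t - g t)"
      using L1norm_translate[of "\<lambda>t. f t - g t" s] by simp
    also have "L1norm (\<lambda>t. g t - f t) = L1norm (\<lambda>t. f t - g t)"
      by (simp add: L1norm_def norm_minus_commute)
    finally show ?thesis .
  qed
  show "\<exists>N. \<forall>i\<ge>N. norm (L1norm (\<lambda>t. f (t + S i) - f t) - 0) < e"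
  proof (intro exI allI impI)
    fix i assume "i \<ge> N"
    from le[of "S i"] N[OF this] g(2) show "norm (L1norm (\<lambda>t. f (t + S i) - f t) - 0) < e"
      using L1norm_nonneg[of "\<lambda>t. f (t + S i) - f t"] by simp
  qed
qed

text \<open>Approximation reduces the claim to indicators of sets of finite measure, and outer
  regularity to open sets. A point of an open set stays in it under small shifts, so dominated
  convergence applies.\<close>

lemma L1_translation_continuous:
  fixes f :: "real^'n \<Rightarrow> complex"
  assumes "integrable lborel f" "S \<longlonglongrightarrow> 0"
  shows "(\<lambda>i. L1norm (\<lambda>t. f (t + S i) - f t)) \<longlonglongrightarrow> 0"
  using assms(1)
proof (induction rule: integrable_induct)
  case (base A c)
  have A[measurable]: "A \<in> sets borel" and Afin: "emeasure lborel A < \<infinity>" using base by auto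
  show ?case
  proof (rule L1_translation_approx[OF _ assms(2)])
    show "integrable lborel (\<lambda>x. indicator A x *\<^sub>R c)"
      using base by (intro integrable_scaleR_left integrable_real_indicator) auto
    fix e :: real assume e: "e > 0"
    define e' where "e' = e / (norm c + 1)"
    have e': "e' > 0" using e by (auto simp: e'_def intro!: divide_pos_pos add_nonneg_pos)
    obtain U where U: "open U" "A \<subseteq> U" "emeasure lborel (U - A) < ennreal e'"
      using outer_regular_lborel[OF A e'] by blast
    have [measurable]: "U \<in> sets borel" using U(1) by auto
    have UA: "emeasure lborel (U - A) < \<infinity>" using U(3) by (simp add: less_top order.strict_trans)
    have "emeasure lborel U \<le> emeasure lborel A + emeasure lborel (U - A)"
      using emeasure_subadditive[of A lborel "U - A"] U(2) by (simp add: Un_absorb1)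
    also have "\<dots> < \<infinity>" using Afin UA by (simp add: ennreal_add_less_top)
    finally have Ufin: "emeasure lborel U < \<infinity>" .
    have iU: "integrable lborel (\<lambda>x. indicator U x :: real)" using Ufin by (intro integrable_real_indicator) auto
    have iUs: "integrable lborel (\<lambda>x. indicator U (x + s) :: real)" for s
    proof -
      have "integrable lborel (\<lambda>x. complex_of_real (indicator U x))" using iU by (rule integrable_of_real)
      from integrable_translate[OF this, of s] show ?thesis by (simp add: complex_of_real_integrable_eq)
    qed
    have int0: "(\<integral>t. indicator U (t + s) \<partial>lborel) = (\<integral>t. indicat_real U t \<partial>lborel)" for s
    proof -
      have "complex_of_real (\<integral>t. indicator U (t + s) \<partial>lborel) = complex_of_real (\<integral>t. indicat_real U t \<partial>lborel)"
        unfolding integral_complex_of_real[symmetric] by (rule integral_translate)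
      then show ?thesis by simp
    qed
    \<comment> \<open>The part of \<open>U\<close> lost by the shift; since shifts preserve measure,
      equally much is gained, whence the factor 2 in \<open>Leq\<close>.\<close>
    define p where "p = (\<lambda>i t. indicator U t * (1 - indicator U (t + S i)) :: real)"
    have pi: "integrable lborel (p i)" for i
      unfolding p_def by (rule Bochner_Integration.integrable_bound[OF iU]) (auto simp: indicator_def)
    have "(\<lambda>i. \<integral>t. p i t \<partial>lborel) \<longlonglongrightarrow> integral\<^sup>L lborel (\<lambda>t::real^'n. 0)"
    proof (rule integral_dominated_convergence[OF _ _ iU])
      show "AE t in lborel. (\<lambda>i. p i t) \<longlonglongrightarrow> 0"
      proof (rule AE_I2)
        fix t :: "real^'n"
        show "(\<lambda>i. p i t) \<longlonglongrightarrow> 0"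
        proof (cases "t \<in> U")
          case True
          have "(\<lambda>i. t + S i) \<longlonglongrightarrow> t + 0" by (intro tendsto_intros assms(2))
          then have "\<forall>\<^sub>F i in sequentially. t + S i \<in> U"
            using topological_tendstoD[OF _ U(1)] True by fastforce
          then show ?thesis by (intro tendsto_eventually, elim eventually_mono) (simp add: p_def)
        qed (simp add: p_def)
      qed
      show "AE t in lborel. norm (p i t) \<le> indicator U t" for i
        by (intro AE_I2) (auto simp: p_def indicator_def)
    qed (use borel_measurable_integrable[OF pi] in auto)
    then have p0: "(\<lambda>i. \<integral>t. p i t \<partial>lborel) \<longlonglongrightarrow> 0" by simp
    have Leq: "L1norm (\<lambda>t. indicator U (t + S i) *\<^sub>R c - indicator U t *\<^sub>R c) = 2 * (\<integral>t. p i t \<partial>lborel) * norm c" for i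
    proof -
      have "norm (indicator U (t + S i) *\<^sub>R c - indicator U t *\<^sub>R c) = (2 * p i t + (indicator U (t + S i) - indicator U t)) * norm c" for t
        by (auto simp: p_def indicator_def)
      then have "L1norm (\<lambda>t. indicator U (t + S i) *\<^sub>R c - indicator U t *\<^sub>R c) = (\<integral>t. 2 * p i t + (indicator U (t + S i) - indicator U t) \<partial>lborel) * norm c"
        by (simp add: L1norm_def)
      also have "(\<integral>t. 2 * p i t + (indicator U (t + S i) - indicator U t) \<partial>lborel) = 2 * (\<integral>t. p i t \<partial>lborel)"
        using pi iU iUs[of "S i"] int0[of "S i"] by simp
      finally show ?thesis .
    qed
    show "\<exists>g. integrable lborel g \<and> L1norm (\<lambda>t. indicator A t *\<^sub>R c - g t) \<le> e \<and> (\<lambda>i. L1norm (\<lambda>t. g (t + S i) - g t)) \<longlonglongrightarrow> 0"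
    proof (intro exI[of _ "\<lambda>t. indicator U t *\<^sub>R c"] conjI)
      show "integrable lborel (\<lambda>t. indicator U t *\<^sub>R c)" using iU by (rule integrable_scaleR_left)
      have "L1norm (\<lambda>t. indicator A t *\<^sub>R c - indicator U t *\<^sub>R c) = (\<integral>t. indicator (U - A) t * norm c \<partial>lborel)"
        unfolding L1norm_def by (rule Bochner_Integration.integral_cong) (use U(2) in \<open>auto simp: indicator_def\<close>)
      also have "\<dots> = measure lborel (U - A) * norm c" by simp
      also have "\<dots> \<le> e' * norm c"
        using U(3) UA e' by (intro mult_right_mono) (auto simp: measure_def enn2real_leI)
      also have "\<dots> \<le> e"
        using e by (simp add: e'_def divide_le_eq add_nonneg_pos)
      finally show "L1norm (\<lambda>t. indicator A t *\<^sub>R c - indicator U t *\<^sub>R c) \<le> e" .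
      show "(\<lambda>i. L1norm (\<lambda>t. indicator U (t + S i) *\<^sub>R c - indicator U t *\<^sub>R c)) \<longlonglongrightarrow> 0"
        unfolding Leq using tendsto_mult[OF tendsto_mult[OF tendsto_const[of 2] p0] tendsto_const[of "norm c"]] by simp
    qed
  qed
next
  case (add f g)
  show ?case
  proof (rule Lim_null_comparison)
    show "(\<lambda>i. L1norm (\<lambda>t. f (t + S i) - f t) + L1norm (\<lambda>t. g (t + S i) - g t)) \<longlonglongrightarrow> 0"
      using tendsto_add[OF add.IH] by simp
    show "\<forall>\<^sub>F i in sequentially. norm (L1norm (\<lambda>t. f (t + S i) + g (t + S i) - (f t + g t))) \<le> L1norm (\<lambda>t. f (t + S i) - f t) + L1norm (\<lambda>t. g (t + S i) - g t)"
    proof (intro always_eventually allI)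
      fix i
      have "L1norm (\<lambda>t. (f (t + S i) - f t) + (g (t + S i) - g t)) \<le> L1norm (\<lambda>t. f (t + S i) - f t) + L1norm (\<lambda>t. g (t + S i) - g t)"
        by (rule L1norm_add_le) (auto intro!: integrable_translate add.hyps)
      then show "norm (L1norm (\<lambda>t. f (t + S i) + g (t + S i) - (f t + g t))) \<le> L1norm (\<lambda>t. f (t + S i) - f t) + L1norm (\<lambda>t. g (t + S i) - g t)"
        by (simp add: L1norm_nonneg add_diff_add)
    qed
  qed
next
  case (lim f s)
  show ?case
  proof (rule L1_translation_approx[OF lim.hyps(4) assms(2)])
    have "(\<lambda>k. \<integral>t. norm (f t - s k t) \<partial>lborel) \<longlonglongrightarrow> integral\<^sup>L lborel (\<lambda>t::real^'n. 0)"
    proof (rule integral_dominated_convergence[of _ _ _ "\<lambda>t. 3 * norm (f t)"])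
      show "AE t in lborel. (\<lambda>k. norm (f t - s k t)) \<longlonglongrightarrow> 0"
      proof (rule AE_I2)
        fix t :: "real^'n"
        have "(\<lambda>k. f t - s k t) \<longlonglongrightarrow> f t - f t" by (intro tendsto_intros lim.hyps(2)) simp
        then show "(\<lambda>k. norm (f t - s k t)) \<longlonglongrightarrow> 0" by (intro tendsto_norm_zero) simp
      qed
      show "AE t in lborel. norm (norm (f t - s k t)) \<le> 3 * norm (f t)" for k
      proof (rule AE_I2)
        fix t
        show "norm (norm (f t - s k t)) \<le> 3 * norm (f t)"
          using lim.hyps(3)[of t k] norm_triangle_ineq4[of "f t" "s k t"] by simp
      qed
    qed (use lim.hyps(1,4) in auto)
    then have l: "(\<lambda>k. L1norm (\<lambda>t. f t - s k t)) \<longlonglongrightarrow> 0" by (simp add: L1norm_def)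
    fix e :: real assume "e > 0"
    then obtain k where "L1norm (\<lambda>t. f t - s k t) \<le> e"
      using LIMSEQ_D[OF l, of e] by (auto simp: abs_of_nonneg L1norm_nonneg) (meson less_imp_le order_refl)
    then show "\<exists>g. integrable lborel g \<and> L1norm (\<lambda>t. f t - g t) \<le> e \<and> (\<lambda>i. L1norm (\<lambda>t. g (t + S i) - g t)) \<longlonglongrightarrow> 0"
      using lim.hyps(1) lim.IH by blast
  qed
qed

context L1_mod begin

text \<open>This makes the integral formula applicable: it is given for \<open>T\<close>-continuous
  elements, and every \<open>act f x\<close> is one.\<close>

lemma continuous_on_T_act:
  assumes f: "integrable lborel f" and x: "x \<in> cblin"
  shows "continuous_on UNIV (\<lambda>t. T t (act f x))"
proof (rule continuous_at_imp_continuous_on, rule ballI)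
  fix s :: "real^'n"
  show "isCont (\<lambda>t. T t (act f x)) s"
    unfolding continuous_at_sequentially
  proof (intro allI impI)
    fix u assume u: "u \<longlonglongrightarrow> s"
    have "(\<lambda>i. u i - s) \<longlonglongrightarrow> 0" using u by (simp add: LIM_zero_iff)
    from L1_translation_continuous[OF f this]
    have l: "(\<lambda>i. L1norm (\<lambda>t. f (t + (u i - s)) - f t) * norm x) \<longlonglongrightarrow> 0" by (rule tendsto_mult_left_zero)
    have "norm (T (u i) (act f x) - T s (act f x)) \<le> L1norm (\<lambda>t. f (t + (u i - s)) - f t) * norm x" for i
    proof -
      have "norm (T (u i) (act f x) - T s (act f x)) = norm (act (\<lambda>t. f (t + u i) - f (t + s)) x)"
        by (simp add: T_act f x act_diff_left integrable_translate)
      also have "\<dots> \<le> L1norm (\<lambda>t. f (t + u i) - f (t + s)) * norm x"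
        by (rule act_norm) (auto intro!: integrable_translate f x)
      also have "L1norm (\<lambda>t. f (t + u i) - f (t + s)) = L1norm (\<lambda>t. f (t + (u i - s)) - f t)"
        using L1norm_translate[of "\<lambda>t. f (t + (u i - s)) - f t" s] by (simp add: algebra_simps)
      finally show ?thesis .
    qed
    then have "(\<lambda>i. T (u i) (act f x) - T s (act f x)) \<longlonglongrightarrow> 0"
      by (intro Lim_null_comparison[OF _ l] always_eventually allI)
    then show "((\<lambda>t. T t (act f x)) \<circ> u) \<longlonglongrightarrow> T s (act f x)" by (simp add: o_def LIM_zero_iff)
  qed
qed

text \<open>Non-degeneracy quantifies over all kernels; here a sequence of Fejer kernels suffices.
  On the \<open>T\<close>-continuous element y = \<open>act f x\<close> they form an approximate
  identity, and they annihilate y because they annihilate x and commute with f.\<close>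

lemma eq_0_if_act_ker_0:
  assumes x: "x \<in> cblin" and k0: "\<And>m. act (ker (real (Suc m)) 0) x = 0"
  shows "x = 0"
proof (rule act_nondegenerate[OF x])
  fix f :: "real^'n \<Rightarrow> complex" assume f: "integrable lborel f"
  define y where "y = act f x"
  have y: "y \<in> cblin" unfolding y_def by (rule act_cblin[OF f x])
  have cont: "continuous_on UNIV (\<lambda>t. T t y)" unfolding y_def by (rule continuous_on_T_act[OF f x])
  define om where "om = (\<lambda>t. norm (y - T (- t) y))"
  have om_cont: "continuous_on UNIV om"
    unfolding om_def by (intro continuous_intros continuous_on_compose2[OF cont]) auto
  have [measurable]: "om \<in> borel_measurable borel" by (rule borel_measurable_continuous_onI[OF om_cont])
  have om_le: "om t \<le> 2 * norm y" for t
    unfolding om_def using norm_triangle_ineq4[of y "T (-t) y"] T_norm[OF y, of "-t"] by simp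
  have om0: "om 0 = 0" by (simp add: om_def T_zero[OF y])
  define k where "k = (\<lambda>w (t::real^'n). norm (ker w 0 t))"
  have kker: "ker w 0 t = of_real (k w t)" if "w > 0" for w t using norm_ker[OF that, of 0 t] by (simp add: k_def)
  have ki: "integrable lborel (k w)" if "w > 0" for w unfolding k_def using ker_integrable[OF that] by auto
  have k1: "(\<integral>t. k w t \<partial>lborel) = 1" if "w > 0" for w using L1norm_ker[OF that, of 0] by (simp add: k_def L1norm_def)
  have koi: "integrable lborel (\<lambda>t. k w t * om (c *\<^sub>R t))" if "w > 0" for w c
  proof (rule Bochner_Integration.integrable_bound[of _ "\<lambda>t. k w t * (2 * norm y)"])
    show "integrable lborel (\<lambda>t. k w t * (2 * norm y))" using ki[OF that] by simp
    show "(\<lambda>t. k w t * om (c *\<^sub>R t)) \<in> borel_measurable lborel" using ki[OF that] by measurable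
    show "AE t in lborel. norm (k w t * om (c *\<^sub>R t)) \<le> norm (k w t * (2 * norm y))"
      using om_le by (intro AE_I2) (auto simp: abs_mult k_def om_def intro!: mult_left_mono)
  qed
  \<comment> \<open>Writing \<open>y\<close> as its own average and subtracting the vanishing
    integral leaves the modulus \<open>om\<close>. Rescaling fixes the kernel and moves the width
    into the argument of \<open>om\<close>, ready for dominated convergence.\<close>
  have bound: "norm y \<le> (\<integral>t. k 1 t * om ((1 / real (Suc m)) *\<^sub>R t) \<partial>lborel)" for m
  proof -
    define w where "w = real (Suc m)"
    have w: "w > 0" by (simp add: w_def)
    have "act (ker w 0) y = act f (act (ker w 0) x)"
      unfolding y_def by (rule act_commute[OF ker_integrable[OF w] f x])
    also have "\<dots> = 0" unfolding w_def k0 by (rule act_zero[OF f])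
    finally have "((\<lambda>t. scaleCL (ker w 0 t) (T (- t) y)) has_integral 0) UNIV"
      using module_axioms2[THEN conjunct2, THEN conjunct2, THEN conjunct2, THEN conjunct2, rule_format, OF y ker_integrable[OF w] cont, of 0] by simp
    then have h0: "((\<lambda>t. k w t *\<^sub>R T (- t) y) has_integral 0) UNIV" by (simp add: kker[OF w] scaleCL_of_real)
    have "(k w has_integral 1) UNIV" using has_integral_integral_lborel[OF ki[OF w]] k1[OF w] by simp
    then have "((\<lambda>t. k w t *\<^sub>R y) has_integral (1 *\<^sub>R y)) UNIV" by (rule has_integral_scaleR_left)
    from has_integral_diff[OF this h0]
    have hi: "((\<lambda>t. k w t *\<^sub>R (y - T (- t) y)) has_integral y) UNIV" by (simp add: scaleR_diff_right)
    have koi': "integrable lborel (\<lambda>t. k w t * om t)" using koi[OF w, of 1] by simp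
    have "norm (integral UNIV (\<lambda>t. k w t *\<^sub>R (y - T (- t) y))) \<le> integral UNIV (\<lambda>t. k w t * om t)"
    proof (rule Henstock_Kurzweil_Integration.integral_norm_bound_integral)
      show "(\<lambda>t. k w t *\<^sub>R (y - T (- t) y)) integrable_on UNIV" using hi by auto
      show "(\<lambda>t. k w t * om t) integrable_on UNIV" by (rule integrable_on_lborel[OF koi'])
    qed (auto simp: om_def k_def)
    also have "integral UNIV (\<lambda>t. k w t *\<^sub>R (y - T (- t) y)) = y" using hi by (rule integral_unique)
    also have "integral UNIV (\<lambda>t. k w t * om t) = (\<integral>t. k w t * om t \<partial>lborel)" by (rule integral_lborel[OF koi'])
    also have "\<dots> = \<bar>1/w\<bar> ^ CARD('n) *\<^sub>R (\<integral>t. k w (0 + (1/w) *\<^sub>R t) * om (0 + (1/w) *\<^sub>R t) \<partial>lborel)"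
      by (rule integral_affine_vec) (use koi' w in auto)
    also have "\<dots> = (\<integral>t. k 1 t * om ((1/w) *\<^sub>R t) \<partial>lborel)"
    proof -
      have "k w ((1/w) *\<^sub>R t) = w ^ CARD('n) * k 1 t" for t
        using w by (simp add: k_def ker_def norm_mult prod_norm[symmetric] prod.distrib abs_mult norm_power)
      then have "(\<integral>t. k w (0 + (1/w) *\<^sub>R t) * om (0 + (1/w) *\<^sub>R t) \<partial>lborel) = w ^ CARD('n) * (\<integral>t. k 1 t * om ((1/w) *\<^sub>R t) \<partial>lborel)"
        by (simp add: mult.assoc)
      then show ?thesis using w by (simp add: power_one_over field_simps)
    qed
    finally show ?thesis by (simp add: w_def)
  qed
  have "(\<lambda>m. \<integral>t. k 1 t * om ((1 / real (Suc m)) *\<^sub>R t) \<partial>lborel) \<longlonglongrightarrow> integral\<^sup>L lborel (\<lambda>t::real^'n. 0)"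
  proof (rule integral_dominated_convergence[of _ _ _ "\<lambda>t. k 1 t * (2 * norm y)"])
    show "AE t in lborel. (\<lambda>m. k 1 t * om ((1 / real (Suc m)) *\<^sub>R t)) \<longlonglongrightarrow> 0"
    proof (rule AE_I2)
      fix t :: "real^'n"
      have "(\<lambda>m. (1 / real (Suc m)) *\<^sub>R t) \<longlonglongrightarrow> 0 *\<^sub>R t"
        by (intro tendsto_intros lim_1_over_n[THEN LIMSEQ_Suc])
      then have "(\<lambda>m. om ((1 / real (Suc m)) *\<^sub>R t)) \<longlonglongrightarrow> om 0"
        using om_cont by (intro isCont_tendsto_compose[of _ om]) (auto simp: continuous_on_eq_continuous_at)
      then show "(\<lambda>m. k 1 t * om ((1 / real (Suc m)) *\<^sub>R t)) \<longlonglongrightarrow> 0"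
        unfolding om0 by (rule tendsto_mult_right_zero)
    qed
    show "AE t in lborel. norm (k 1 t * om ((1 / real (Suc m)) *\<^sub>R t)) \<le> k 1 t * (2 * norm y)" for m
      using om_le by (intro AE_I2) (auto simp: abs_mult k_def om_def intro!: mult_left_mono)
    show "integrable lborel (\<lambda>t. k 1 t * (2 * norm y))" using ki[of 1] by simp
  qed (use koi[of 1] in auto)
  then have "(\<lambda>m. \<integral>t. k 1 t * om ((1 / real (Suc m)) *\<^sub>R t) \<partial>lborel) \<longlonglongrightarrow> 0" by simp
  then have "norm y \<le> 0" by (rule LIMSEQ_le_const) (use bound in auto)
  then show "act f x = 0" by (simp add: y_def)
qed

end

section \<open>Partitions of unity\<close>

text \<open>Lattice boxes as products of coordinate sets: sums of products over them factor, and
  their cardinality is a product.\<close>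

definition vbox :: "('n \<Rightarrow> 'a set) \<Rightarrow> ('a^'n::finite) set" where
  "vbox S = {k. \<forall>j. k $ j \<in> S j}"

lemma vbox_bij: "bij_betw vec_nth (vbox S) (PiE UNIV S)"
  by (rule bij_betw_byWitness[where f' = "\<lambda>f. \<chi> j. f j"]) (auto simp: vbox_def PiE_def Pi_def)

lemma finite_vbox: "(\<And>j. finite (S j)) \<Longrightarrow> finite (vbox S)"
  using bij_betw_finite[OF vbox_bij, of S] by (simp add: finite_PiE)

lemma sum_vbox:
  fixes g :: "'n::finite \<Rightarrow> 'a \<Rightarrow> 'b::comm_semiring_1"
  assumes "\<And>j. finite (S j)"
  shows "(\<Sum>k\<in>vbox S. \<Prod>j\<in>UNIV. g j (k $ j)) = (\<Prod>j\<in>UNIV. \<Sum>i\<in>S j. g j i)"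
  using sum.reindex_bij_betw[OF vbox_bij[of S], of "\<lambda>f. \<Prod>j\<in>UNIV. g j (f j)"] assms
  by (simp add: prod_sum_PiE)

lemma card_vbox: "(\<And>j. finite (S j)) \<Longrightarrow> card (vbox S) = (\<Prod>j\<in>UNIV. card (S j))"
  using bij_betw_same_card[OF vbox_bij, of S] by (simp add: card_PiE)

lemma sum_tri:
  fixes a b :: int
  assumes "real_of_int a \<le> x" "x \<le> real_of_int b"
  shows "(\<Sum>k\<in>{a..b}. tri (x - real_of_int k)) = 1"
proof -
  define f where "f = \<lfloor>x\<rfloor>"
  have f: "real_of_int f \<le> x" "x < real_of_int f + 1" by (auto simp: f_def)
  have "(\<Sum>k\<in>{a..b}. tri (x - real_of_int k)) = (\<Sum>k\<in>{a..b} \<inter> {f, f+1}. tri (x - real_of_int k))"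
  proof (rule sum.mono_neutral_right)
    show "\<forall>k\<in>{a..b} - {a..b} \<inter> {f, f+1}. tri (x - real_of_int k) = 0"
    proof
      fix k assume "k \<in> {a..b} - {a..b} \<inter> {f, f+1}"
      then have "k \<le> f - 1 \<or> k \<ge> f + 2" by auto
      then have "1 \<le> \<bar>x - real_of_int k\<bar>" using f by auto
      then show "tri (x - real_of_int k) = 0" by (simp add: tri_eq_0_iff)
    qed
  qed auto
  also have "\<dots> = (\<Sum>k\<in>{f, f+1}. tri (x - real_of_int k))"
  proof (rule sum.mono_neutral_left)
    have fa: "a \<le> f" using assms(1) by (simp add: f_def le_floor_iff)
    have fb: "f \<le> b" using assms(2) f by linarith
    show "\<forall>k\<in>{f, f+1} - {a..b} \<inter> {f, f+1}. tri (x - real_of_int k) = 0"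
    proof
      fix k assume "k \<in> {f, f+1} - {a..b} \<inter> {f, f+1}"
      \<comment> \<open>The right neighbour falls outside the range only if x = b is an integer, and
        then its triangle vanishes at x.\<close>
      then have "k = f + 1" "f = b" using fa fb by auto
      then have "x = real_of_int f" using assms f by auto
      then show "tri (x - real_of_int k) = 0" using \<open>k = f + 1\<close> by (simp add: tri_eq_0_iff)
    qed
  qed auto
  also have "\<dots> = 1" using f by (simp add: tri_def)
  finally show ?thesis .
qed

lemma fourier_sum:
  assumes "\<And>i. i \<in> S \<Longrightarrow> integrable lborel (f i)"
  shows "fourier (\<lambda>t. \<Sum>i\<in>S. f i t) l = (\<Sum>i\<in>S. fourier (f i) l)"
proof -
  have "integrable lborel (\<lambda>t. f i t * exp (- \<i> * complex_of_real (t \<bullet> l)))" if "i \<in> S" for i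
  proof -
    have "exp (- \<i> * complex_of_real (t \<bullet> l)) = cis (t \<bullet> (- l))" for t
      by (simp add: cis_conv_exp)
    then show ?thesis using integrable_mult_cis[OF assms[OF that], of "-l"] by simp
  qed
  then show ?thesis by (simp add: fourier_def sum_distrib_right)
qed

text \<open>The integer translates of the triangle form a partition of unity in each coordinate. The
  offset \<open>th\<close> slides the lattice, for the averaging in
  \<open>nsum_finite_if_normW\<close>.\<close>

lemma sum_ker_hat_eq_1:
  fixes c l th :: "real^'n" and a b :: "'n \<Rightarrow> int"
  assumes w: "w > 0" and l: "\<And>j. real_of_int (a j) \<le> l $ j / w - th $ j" "\<And>j. l $ j / w - th $ j \<le> real_of_int (b j)"
  shows "(\<Sum>k\<in>vbox (\<lambda>j. {a j..b j}). ker_hat w (w *\<^sub>R (int_vec k + th)) l) = 1"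
proof -
  have e: "ker_hat w (w *\<^sub>R (int_vec k + th)) l = (\<Prod>j\<in>UNIV. complex_of_real (tri (l $ j / w - th $ j - real_of_int (k $ j))))" for k
    unfolding ker_hat_def using w
    by (intro prod.cong refl arg_cong[of _ _ "\<lambda>x. complex_of_real (tri x)"]) (simp add: int_vec_def field_simps)
  have "(\<Sum>k\<in>vbox (\<lambda>j. {a j..b j}). ker_hat w (w *\<^sub>R (int_vec k + th)) l) = (\<Prod>j\<in>UNIV. \<Sum>i\<in>{a j..b j}. complex_of_real (tri (l $ j / w - th $ j - real_of_int i)))"
    unfolding e by (rule sum_vbox) simp
  also have "\<dots> = (\<Prod>j\<in>(UNIV::'n set). 1)"
    using sum_tri[OF l] by (intro prod.cong refl) (metis of_real_1 of_real_sum)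
  finally show ?thesis by simp
qed

text \<open>The lattice points \<open>k\<close> for which the spectra of \<open>ker w (w (k + th))\<close> and \<open>ker u c\<close> overlap.\<close>

definition overlap :: "real \<Rightarrow> real^'n \<Rightarrow> real \<Rightarrow> real^'n \<Rightarrow> (int^'n) set" where
  "overlap u c w th = {k. \<forall>j. \<bar>w * (real_of_int (k $ j) + th $ j) - c $ j\<bar> < w + u}"

section \<open>Cutting an element along a lattice of kernels\<close>

context L1_mod begin

lemma act_ker_disjoint:
  assumes "w > 0" "u > 0" "x \<in> cblin" "w + u \<le> \<bar>c $ j - c' $ j\<bar>"
  shows "act (ker w c) (act (ker u c') x) = 0"
proof (rule act_act_0[OF ker_integrable[OF assms(1)] frep_ker[OF assms(2)] assms(3)])
  fix l :: "real^'n" assume "ker_hat u c' l / complex_of_real ((2 * pi) ^ CARD('n)) \<noteq> 0"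
  then have "\<bar>l $ j - c' $ j\<bar> < u" using ker_hat_support[OF assms(2), of c' l j] by auto
  then have "\<not> \<bar>l $ j - c $ j\<bar> < w" using assms(4) by linarith
  then show "fourier (ker w c) l = 0"
    unfolding ker_fourier[OF assms(1)] using ker_hat_support[OF assms(1), of c l j] by blast
qed

text \<open>The full lattice gives a partition of unity, but on \<open>act (ker u c) x\<close> all
  but finitely many kernels act as zero, so a finite sum already acts as the identity. Allowing any
  finite superset of the overlap is what \<open>remainder_tail\<close> exploits.\<close>

lemma act_ker_partition:
  fixes c th :: "real^'n"
  assumes w: "w > 0" and u: "u > 0" and x: "x \<in> cblin"
  shows "finite (overlap u c w th)"
    and "finite F \<Longrightarrow> overlap u c w th \<subseteq> F \<Longrightarrow>
      (\<Sum>k\<in>F. act (ker w (w *\<^sub>R (int_vec k + th))) (act (ker u c) x)) = act (ker u c) x"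
proof -
  \<comment> \<open>The spectrum of \<open>ker u c\<close> in lattice units, rounded outwards; the
    rounding leaves room for all of \<open>overlap\<close>.\<close>
  define a b where "a = (\<lambda>j. \<lfloor>(c $ j - u) / w - th $ j\<rfloor>)" and "b = (\<lambda>j. \<lceil>(c $ j + u) / w - th $ j\<rceil>)"
  define G where "G = vbox (\<lambda>j. {a j..b j})"
  have fG: "finite G" unfolding G_def by (rule finite_vbox) simp
  have sub: "overlap u c w th \<subseteq> G"
  proof
    fix k assume k: "k \<in> overlap u c w th"
    show "k \<in> G"
      unfolding G_def vbox_def
    proof (intro CollectI allI)
      fix j
      have "w * (real_of_int (k $ j) + th $ j) < c $ j + u + w" "c $ j - u - w < w * (real_of_int (k $ j) + th $ j)"
        using k by (auto simp: overlap_def abs_less_iff dest!: spec[of _ j])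
      then have "real_of_int (k $ j) < (c $ j + u) / w - th $ j + 1" "(c $ j - u) / w - th $ j - 1 < real_of_int (k $ j)"
        using w by (simp_all add: field_simps)
      then show "k $ j \<in> {a j..b j}" unfolding a_def b_def by (auto; linarith)
    qed
  qed
  show fin: "finite (overlap u c w th)" using finite_subset[OF sub fG] .
  define t where "t = (\<lambda>k. act (ker w (w *\<^sub>R (int_vec k + th))) (act (ker u c) x))"
  have t0: "t k = 0" if k: "k \<notin> overlap u c w th" for k
  proof -
    obtain j where "w + u \<le> \<bar>w * (real_of_int (k $ j) + th $ j) - c $ j\<bar>" using k by (auto simp: overlap_def not_less)
    then show ?thesis unfolding t_def by (intro act_ker_disjoint[of _ _ _ _ j] w u x) (simp add: int_vec_def)
  qed
  have "sum t G = act (\<lambda>t. \<Sum>k\<in>G. ker w (w *\<^sub>R (int_vec k + th)) t) (act (ker u c) x)"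
    unfolding t_def by (rule act_sum_left[symmetric]) (auto intro!: ker_integrable w act_cblin u x)
  also have "\<dots> = act (ker u c) x"
  proof (rule act_act_id[OF _ frep_ker[OF u] x])
    show "integrable lborel (\<lambda>t. \<Sum>k\<in>G. ker w (w *\<^sub>R (int_vec k + th)) t)"
      by (intro Bochner_Integration.integrable_sum ker_integrable w)
    fix l :: "real^'n" assume "ker_hat u c l / complex_of_real ((2 * pi) ^ CARD('n)) \<noteq> 0"
    then have l: "\<bar>l $ j - c $ j\<bar> < u" for j using ker_hat_support[OF u, of c l j] by auto
    have "fourier (\<lambda>t. \<Sum>k\<in>G. ker w (w *\<^sub>R (int_vec k + th)) t) l = (\<Sum>k\<in>G. ker_hat w (w *\<^sub>R (int_vec k + th)) l)"
      by (subst fourier_sum) (auto intro!: ker_integrable w sum.cong simp: ker_fourier[OF w])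
    also have "\<dots> = 1"
      unfolding G_def
    proof (rule sum_ker_hat_eq_1[OF w])
      fix j
      have "(c $ j - u) / w - th $ j \<le> l $ j / w - th $ j" "l $ j / w - th $ j \<le> (c $ j + u) / w - th $ j"
        using l[of j] w by (auto simp: abs_less_iff divide_right_mono)
      then show "real_of_int (a j) \<le> l $ j / w - th $ j" "l $ j / w - th $ j \<le> real_of_int (b j)"
        unfolding a_def b_def by linarith+
    qed
    finally show "fourier (\<lambda>t. \<Sum>k\<in>G. ker w (w *\<^sub>R (int_vec k + th)) t) l = 1" .
  qed
  finally have G1: "sum t G = act (ker u c) x" .
  have "sum t (overlap u c w th) = sum t G"
    by (rule sum.mono_neutral_left[OF fG sub]) (use t0 in auto)
  moreover have "sum t (overlap u c w th) = sum t F" if "finite F" "overlap u c w th \<subseteq> F"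
    by (rule sum.mono_neutral_left[OF that]) (use t0 in auto)
  ultimately show "(\<Sum>k\<in>F. act (ker w (w *\<^sub>R (int_vec k + th))) (act (ker u c) x)) = act (ker u c) x"
    if "finite F" "overlap u c w th \<subseteq> F"
    using that G1 by (simp add: t_def)
qed

lemma norm_act_ker_le:
  assumes "w > 0" "x \<in> cblin" shows "norm (act (ker w c) x) \<le> norm x"
  using act_norm[OF ker_integrable[OF assms(1)] assms(2), of c] by (simp add: L1norm_ker[OF assms(1)])

text \<open>Source of all norm comparisons: the partition is inserted, the kernels commute, and
  \<open>ker u c\<close> is a contraction.\<close>

lemma norm_act_ker_overlap:
  fixes c th :: "real^'n"
  assumes w: "w > 0" and u: "u > 0" and x: "x \<in> cblin"
  shows "norm (act (ker u c) x) \<le> (\<Sum>k\<in>overlap u c w th. norm (act (ker w (w *\<^sub>R (int_vec k + th))) x))"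
proof -
  have "norm (act (ker u c) x) = norm (\<Sum>k\<in>overlap u c w th. act (ker w (w *\<^sub>R (int_vec k + th))) (act (ker u c) x))"
    by (simp add: act_ker_partition(2)[OF assms act_ker_partition(1)[OF assms] order_refl])
  also have "\<dots> \<le> (\<Sum>k\<in>overlap u c w th. norm (act (ker w (w *\<^sub>R (int_vec k + th))) x))"
    by (rule sum_norm_le, subst act_commute)
       (auto intro!: norm_act_ker_le ker_integrable act_cblin w u x)
  finally show ?thesis .
qed

lemma act_has_sum:
  assumes f: "integrable lborel f" and X: "\<And>k. X k \<in> cblin" "(X has_sum s) A"
  shows "s \<in> cblin" "((\<lambda>k. act f (X k)) has_sum act f s) A"
proof -
  have lim: "(sum X \<longlongrightarrow> s) (finite_subsets_at_top A)" using X(2) by (simp add: has_sum_def)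
  show s: "s \<in> cblin"
    by (rule Lim_in_closed_set[OF closed_cblin _ _ lim]) (auto intro!: always_eventually cblin_sum X)
  show "((\<lambda>k. act f (X k)) has_sum act f s) A"
    unfolding has_sum_def
  proof (rule LIM_zero_cancel, rule Lim_null_comparison)
    show "\<forall>\<^sub>F F in finite_subsets_at_top A. norm ((\<Sum>k\<in>F. act f (X k)) - act f s) \<le> L1norm f * norm (sum X F - s)"
      by (intro always_eventually allI, subst act_sum[symmetric, OF f X(1)], subst act_diff[symmetric])
         (auto intro!: act_norm f s X(1) cblin_sum cblin_diff)
    have "((\<lambda>F. sum X F - s) \<longlongrightarrow> 0) (finite_subsets_at_top A)" using lim by (simp add: LIM_zero_iff)
    then show "((\<lambda>F. L1norm f * norm (sum X F - s)) \<longlongrightarrow> 0) (finite_subsets_at_top A)"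
      by (intro tendsto_mult_right_zero tendsto_norm_zero)
  qed
qed

text \<open>Absolute convergence yields some sum y; that y equals x is tested with the kernels of
  \<open>eq_0_if_act_ker_0\<close>, each of which sees only finitely many pieces.\<close>

lemma has_sum_act_ker:
  assumes w: "w > 0" and x: "x \<in> cblin" and s: "(\<lambda>k. norm (act (ker w (w *\<^sub>R int_vec k)) x)) summable_on UNIV"
  shows "((\<lambda>k. act (ker w (w *\<^sub>R int_vec k)) x) has_sum x) UNIV"
proof -
  define X where "X = (\<lambda>k. act (ker w (w *\<^sub>R int_vec k)) x)"
  have Xc: "X k \<in> cblin" for k unfolding X_def by (rule act_cblin[OF ker_integrable[OF w] x])
  have "X summable_on UNIV" using s unfolding X_def by (rule abs_summable_summable)
  then obtain y where y: "(X has_sum y) UNIV" by (auto simp: summable_on_def)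
  have yc: "y \<in> cblin" by (rule act_has_sum(1)[OF ker_integrable[OF w] Xc y])
  have "x - y = 0"
  proof (rule eq_0_if_act_ker_0)
    show "x - y \<in> cblin" by (rule cblin_diff[OF x yc])
    fix m
    let ?u = "real (Suc m)"
    have u: "?u > 0" by simp
    note ki = ker_integrable[OF u, of 0]
    have h: "((\<lambda>k. act (ker ?u 0) (X k)) has_sum act (ker ?u 0) y) UNIV" by (rule act_has_sum(2)[OF ki Xc y])
    have e: "act (ker ?u 0) (X k) = act (ker w (w *\<^sub>R (int_vec k + 0))) (act (ker ?u 0) x)" for k
      unfolding X_def using act_commute[OF ki ker_integrable[OF w] x] by simp
    let ?O = "overlap ?u 0 w 0 :: (int^'n) set"
    have "((\<lambda>k. act (ker ?u 0) (X k)) has_sum act (ker ?u 0) x) ?O"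
      unfolding e by (intro has_sum_finiteI act_ker_partition(1)[OF w u x] act_ker_partition(2)[OF w u x act_ker_partition(1)[OF w u x] order_refl, symmetric])
    then have "((\<lambda>k. act (ker ?u 0) (X k)) has_sum act (ker ?u 0) x) UNIV"
    proof (rule has_sum_cong_neutral[THEN iffD1, rotated -1])
      fix k assume "k \<in> UNIV - ?O"
      then obtain j where "w + ?u \<le> \<bar>w * real_of_int (k $ j)\<bar>" by (auto simp: overlap_def not_less)
      then show "act (ker ?u 0) (X k) = 0"
        unfolding e by (intro act_ker_disjoint[of _ _ _ _ j] w u x) (simp add: int_vec_def)
    qed auto
    with h have "act (ker ?u 0) y = act (ker ?u 0) x" by (rule has_sum_unique)
    then show "act (ker ?u 0) (x - y) = 0" using act_diff[OF ki x yc] by simp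
  qed
  then show ?thesis using y by (simp add: X_def)
qed

end

section \<open>Submultiplicativity\<close>

abbreviation esum :: "('a \<Rightarrow> ennreal) \<Rightarrow> ennreal" where
  "esum f \<equiv> (\<integral>\<^sup>+ k. f k \<partial>count_space UNIV)"

lemma esum_swap: "esum (\<lambda>x. esum (\<lambda>y. f x y)) = esum (\<lambda>y. esum (\<lambda>x. f x y))"
  using nn_integral_fst_count_space[of "case_prod f"] nn_integral_snd_count_space[of "case_prod f"] by simp

lemma sum_le_esum: "finite F \<Longrightarrow> sum f F \<le> esum f"
proof -
  assume F: "finite F"
  have "sum f F = esum (\<lambda>k. if k \<in> F then f k else 0)"
    using F by (subst nn_integral_count_space'[of F]) auto
  also have "\<dots> \<le> esum f" by (rule nn_integral_mono) auto
  finally show ?thesis .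
qed

lemma esum_le:
  fixes f :: "'a::countable \<Rightarrow> ennreal"
  assumes "\<And>F. finite F \<Longrightarrow> sum f F \<le> C" shows "esum f \<le> C"
proof -
  have "esum f = (\<integral>\<^sup>+ n. f (from_nat n) \<partial>count_space (range (to_nat :: 'a \<Rightarrow> nat)))"
    using nn_integral_bij_count_space[of "to_nat :: 'a \<Rightarrow> nat" UNIV "range (to_nat :: 'a \<Rightarrow> nat)" "\<lambda>n. f (from_nat n)"]
    by (simp add: bij_betw_def)
  also have "\<dots> = (\<integral>\<^sup>+ n. f (from_nat n) * indicator (range (to_nat :: 'a \<Rightarrow> nat)) n \<partial>count_space UNIV)"
    by (simp add: nn_integral_count_space_indicator)
  also have "\<dots> = (\<Sum>n. f (from_nat n) * indicator (range (to_nat :: 'a \<Rightarrow> nat)) n)"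
    by (rule nn_integral_count_space_nat)
  also have "\<dots> \<le> C"
  proof (rule suminf_le_const[OF summableI])
    fix N
    have "(\<Sum>n<N. f (from_nat n) * indicator (range (to_nat :: 'a \<Rightarrow> nat)) n) = (\<Sum>n\<in>{..<N} \<inter> range (to_nat :: 'a \<Rightarrow> nat). f (from_nat n))"
      by (rule sum.mono_neutral_cong_right) (auto simp: indicator_def)
    also have "\<dots> = sum f (from_nat ` ({..<N} \<inter> range (to_nat :: 'a \<Rightarrow> nat)))"
      by (subst sum.reindex) (auto simp: inj_on_def)
    also have "\<dots> \<le> C" by (rule assms) auto
    finally show "(\<Sum>n<N. f (from_nat n) * indicator (range (to_nat :: 'a \<Rightarrow> nat)) n) \<le> C" .
  qed
  finally show ?thesis .
qed

lemma esum_if: "finite F \<Longrightarrow> esum (\<lambda>k. if k \<in> F then f k else 0) = sum f F"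
  by (subst nn_integral_count_space'[of F]) auto

text \<open>Double counting: after the sums are exchanged, \<open>h k\<close> appears once for each
  n whose set contains k.\<close>

lemma esum_Schur:
  fixes Q :: "'a \<Rightarrow> 'b set"
  assumes f: "\<And>n. f n \<le> (\<Sum>k\<in>Q n. h k)" and Q: "\<And>n. finite (Q n)"
    and C: "\<And>k. finite {n. k \<in> Q n}" "\<And>k. card {n. k \<in> Q n} \<le> C"
  shows "esum f \<le> of_nat C * esum h"
proof -
  have "esum f \<le> esum (\<lambda>n. esum (\<lambda>k. if k \<in> Q n then h k else 0))"
    by (rule nn_integral_mono) (simp add: esum_if Q f)
  also have "\<dots> = esum (\<lambda>k. esum (\<lambda>n. if n \<in> {n. k \<in> Q n} then h k else 0))"
    by (subst esum_swap) simp
  also have "\<dots> = esum (\<lambda>k. of_nat (card {n. k \<in> Q n}) * h k)"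
    by (subst esum_if[OF C(1)]) simp
  also have "\<dots> \<le> esum (\<lambda>k. of_nat C * h k)"
    by (intro nn_integral_mono mult_right_mono) (use C(2) in auto)
  also have "\<dots> = of_nat C * esum h" by (rule nn_integral_cmult) simp
  finally show ?thesis .
qed

lemma summable_on_if_esum_finite:
  fixes f :: "'a \<Rightarrow> 'b::real_normed_vector"
  assumes "esum (\<lambda>k. ennreal (norm (f k))) < \<infinity>"
  shows "(\<lambda>k. norm (f k)) summable_on UNIV"
proof (rule nonneg_bdd_above_summable_on)
  obtain r where r: "esum (\<lambda>k. ennreal (norm (f k))) = ennreal r" "0 \<le> r"
    using assms by (metis ennreal_cases infinity_ennreal_def less_irrefl)
  show "bdd_above (sum (\<lambda>k. norm (f k)) ` {F. F \<subseteq> UNIV \<and> finite F})"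
  proof (rule bdd_aboveI2[of _ _ r])
    fix F assume "F \<in> {F::'a set. F \<subseteq> UNIV \<and> finite F}"
    then have "ennreal (sum (\<lambda>k. norm (f k)) F) \<le> ennreal r"
      using sum_le_esum[of F "\<lambda>k. ennreal (norm (f k))"] r by (simp add: sum_ennreal)
    then show "sum (\<lambda>k. norm (f k)) F \<le> r" using r(2) by simp
  qed
qed simp

lemma norm_has_sum_le_esum:
  fixes f :: "'a \<Rightarrow> 'b::real_normed_vector"
  assumes "(f has_sum s) UNIV"
  shows "ennreal (norm s) \<le> esum (\<lambda>k. ennreal (norm (f k)))"
proof (rule tendsto_upperbound)
  show "((\<lambda>F. ennreal (norm (sum f F))) \<longlongrightarrow> ennreal (norm s)) (finite_subsets_at_top UNIV)"
    using assms unfolding has_sum_def by (intro tendsto_intros)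
  show "\<forall>\<^sub>F F in finite_subsets_at_top UNIV. ennreal (norm (sum f F)) \<le> esum (\<lambda>k. ennreal (norm (f k)))"
  proof (rule eventually_finite_subsets_at_top_weakI)
    fix F :: "'a set" assume F: "finite F"
    have "ennreal (norm (sum f F)) \<le> ennreal (\<Sum>k\<in>F. norm (f k))" by (intro ennreal_leI norm_sum)
    also have "\<dots> = (\<Sum>k\<in>F. ennreal (norm (f k)))" by simp
    also have "\<dots> \<le> esum (\<lambda>k. ennreal (norm (f k)))" by (rule sum_le_esum[OF F])
    finally show "ennreal (norm (sum f F)) \<le> esum (\<lambda>k. ennreal (norm (f k)))" .
  qed
qed simp

text \<open>The factor 5^d of \<open>norm1N\<close> is kept apart: \<open>nsum_compose\<close>
  produces exactly one such factor, and this makes \<open>norm1N\<close> submultiplicative.\<close>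

definition nsum :: "((real^'n \<Rightarrow> complex) \<Rightarrow> ('a \<Rightarrow>\<^sub>L 'b) \<Rightarrow> ('a \<Rightarrow>\<^sub>L 'b)) \<Rightarrow> real
    \<Rightarrow> ('a::real_normed_vector \<Rightarrow>\<^sub>L 'b::real_normed_vector) \<Rightarrow> ennreal" where
  "nsum act w x = esum (\<lambda>k::int^'n. ennreal (norm (act (ker w (w *\<^sub>R int_vec k)) x)))"

lemma norm1N_eq_nsum:
  fixes act :: "(real^'n \<Rightarrow> complex) \<Rightarrow> ('a::real_normed_vector \<Rightarrow>\<^sub>L 'b::real_normed_vector) \<Rightarrow> ('a \<Rightarrow>\<^sub>L 'b)"
  shows "norm1N act N x = 5 ^ CARD('n) * nsum act (real N) x"
  by (simp add: norm1N_def nsum_def phi_d_eq_ker)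

lemma (in L1_mod) has_sum_if_nsum:
  assumes "w > 0" "x \<in> cblin" "nsum act w x < \<infinity>"
  shows "((\<lambda>k. act (ker w (w *\<^sub>R int_vec k)) x) has_sum x) UNIV"
  by (rule has_sum_act_ker[OF assms(1,2)]) (rule summable_on_if_esum_finite[OF assms(3)[unfolded nsum_def]])

lemma (in L1_mod) norm_le_nsum:
  assumes "w > 0" "x \<in> cblin"
  shows "ennreal (norm x) \<le> nsum act w x"
proof (cases "nsum act w x < \<infinity>")
  case True
  show ?thesis using norm_has_sum_le_esum[OF has_sum_if_nsum[OF assms True]] by (simp add: nsum_def)
next
  case False
  then have "nsum act w x = top" by (simp add: not_less top_unique)
  then show ?thesis by simp
qed

text \<open>The product of the pieces k and l is seen by the kernel m only if m - k - l lies in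
  {-2..2} in every coordinate, so each pair is counted 5^d times. Finiteness lets both factors be
  expanded into their pieces.\<close>

lemma nsum_compose:
  fixes act1 :: "(real^'n \<Rightarrow> complex) \<Rightarrow> ('v::complex_banach \<Rightarrow>\<^sub>L 'w::complex_banach) \<Rightarrow> ('v \<Rightarrow>\<^sub>L 'w)"
    and act2 :: "(real^'n \<Rightarrow> complex) \<Rightarrow> ('u::complex_banach \<Rightarrow>\<^sub>L 'v) \<Rightarrow> ('u \<Rightarrow>\<^sub>L 'v)"
    and act3 :: "(real^'n \<Rightarrow> complex) \<Rightarrow> ('u \<Rightarrow>\<^sub>L 'w) \<Rightarrow> ('u \<Rightarrow>\<^sub>L 'w)"
  assumes M: "L1_mod T1 act1" "L1_mod T2 act2" "L1_mod T3 act3"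
    and mult: "\<And>t X Y. X \<in> cblin \<Longrightarrow> Y \<in> cblin \<Longrightarrow> T3 t (X o\<^sub>L Y) = T1 t X o\<^sub>L T2 t Y"
    and X: "X \<in> cblin" and Y: "Y \<in> cblin" and w: "w > 0"
    and fin: "nsum act1 w X < \<infinity>" "nsum act2 w Y < \<infinity>"
  shows "nsum act3 w (X o\<^sub>L Y) \<le> 5 ^ CARD('n) * (nsum act1 w X * nsum act2 w Y)"
proof -
  interpret M1: L1_mod T1 act1 by fact
  interpret M2: L1_mod T2 act2 by fact
  interpret M3: L1_mod T3 act3 by fact
  define x where "x = (\<lambda>k. act1 (ker w (w *\<^sub>R int_vec k)) X)"
  define y where "y = (\<lambda>k. act2 (ker w (w *\<^sub>R int_vec k)) Y)"
  define p where "p = (\<lambda>m z. act3 (ker w (w *\<^sub>R int_vec m)) z)"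
  have xc: "x k \<in> cblin" for k unfolding x_def by (rule M1.act_cblin[OF ker_integrable[OF w] X])
  have yc: "y k \<in> cblin" for k unfolding y_def by (rule M2.act_cblin[OF ker_integrable[OF w] Y])
  have xs: "(x has_sum X) UNIV" unfolding x_def by (rule M1.has_sum_if_nsum[OF w X fin(1)])
  have ys: "(y has_sum Y) UNIV" unfolding y_def by (rule M2.has_sum_if_nsum[OF w Y fin(2)])
  note bl = bounded_bilinear_blinfun_compose
  define Q where "Q = (\<lambda>k l::int^'n. vbox (\<lambda>j. {k $ j + l $ j - 2..k $ j + l $ j + 2}))"
  have Qf: "finite (Q k l)" for k l unfolding Q_def by (rule finite_vbox) simp
  have Qc: "card (Q k l) = 5 ^ CARD('n)" for k l unfolding Q_def by (subst card_vbox) auto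
  have kl: "ennreal (norm (p m (x k o\<^sub>L y l))) \<le> (if m \<in> Q k l then ennreal (norm (x k)) * ennreal (norm (y l)) else 0)" for m k l
  proof (cases "m \<in> Q k l")
    case True
    have "norm (p m (x k o\<^sub>L y l)) \<le> norm (x k o\<^sub>L y l)"
      unfolding p_def by (rule M3.norm_act_ker_le[OF w cblin_compose[OF xc yc]])
    also have "\<dots> \<le> norm (x k) * norm (y l)" by (rule norm_blinfun_compose)
    finally show ?thesis using True by (simp add: ennreal_mult[symmetric])
  next
    case False
    \<comment> \<open>For integers, leaving {-2..2} means distance at least 3, which is the gap
      condition with equality. A strict gap condition would leave 7 values per coordinate instead of
      5.\<close>
    then obtain j where "m $ j < k $ j + l $ j - 2 \<or> k $ j + l $ j + 2 < m $ j" by (auto simp: Q_def vbox_def not_le)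
    then have "3 \<le> \<bar>real_of_int (m $ j) - real_of_int (k $ j) - real_of_int (l $ j)\<bar>" by linarith
    then have "w * 3 \<le> w * \<bar>real_of_int (m $ j) - real_of_int (k $ j) - real_of_int (l $ j)\<bar>"
      using w by (intro mult_left_mono) auto
    also have "\<dots> = \<bar>w * (real_of_int (m $ j) - real_of_int (k $ j) - real_of_int (l $ j))\<bar>" using w by (simp add: abs_mult)
    finally have "3 * w \<le> \<bar>(w *\<^sub>R int_vec m) $ j - (w *\<^sub>R int_vec k) $ j - (w *\<^sub>R int_vec l) $ j\<bar>"
      by (simp add: int_vec_def right_diff_distrib)
    from act_ker_product_0[OF M mult X Y w this] show ?thesis using False by (simp add: p_def x_def y_def)
  qed
  have 1: "ennreal (norm (p m (X o\<^sub>L Y))) \<le> esum (\<lambda>k. ennreal (norm (p m (x k o\<^sub>L Y))))" for m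
  proof -
    have "((\<lambda>k. x k o\<^sub>L Y) has_sum (X o\<^sub>L Y)) UNIV"
      using has_sum_bounded_linear[OF bounded_bilinear.bounded_linear_left[OF bl] xs] .
    from norm_has_sum_le_esum[OF M3.act_has_sum(2)[OF ker_integrable[OF w] cblin_compose[OF xc Y] this]]
    show ?thesis by (simp add: p_def)
  qed
  have 2: "ennreal (norm (p m (x k o\<^sub>L Y))) \<le> esum (\<lambda>l. ennreal (norm (p m (x k o\<^sub>L y l))))" for m k
  proof -
    have "((\<lambda>l. x k o\<^sub>L y l) has_sum (x k o\<^sub>L Y)) UNIV"
      using has_sum_bounded_linear[OF bounded_bilinear.bounded_linear_right[OF bl] ys] .
    from norm_has_sum_le_esum[OF M3.act_has_sum(2)[OF ker_integrable[OF w] cblin_compose[OF xc yc] this]]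
    show ?thesis by (simp add: p_def)
  qed
  let ?g = "\<lambda>m k l. if m \<in> Q k l then ennreal (norm (x k)) * ennreal (norm (y l)) else 0"
  have "nsum act3 w (X o\<^sub>L Y) \<le> esum (\<lambda>m. esum (\<lambda>k. esum (\<lambda>l. ?g m k l)))"
    unfolding nsum_def
  proof (rule nn_integral_mono)
    fix m :: "int^'n"
    have "ennreal (norm (p m (X o\<^sub>L Y))) \<le> esum (\<lambda>k. esum (\<lambda>l. ennreal (norm (p m (x k o\<^sub>L y l)))))"
      by (rule order_trans[OF 1 nn_integral_mono]) (rule 2)
    also have "\<dots> \<le> esum (\<lambda>k. esum (\<lambda>l. ?g m k l))" by (intro nn_integral_mono kl)
    finally show "ennreal (norm (act3 (ker w (w *\<^sub>R int_vec m)) (X o\<^sub>L Y))) \<le> esum (\<lambda>k. esum (\<lambda>l. ?g m k l))"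
      by (simp add: p_def)
  qed
  also have "\<dots> = esum (\<lambda>k. esum (\<lambda>l. esum (\<lambda>m. ?g m k l)))"
    by (subst esum_swap) (intro nn_integral_cong esum_swap)
  also have "\<dots> = esum (\<lambda>k. esum (\<lambda>l. 5 ^ CARD('n) * (ennreal (norm (x k)) * ennreal (norm (y l)))))"
    by (subst esum_if[OF Qf]) (simp add: Qc)
  also have "\<dots> = 5 ^ CARD('n) * (nsum act1 w X * nsum act2 w Y)"
    unfolding nsum_def x_def y_def by (simp add: nn_integral_cmult nn_integral_multc)
  finally show ?thesis .
qed

context L1_mod begin

lemma nsum_1_le:
  assumes N: "N \<ge> 1" and x: "x \<in> cblin"
  shows "nsum act 1 x \<le> of_nat ((2 * N + 1) ^ CARD('n)) * nsum act (real N) x"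
proof -
  have N0: "real N > 0" using N by simp
  let ?Q = "\<lambda>n. overlap 1 (int_vec n) (real N) (0::real^'n)"
  \<comment> \<open>Integrality turns the strict bound N + 1 into at most N, so a kernel of width N
    meets exactly 2N + 1 unit kernels per coordinate: the factor in the theorem.\<close>
  have eq: "{n. k \<in> ?Q n} = vbox (\<lambda>j. {int N * k $ j - int N..int N * k $ j + int N})" for k
  proof -
    have "\<bar>real N * real_of_int a - real_of_int b\<bar> < real N + 1 \<longleftrightarrow> b \<in> {int N * a - int N..int N * a + int N}" for a b :: int
    proof -
      have "\<bar>real N * real_of_int a - real_of_int b\<bar> < real N + 1 \<longleftrightarrow> \<bar>int N * a - b\<bar> < int N + 1"
        by (metis (mono_tags, lifting) of_int_1 of_int_abs of_int_add of_int_diff of_int_less_iff of_int_mult of_int_of_nat_eq)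
      then show ?thesis by auto
    qed
    then show ?thesis by (simp add: overlap_def vbox_def int_vec_def)
  qed
  have "esum (\<lambda>n. ennreal (norm (act (ker 1 (int_vec n)) x))) \<le> of_nat ((2 * N + 1) ^ CARD('n)) * esum (\<lambda>k. ennreal (norm (act (ker (real N) (real N *\<^sub>R int_vec k)) x)))"
  proof (rule esum_Schur[where Q = ?Q])
    fix n k
    show "ennreal (norm (act (ker 1 (int_vec n)) x)) \<le> (\<Sum>k\<in>?Q n. ennreal (norm (act (ker (real N) (real N *\<^sub>R int_vec k)) x)))"
      using norm_act_ker_overlap[OF N0 zero_less_one x, of "int_vec n" 0] by (simp add: ennreal_leI)
    show "finite (?Q n)" by (rule act_ker_partition(1)[OF N0 zero_less_one x])
    show "finite {n. k \<in> ?Q n}" unfolding eq by (rule finite_vbox) simp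
    have "card {n. k \<in> ?Q n} = (\<Prod>j\<in>(UNIV::'n set). nat (2 * int N + 1))" unfolding eq by (subst card_vbox) auto
    then show "card {n. k \<in> ?Q n} \<le> (2 * N + 1) ^ CARD('n)" by (simp add: nat_add_distrib nat_mult_distrib)
  qed
  then show ?thesis by (simp add: nsum_def)
qed

end

section \<open>Comparison of the norms\<close>

context L1_mod begin

lemma continuous_on_act_ker:
  assumes w: "w > 0" and x: "x \<in> cblin"
  shows "continuous_on UNIV (\<lambda>c. act (ker w c) x)"
proof (rule continuous_at_imp_continuous_on, rule ballI)
  fix c :: "real^'n"
  show "isCont (\<lambda>c. act (ker w c) x) c"
    unfolding continuous_at_sequentially o_def
    using act_ker_tendsto[OF w, of "\<lambda>_. w", OF _ _ _ _ x] w by simp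
qed

text \<open>The lattice piece k contributes only for \<open>a\<close> in a box of side 4 about k, so
  Tonelli bounds the integral by 4^d times the lattice sum.\<close>

lemma normW_finite_if_nsum:
  assumes x: "x \<in> cblin" and fin: "nsum act 1 x < \<infinity>"
  shows "normW act x < \<infinity>"
proof -
  define h where "h = (\<lambda>k. ennreal (norm (act (ker 1 (int_vec k)) x)))"
  define v :: "real^'n" where "v = (\<chi> j. 2)"
  define E where "E = (\<lambda>k. cbox (int_vec k - v) (int_vec k + v))"
  have le: "ennreal (norm (act (phi_d 1 a) x)) \<le> esum (\<lambda>k. h k * indicator (E k) a)" for a
  proof -
    let ?O = "overlap 1 a 1 (0::real^'n)"
    have "ennreal (norm (act (phi_d 1 a) x)) \<le> (\<Sum>k\<in>?O. h k)"
      using norm_act_ker_overlap[OF zero_less_one zero_less_one x, of a 0]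
      by (simp add: phi_d_eq_ker h_def ennreal_leI)
    also have "\<dots> = esum (\<lambda>k. if k \<in> ?O then h k else 0)"
      by (rule esum_if[symmetric]) (rule act_ker_partition(1)[OF zero_less_one zero_less_one x])
    also have "\<dots> \<le> esum (\<lambda>k. h k * indicator (E k) a)"
    proof (rule nn_integral_mono)
      fix k
      have "a \<in> E k" if "k \<in> ?O"
        unfolding E_def mem_box_cart
      proof
        fix j
        have "\<bar>real_of_int (k $ j) - a $ j\<bar> < 2" using that by (auto simp: overlap_def)
        then show "(int_vec k - v) $ j \<le> a $ j \<and> a $ j \<le> (int_vec k + v) $ j"
          by (simp add: v_def int_vec_def abs_less_iff)
      qed
      then show "(if k \<in> ?O then h k else 0) \<le> h k * indicator (E k) a" by simp
    qed
    finally show ?thesis .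
  qed
  have [measurable]: "E k \<in> sets borel" for k by (simp add: E_def)
  have "normW act x \<le> (\<integral>\<^sup>+ a. esum (\<lambda>k. h k * indicator (E k) a) \<partial>lborel)"
    unfolding normW_def by (rule nn_integral_mono) (rule le)
  also have "\<dots> = esum (\<lambda>k. \<integral>\<^sup>+ a. h k * indicator (E k) a \<partial>lborel)"
    by (rule nn_integral_count_space_nn_integral) auto
  also have "\<dots> = esum (\<lambda>k. h k * ennreal (\<Prod>b\<in>Basis. (2 *\<^sub>R v) \<bullet> b))"
  proof (intro nn_integral_cong)
    fix k
    have "emeasure lborel (E k) = ennreal (\<Prod>b\<in>Basis. ((int_vec k + v) - (int_vec k - v)) \<bullet> b)"
      unfolding E_def by (rule emeasure_lborel_cbox) (auto simp: Basis_vec_def inner_axis v_def)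
    also have "(int_vec k + v) - (int_vec k - v) = 2 *\<^sub>R v" by (simp add: scaleR_2)
    finally show "(\<integral>\<^sup>+ a. h k * indicator (E k) a \<partial>lborel) = h k * ennreal (\<Prod>b\<in>Basis. (2 *\<^sub>R v) \<bullet> b)"
      by (simp add: nn_integral_cmult)
  qed
  also have "\<dots> = esum h * ennreal (\<Prod>b\<in>Basis. (2 *\<^sub>R v) \<bullet> b)" by (rule nn_integral_multc) simp
  also have "\<dots> < \<infinity>" using fin by (simp add: nsum_def h_def ennreal_mult_less_top)
  finally show ?thesis .
qed

text \<open>An integral alone does not control values at lattice points. But every shifted lattice
  controls the unshifted one, so the sum can be averaged over shifts in the unit cube, and the
  translated cubes recover the integral.\<close>

lemma nsum_finite_if_normW:
  assumes x: "x \<in> cblin" and fin: "normW act x < \<infinity>"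
  shows "nsum act 1 x < \<infinity>"
proof -
  define h where "h = (\<lambda>a. ennreal (norm (act (ker 1 a) x)))"
  have hW: "normW act x = (\<integral>\<^sup>+ a. h a \<partial>lborel)" by (simp add: normW_def h_def phi_d_eq_ker)
  have [measurable]: "h \<in> borel_measurable borel"
    unfolding h_def
    by (intro borel_measurable_continuous_onI continuous_on_ennreal continuous_on_norm continuous_on_act_ker x) simp
  define Q :: "(real^'n) set" where "Q = cbox 0 (\<chi> j. 1)"
  have [measurable]: "Q \<in> sets borel" by (simp add: Q_def)
  have Q1: "emeasure lborel Q = 1"
  proof -
    have "emeasure lborel Q = ennreal (\<Prod>b\<in>Basis. ((\<chi> j. 1) - (0::real^'n)) \<bullet> b)"
      unfolding Q_def by (rule emeasure_lborel_cbox) (auto simp: Basis_vec_def inner_axis)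
    also have "(\<Prod>b\<in>Basis. ((\<chi> j. 1) - (0::real^'n)) \<bullet> b) = (\<Prod>b\<in>(Basis::(real^'n) set). 1)"
      by (rule prod.cong) (auto simp: Basis_vec_def inner_axis)
    finally show ?thesis by simp
  qed
  have shift: "nsum act 1 x \<le> of_nat (6 ^ CARD('n)) * esum (\<lambda>k. h (int_vec k + th))" if th: "th \<in> Q" for th
  proof -
    let ?Q = "\<lambda>n. overlap 1 (int_vec n) 1 th"
    have th01: "0 \<le> th $ j" "th $ j \<le> 1" for j using th by (auto simp: Q_def mem_box_cart)
    have sub: "{n. k \<in> ?Q n} \<subseteq> vbox (\<lambda>j. {k $ j - 2..k $ j + 3})" for k
    proof
      fix n assume "n \<in> {n. k \<in> ?Q n}"
      then have n: "\<bar>real_of_int (k $ j) + th $ j - real_of_int (n $ j)\<bar> < 2" for j by (auto simp: overlap_def int_vec_def)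
      have "k $ j - 2 \<le> n $ j \<and> n $ j \<le> k $ j + 3" for j
      proof -
        have "real_of_int (k $ j - 2) < real_of_int (n $ j)" "real_of_int (n $ j) < real_of_int (k $ j + 3)"
          using n[of j] th01[of j] by auto
        then show ?thesis unfolding of_int_less_iff by simp
      qed
      then show "n \<in> vbox (\<lambda>j. {k $ j - 2..k $ j + 3})" by (simp add: vbox_def)
    qed
    have fv: "finite (vbox (\<lambda>j::'n. {k $ j - 2..k $ j + 3 :: int}))" for k by (rule finite_vbox) simp
    have "esum (\<lambda>n. ennreal (norm (act (ker 1 (int_vec n)) x))) \<le> of_nat (6 ^ CARD('n)) * esum (\<lambda>k. h (int_vec k + th))"
    proof (rule esum_Schur[where Q = ?Q])
      fix n k
      show "ennreal (norm (act (ker 1 (int_vec n)) x)) \<le> (\<Sum>k\<in>?Q n. h (int_vec k + th))"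
        using norm_act_ker_overlap[OF zero_less_one zero_less_one x, of "int_vec n" th] by (simp add: ennreal_leI h_def)
      show "finite (?Q n)" by (rule act_ker_partition(1)[OF zero_less_one zero_less_one x])
      show "finite {n. k \<in> ?Q n}" by (rule finite_subset[OF sub fv])
      have "card {n. k \<in> ?Q n} \<le> card (vbox (\<lambda>j. {k $ j - 2..k $ j + 3}))" by (rule card_mono[OF fv sub])
      also have "\<dots> = 6 ^ CARD('n)" by (subst card_vbox) auto
      finally show "card {n. k \<in> ?Q n} \<le> 6 ^ CARD('n)" .
    qed
    then show ?thesis by (simp add: nsum_def)
  qed
  have "nsum act 1 x = (\<integral>\<^sup>+ th. nsum act 1 x * indicator Q th \<partial>lborel)"
    by (simp add: nn_integral_cmult Q1)
  also have "\<dots> \<le> (\<integral>\<^sup>+ th. esum (\<lambda>k. of_nat (6 ^ CARD('n)) * (indicator Q th * h (int_vec k + th))) \<partial>lborel)"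
    by (rule nn_integral_mono) (use shift in \<open>auto simp: nn_integral_cmult split: split_indicator\<close>)
  also have "\<dots> = esum (\<lambda>k. \<integral>\<^sup>+ th. of_nat (6 ^ CARD('n)) * (indicator Q th * h (int_vec k + th)) \<partial>lborel)"
    by (rule nn_integral_count_space_nn_integral) auto
  also have "\<dots> = of_nat (6 ^ CARD('n)) * esum (\<lambda>k. \<integral>\<^sup>+ th. indicator Q th * h (int_vec k + th) \<partial>lborel)"
    by (subst nn_integral_cmult) (auto intro!: nn_integral_cmult)
  also have "esum (\<lambda>k. \<integral>\<^sup>+ th. indicator Q th * h (int_vec k + th) \<partial>lborel) = esum (\<lambda>k. \<integral>\<^sup>+ a. indicator Q (a - int_vec k) * h a \<partial>lborel)"
  proof (rule nn_integral_cong)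
    fix k :: "int^'n"
    have "(\<integral>\<^sup>+ a. indicator Q (a - int_vec k) * h a \<partial>lborel) = (\<integral>\<^sup>+ a. indicator Q (a - int_vec k) * h a \<partial>distr lborel borel ((+) (int_vec k)))"
      by (simp only: lborel_distr_plus)
    also have "\<dots> = (\<integral>\<^sup>+ th. indicator Q th * h (int_vec k + th) \<partial>lborel)"
      by (subst nn_integral_distr) auto
    finally show "(\<integral>\<^sup>+ th. indicator Q th * h (int_vec k + th) \<partial>lborel) = (\<integral>\<^sup>+ a. indicator Q (a - int_vec k) * h a \<partial>lborel)" ..
  qed
  also have "\<dots> = (\<integral>\<^sup>+ a. esum (\<lambda>k::int^'n. indicator Q (a - int_vec k) * h a) \<partial>lborel)"
    by (rule nn_integral_count_space_nn_integral[symmetric]) auto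
  also have "\<dots> \<le> (\<integral>\<^sup>+ a. of_nat (2 ^ CARD('n)) * h a \<partial>lborel)"
  proof (rule nn_integral_mono)
    fix a :: "real^'n"
    \<comment> \<open>The cube is closed and its translates share faces, so a point has up to two
      candidates per coordinate.\<close>
    let ?V = "vbox (\<lambda>j. {\<lfloor>a $ j\<rfloor> - 1..\<lfloor>a $ j\<rfloor>})"
    have fV: "finite ?V" by (rule finite_vbox) simp
    have "esum (\<lambda>k::int^'n. indicator Q (a - int_vec k) * h a) \<le> esum (\<lambda>k. if k \<in> ?V then h a else 0)"
    proof (rule nn_integral_mono)
      fix k :: "int^'n"
      have "k \<in> ?V" if "a - int_vec k \<in> Q"
        unfolding vbox_def
      proof (intro CollectI allI)
        fix j
        have "0 \<le> a $ j - real_of_int (k $ j)" "a $ j - real_of_int (k $ j) \<le> 1"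
          using that by (auto simp: Q_def mem_box_cart int_vec_def)
        then show "k $ j \<in> {\<lfloor>a $ j\<rfloor> - 1..\<lfloor>a $ j\<rfloor>}" by (auto; linarith)
      qed
      then show "indicator Q (a - int_vec k) * h a \<le> (if k \<in> ?V then h a else 0)" by (auto split: split_indicator)
    qed
    also have "\<dots> = of_nat (card ?V) * h a" by (subst esum_if[OF fV]) simp
    also have "card ?V = 2 ^ CARD('n)" by (subst card_vbox) auto
    finally show "esum (\<lambda>k::int^'n. indicator Q (a - int_vec k) * h a) \<le> of_nat (2 ^ CARD('n)) * h a" .
  qed
  also have "\<dots> = of_nat (2 ^ CARD('n)) * normW act x" unfolding hW by (rule nn_integral_cmult) simp
  finally have "nsum act 1 x \<le> of_nat (6 ^ CARD('n)) * (of_nat (2 ^ CARD('n)) * normW act x)"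
    by (simp add: mult_left_mono)
  also have "\<dots> < \<infinity>" using fin by (simp add: ennreal_mult_less_top power_less_top_ennreal)
  finally show ?thesis .
qed

text \<open>Shows that the set behind \<open>psi\<close> is nonempty. The pieces of the remainder
  with |n| <= 1 vanish; at width K the others are controlled by the unit pieces of x with |k| >= K,
  whose sum tends to 0 (maximum norms throughout).\<close>

lemma remainder_tail:
  assumes x: "x \<in> cblin" and fin: "nsum act 1 x < \<infinity>" and t: "t > 0"
  shows "\<exists>K\<ge>1. norm1N act K (x - (\<Sum>k\<in>{k :: int^'n. \<forall>j. \<bar>k $ j\<bar> \<le> 2}. act (phi_d K (int_vec k)) x)) \<le> ennreal t"
proof -
  define h where "h = (\<lambda>k. norm (act (ker 1 (int_vec k)) x))"
  define F where "F = {k :: int^'n. \<forall>j. \<bar>k $ j\<bar> \<le> 2}"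
  have F_eq: "F = vbox (\<lambda>j. {-2..2})" by (auto simp: F_def vbox_def abs_le_iff minus_le_iff)
  have fF: "finite F" unfolding F_eq by (rule finite_vbox) simp
  define H where "H = (\<lambda>K k. if \<exists>j. int K \<le> \<bar>k $ j\<bar> then h k else 0)"
  define C where "C = 3 ^ CARD('n) * (1 + card F)"
  have main: "nsum act (real K) (x - (\<Sum>k\<in>F. act (ker (real K) (real K *\<^sub>R int_vec k)) x)) \<le> of_nat C * esum (\<lambda>k. ennreal (H K k))"
    if K: "K \<ge> 1" for K
  proof -
    have K0: "real K > 0" using K by simp
    define p where "p = (\<lambda>n. act (ker (real K) (real K *\<^sub>R int_vec n)))"
    define R where "R = x - (\<Sum>k\<in>F. p k x)"
    have pc: "p n y \<in> cblin" if "y \<in> cblin" for n y unfolding p_def by (rule act_cblin[OF ker_integrable[OF K0] that])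
    have pR: "p n R = p n x - (\<Sum>k\<in>F. p k (p n x))" for n
    proof -
      have "p n R = p n x - (\<Sum>k\<in>F. p n (p k x))"
        unfolding R_def p_def using ker_integrable[OF K0] x
        by (subst act_diff) (auto intro!: cblin_sum act_cblin simp: act_sum act_cblin)
      also have "(\<Sum>k\<in>F. p n (p k x)) = (\<Sum>k\<in>F. p k (p n x))"
        unfolding p_def by (intro sum.cong refl act_commute ker_integrable K0 x)
      finally show ?thesis .
    qed
    \<comment> \<open>The reason why the band part reaches up to |k| <= 2: it contains all
      neighbours of the kernels with |n| <= 1, hence acts on those as the identity.\<close>
    have small: "p n R = 0" if n: "\<forall>j. \<bar>n $ j\<bar> \<le> 1" for n
    proof -
      have "overlap (real K) (real K *\<^sub>R int_vec n) (real K) 0 \<subseteq> F"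
      proof
        fix k assume k: "k \<in> overlap (real K) (real K *\<^sub>R int_vec n) (real K) (0::real^'n)"
        show "k \<in> F" unfolding F_def
        proof (intro CollectI allI)
          fix j
          have "real K * \<bar>real_of_int (k $ j) - real_of_int (n $ j)\<bar> < real K * 2"
          proof -
            have "\<bar>real K * (real_of_int (k $ j) - real_of_int (n $ j))\<bar> < 2 * real K"
              using k by (auto simp: overlap_def int_vec_def right_diff_distrib)
            then show ?thesis using K0 by (simp add: abs_mult mult.commute)
          qed
          then have "\<bar>real_of_int (k $ j) - real_of_int (n $ j)\<bar> < 2" using K0 by simp
          then have "\<bar>k $ j - n $ j\<bar> < 2" by linarith
          then show "\<bar>k $ j\<bar> \<le> 2" using n[rule_format, of j] by linarith
        qed
      qed
      from act_ker_partition(2)[OF K0 K0 x fF this] have "(\<Sum>k\<in>F. p k (p n x)) = p n x" by (simp add: p_def)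
      then show ?thesis by (simp add: pR)
    qed
    have bd: "norm (p n R) \<le> (1 + real (card F)) * norm (p n x)" for n
    proof -
      have "norm (p n R) \<le> norm (p n x) + norm (\<Sum>k\<in>F. p k (p n x))" unfolding pR by (rule norm_triangle_ineq4)
      also have "norm (\<Sum>k\<in>F. p k (p n x)) \<le> (\<Sum>k\<in>F. norm (p n x))"
        by (rule sum_norm_le) (use norm_act_ker_le[OF K0 pc[OF x]] in \<open>auto simp: p_def\<close>)
      finally show ?thesis by (simp add: algebra_simps)
    qed
    let ?Q = "\<lambda>n. overlap (real K) (real K *\<^sub>R int_vec n) 1 (0::real^'n)"
    have fQ: "finite (?Q n)" for n by (rule act_ker_partition(1)[OF zero_less_one K0 x])
    have f: "norm (p n R) \<le> (\<Sum>k\<in>?Q n. (1 + real (card F)) * H K k)" for n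
    proof (cases "\<forall>j. \<bar>n $ j\<bar> \<le> 1")
      case True
      then show ?thesis using small[OF True] by (auto intro!: sum_nonneg simp: H_def h_def)
    next
      case False
      then obtain j where "\<not> \<bar>n $ j\<bar> \<le> 1" by blast
      then have j: "\<bar>n $ j\<bar> \<ge> 2" by linarith
      have "H K k = h k" if "k \<in> ?Q n" for k
      proof -
        have "\<bar>real_of_int (k $ j) - real K * real_of_int (n $ j)\<bar> < 1 + real K" using that by (auto simp: overlap_def int_vec_def)
        then have "\<bar>k $ j - int K * n $ j\<bar> < 1 + int K"
          by (metis (mono_tags, lifting) of_int_1 of_int_abs of_int_add of_int_diff of_int_less_iff of_int_mult of_int_of_nat_eq)
        \<comment> \<open>Unit kernels meeting the kernel n have k within K of K n in coordinate j,
          so |k j| is at least 2K - K = K.\<close>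
        moreover have "int K * 2 \<le> \<bar>int K * n $ j\<bar>" using j by (simp add: abs_mult mult_left_mono)
        ultimately have "int K \<le> \<bar>k $ j\<bar>" by linarith
        then show ?thesis by (auto simp: H_def)
      qed
      then have "(\<Sum>k\<in>?Q n. (1 + real (card F)) * H K k) = (1 + real (card F)) * (\<Sum>k\<in>?Q n. h k)"
        by (simp add: sum_distrib_left)
      moreover have "norm (p n x) \<le> (\<Sum>k\<in>?Q n. h k)"
        using norm_act_ker_overlap[OF zero_less_one K0 x, of "real K *\<^sub>R int_vec n" 0] by (simp add: p_def h_def)
      ultimately show ?thesis using order_trans[OF bd[of n] mult_left_mono[of "norm (p n x)" _ "1 + real (card F)"]] by simp
    qed
    have sub: "{n. k \<in> ?Q n} \<subseteq> vbox (\<lambda>j. {k $ j div int K - 1..k $ j div int K + 1})" for k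
    proof
      fix n assume n: "n \<in> {n. k \<in> ?Q n}"
      show "n \<in> vbox (\<lambda>j. {k $ j div int K - 1..k $ j div int K + 1})"
        unfolding vbox_def
      proof (intro CollectI allI)
        fix j
        have "\<bar>real_of_int (k $ j) - real K * real_of_int (n $ j)\<bar> < 1 + real K" using n by (auto simp: overlap_def int_vec_def)
        then have "\<bar>k $ j - int K * n $ j\<bar> < 1 + int K"
          by (metis (mono_tags, lifting) of_int_1 of_int_abs of_int_add of_int_diff of_int_less_iff of_int_mult of_int_of_nat_eq)
        then have 1: "int K * (n $ j - 1) \<le> k $ j" "k $ j \<le> int K * (n $ j + 1)" by (simp_all add: algebra_simps)
        have Ki: "int K > 0" using K by simp
        have "n $ j - 1 \<le> k $ j div int K" using zdiv_mono1[OF 1(1) Ki] Ki by simp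
        moreover have "k $ j div int K \<le> n $ j + 1" using zdiv_mono1[OF 1(2) Ki] Ki by simp
        ultimately show "n $ j \<in> {k $ j div int K - 1..k $ j div int K + 1}" by simp
      qed
    qed
    have fv: "finite (vbox (\<lambda>j::'n. {k $ j div int K - 1..k $ j div int K + 1}))" for k by (rule finite_vbox) simp
    have "esum (\<lambda>n. ennreal (norm (p n R))) \<le> of_nat (3 ^ CARD('n)) * esum (\<lambda>k. ennreal ((1 + real (card F)) * H K k))"
    proof (rule esum_Schur[where Q = ?Q])
      fix n k
      show "ennreal (norm (p n R)) \<le> (\<Sum>k\<in>?Q n. ennreal ((1 + real (card F)) * H K k))"
        using f[of n] by (subst sum_ennreal) (auto simp: H_def h_def intro: ennreal_leI)
      show "finite (?Q n)" by (rule fQ)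
      show "finite {n. k \<in> ?Q n}" by (rule finite_subset[OF sub fv])
      have "card {n. k \<in> ?Q n} \<le> card (vbox (\<lambda>j. {k $ j div int K - 1..k $ j div int K + 1}))" by (rule card_mono[OF fv sub])
      also have "\<dots> = 3 ^ CARD('n)" by (subst card_vbox) auto
      finally show "card {n. k \<in> ?Q n} \<le> 3 ^ CARD('n)" .
    qed
    also have "esum (\<lambda>k. ennreal ((1 + real (card F)) * H K k)) = of_nat (1 + card F) * esum (\<lambda>k. ennreal (H K k))"
      by (subst nn_integral_cmult[symmetric]) (auto simp: ennreal_mult' H_def h_def simp flip: ennreal_of_nat_eq_real_of_nat intro!: nn_integral_cong)
    finally have "esum (\<lambda>n. ennreal (norm (p n R))) \<le> of_nat C * esum (\<lambda>k. ennreal (H K k))"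
      by (simp only: C_def of_nat_mult mult.assoc)
    then show ?thesis by (simp add: nsum_def p_def R_def)
  qed
  have "(\<lambda>K. esum (\<lambda>k. ennreal (H K k))) \<longlonglongrightarrow> esum (\<lambda>k::int^'n. 0)"
  proof (rule nn_integral_dominated_convergence[where w = "\<lambda>k. ennreal (h k)"])
    show "esum (\<lambda>k. ennreal (h k)) < \<infinity>" using fin by (simp add: nsum_def h_def)
    show "AE k in count_space UNIV. ennreal (H K k) \<le> ennreal (h k)" for K by (intro AE_I2) (auto simp: H_def h_def)
    show "AE k in count_space UNIV. (\<lambda>K. ennreal (H K k)) \<longlonglongrightarrow> 0"
    proof (rule AE_I2)
      fix k :: "int^'n"
      define m where "m = nat (Max (range (\<lambda>j. \<bar>k $ j\<bar>))) + 1"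
      have "H K k = 0" if "K \<ge> m" for K
      proof -
        have "\<bar>k $ j\<bar> < int m" for j
        proof -
          define M where "M = Max (range (\<lambda>j. \<bar>k $ j\<bar>))"
          have "\<bar>k $ j\<bar> \<le> M" unfolding M_def by (rule Max_ge) auto
          then show ?thesis unfolding m_def M_def[symmetric] by linarith
        qed
        then have "\<bar>k $ j\<bar> < int K" for j using that by (meson less_le_trans of_nat_mono)
        then have "\<not> (\<exists>j. int K \<le> \<bar>k $ j\<bar>)" by (simp add: not_le)
        then show ?thesis by (simp only: H_def if_False)
      qed
      then have "\<forall>\<^sub>F K in sequentially. ennreal (H K k) = 0" by (auto intro!: eventually_sequentiallyI[of m])
      then show "(\<lambda>K. ennreal (H K k)) \<longlonglongrightarrow> 0" by (rule tendsto_eventually)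
    qed
  qed auto
  then have "(\<lambda>K. (5 ^ CARD('n) * of_nat C) * esum (\<lambda>k. ennreal (H K k))) \<longlonglongrightarrow> (5 ^ CARD('n) * of_nat C) * 0"
    by (intro ennreal_tendsto_cmult) (auto simp: ennreal_mult_less_top of_nat_less_top power_less_top_ennreal)
  then have "\<forall>\<^sub>F K in sequentially. (5 ^ CARD('n) * of_nat C) * esum (\<lambda>k. ennreal (H K k)) < ennreal t"
    using t by (intro order_tendstoD(2)[where y = "(5 ^ CARD('n) * of_nat C) * 0"]) auto
  then obtain K0 where "\<And>K. K \<ge> K0 \<Longrightarrow> (5 ^ CARD('n) * of_nat C) * esum (\<lambda>k. ennreal (H K k)) < ennreal t"
    by (auto simp: eventually_sequentially)
  then have K1: "(5 ^ CARD('n) * of_nat C) * esum (\<lambda>k. ennreal (H (Suc K0) k)) < ennreal t" by simp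
  have "norm1N act (Suc K0) (x - (\<Sum>k\<in>F. act (phi_d (Suc K0) (int_vec k)) x)) \<le> 5 ^ CARD('n) * (of_nat C * esum (\<lambda>k. ennreal (H (Suc K0) k)))"
    unfolding norm1N_eq_nsum phi_d_eq_ker by (intro mult_left_mono main) auto
  also have "\<dots> \<le> ennreal t" using K1 by (simp add: mult.assoc)
  finally show ?thesis unfolding F_def by (intro exI[of _ "Suc K0"]) auto
qed

end

section \<open>Inverses of band-limited operators\<close>

text \<open>The terms are B (R B)^k; multiplied by A - R on either side, their sums telescope to id
  - C n A and id - A C n. The series itself is returned because its terms are estimated later in
  \<open>norm1N\<close>.\<close>

lemma neumann_inverse:
  fixes A :: "'a::complex_banach \<Rightarrow>\<^sub>L 'b::complex_banach"
  assumes AB: "A o\<^sub>L B = id_blinfun" and BA: "B o\<^sub>L A = id_blinfun"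
    and th: "norm R * norm B \<le> th" "th < 1"
    and C: "C 0 = B" "\<And>k. C (Suc k) = (C k o\<^sub>L R) o\<^sub>L B"
  obtains B' where "C sums B'" "(A - R) o\<^sub>L B' = id_blinfun" "B' o\<^sub>L (A - R) = id_blinfun"
    "norm B' \<le> norm B / (1 - th)"
proof -
  interpret bc: bounded_bilinear "blinfun_compose :: ('b \<Rightarrow>\<^sub>L 'a) \<Rightarrow> ('a \<Rightarrow>\<^sub>L 'b) \<Rightarrow> _" by (rule bounded_bilinear_blinfun_compose)
  interpret bd: bounded_bilinear "blinfun_compose :: ('a \<Rightarrow>\<^sub>L 'b) \<Rightarrow> ('b \<Rightarrow>\<^sub>L 'a) \<Rightarrow> _" by (rule bounded_bilinear_blinfun_compose)
  have th0: "0 \<le> th" using th(1) by (meson mult_nonneg_nonneg norm_ge_zero order_trans)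
  have nC: "norm (C k) \<le> norm B * th ^ k" for k
  proof (induction k)
    case (Suc k)
    have "norm (C (Suc k)) \<le> norm (C k o\<^sub>L R) * norm B" unfolding C(2) by (rule norm_blinfun_compose)
    also have "\<dots> \<le> (norm (C k) * norm R) * norm B" by (intro mult_right_mono norm_blinfun_compose) simp
    also have "\<dots> = norm (C k) * (norm R * norm B)" by simp
    also have "\<dots> \<le> (norm B * th ^ k) * th" using Suc th th0 by (intro mult_mono) auto
    finally show ?case by (simp add: mult_ac)
  qed (simp add: C)
  have geo: "summable (\<lambda>k. norm B * th ^ k)" using th th0 by (intro summable_mult summable_geometric) simp
  have sC: "summable (\<lambda>k. norm (C k))" by (rule summable_comparison_test'[OF geo]) (use nC in auto)
  define B' where "B' = suminf C"
  have s: "C sums B'" unfolding B'_def by (intro summable_sums summable_norm_cancel[OF sC])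
  have C0: "C \<longlonglongrightarrow> 0" by (intro summable_LIMSEQ_zero summable_norm_cancel[OF sC])
  have CA: "C (Suc k) o\<^sub>L A = C k o\<^sub>L R" for k
  proof -
    have "C (Suc k) o\<^sub>L A = (C k o\<^sub>L R) o\<^sub>L (B o\<^sub>L A)" unfolding C(2) by (rule blinfun_eqI) simp
    then show ?thesis unfolding BA by (simp add: blinfun_eqI)
  qed
  have AC: "A o\<^sub>L C (Suc k) = R o\<^sub>L C k" for k
  proof (induction k)
    case 0
    have "A o\<^sub>L C (Suc 0) = (A o\<^sub>L B) o\<^sub>L (R o\<^sub>L B)" unfolding C by (rule blinfun_eqI) simp
    then show ?case unfolding AB C(1) by (simp add: blinfun_eqI)
  next
    case (Suc k)
    have "A o\<^sub>L C (Suc (Suc k)) = ((A o\<^sub>L C (Suc k)) o\<^sub>L R) o\<^sub>L B" unfolding C(2)[of "Suc k"] by (rule blinfun_eqI) simp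
    also have "\<dots> = ((R o\<^sub>L C k) o\<^sub>L R) o\<^sub>L B" by (simp only: Suc)
    also have "\<dots> = R o\<^sub>L C (Suc k)" unfolding C(2)[of k] by (rule blinfun_eqI) simp
    finally show ?case .
  qed
  have "(\<Sum>k<n. C k) o\<^sub>L (A - R) = id_blinfun - (C n o\<^sub>L A)" for n
    by (induction n) (simp_all add: bc.add_left bc.diff_right bc.zero_left C(1) BA CA algebra_simps)
  moreover have "(\<lambda>n. (\<Sum>k<n. C k) o\<^sub>L (A - R)) \<longlonglongrightarrow> (B' o\<^sub>L (A - R))"
    using s unfolding sums_def by (rule bc.tendsto[OF _ tendsto_const])
  moreover have "(\<lambda>n. id_blinfun - (C n o\<^sub>L A)) \<longlonglongrightarrow> (id_blinfun - (0 o\<^sub>L A))"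
    by (rule tendsto_diff[OF tendsto_const bc.tendsto[OF C0 tendsto_const]])
  ultimately have 1: "B' o\<^sub>L (A - R) = id_blinfun" by (simp add: bc.zero_left LIMSEQ_unique)
  have "(A - R) o\<^sub>L (\<Sum>k<n. C k) = id_blinfun - (A o\<^sub>L C n)" for n
    by (induction n) (simp_all add: bd.add_right bd.diff_left bd.zero_right C(1) AB AC algebra_simps)
  moreover have "(\<lambda>n. (A - R) o\<^sub>L (\<Sum>k<n. C k)) \<longlonglongrightarrow> ((A - R) o\<^sub>L B')"
    using s unfolding sums_def by (rule bd.tendsto[OF tendsto_const])
  moreover have "(\<lambda>n. id_blinfun - (A o\<^sub>L C n)) \<longlonglongrightarrow> (id_blinfun - (A o\<^sub>L 0))"
    by (rule tendsto_diff[OF tendsto_const bd.tendsto[OF tendsto_const C0]])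
  ultimately have 2: "(A - R) o\<^sub>L B' = id_blinfun" by (simp add: bd.zero_right LIMSEQ_unique)
  have "norm B' \<le> (\<Sum>k. norm (C k))" unfolding B'_def by (rule summable_norm[OF sC])
  also have "\<dots> \<le> (\<Sum>k. norm B * th ^ k)" by (rule suminf_le[OF nC sC geo])
  also have "\<dots> = norm B / (1 - th)" using th th0 by (subst suminf_mult) (auto simp: suminf_geometric summable_geometric)
  finally show ?thesis using that s 1 2 by blast
qed

lemma inverse_blinfun_unique:
  assumes "B o\<^sub>L A = id_blinfun" "A o\<^sub>L B' = id_blinfun" shows "B = B'"
proof (rule blinfun_eqI)
  fix v
  have "blinfun_apply A (blinfun_apply B' v) = v" using arg_cong[OF assms(2), of "\<lambda>f. blinfun_apply f v"] by simp
  then show "blinfun_apply B v = blinfun_apply B' v"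
    using arg_cong[OF assms(1), of "\<lambda>f. blinfun_apply f (blinfun_apply B' v)"] by simp
qed

text \<open>By truncation 0 contributes 1, and each of k + 1 and - (k + 1) contributes r^k.\<close>

lemma sum_power_abs:
  fixes r :: real
  shows "(\<Sum>i\<in>{- int L..int L}. r ^ nat (\<bar>i\<bar> - 1)) = 1 + 2 * (\<Sum>k<L. r ^ k)"
proof (induction L)
  case (Suc L)
  have "{- int (Suc L)..int (Suc L)} = insert (- int (Suc L)) (insert (int (Suc L)) {- int L..int L})" by auto
  then have "(\<Sum>i\<in>{- int (Suc L)..int (Suc L)}. r ^ nat (\<bar>i\<bar> - 1)) = r ^ L + (r ^ L + (\<Sum>i\<in>{- int L..int L}. r ^ nat (\<bar>i\<bar> - 1)))"
    by simp
  then show ?case using Suc by simp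
qed simp

text \<open>A finite set lies in a cube, over which the sum factors into one geometric sum per
  coordinate.\<close>

lemma esum_decay_le:
  fixes r :: real
  assumes r: "0 \<le> r" "r < 1"
  shows "esum (\<lambda>n::int^'n. ennreal (\<Prod>j\<in>UNIV. r ^ nat (\<bar>n $ j\<bar> - 1))) \<le> ennreal ((1 + 2 / (1 - r)) ^ CARD('n))"
proof (rule esum_le)
  fix F :: "(int^'n) set" assume F: "finite F"
  define L where "L = nat (Max (insert 0 ((\<lambda>(n,j). \<bar>n $ j\<bar>) ` (F \<times> UNIV))))"
  have "\<bar>n $ j\<bar> \<le> int L" if "n \<in> F" for n j
  proof -
    have "\<bar>n $ j\<bar> \<le> Max (insert 0 ((\<lambda>(n,j). \<bar>n $ j\<bar>) ` (F \<times> UNIV)))"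
      using F that by (intro Max_ge) force+
    then show ?thesis unfolding L_def by linarith
  qed
  then have sub: "F \<subseteq> vbox (\<lambda>j::'n. {- int L..int L})" by (auto simp: vbox_def abs_le_iff minus_le_iff)
  have "(\<Sum>n\<in>F. \<Prod>j\<in>UNIV. r ^ nat (\<bar>n $ j\<bar> - 1)) \<le> (\<Sum>n\<in>vbox (\<lambda>j::'n. {- int L..int L}). \<Prod>j\<in>UNIV. r ^ nat (\<bar>n $ j\<bar> - 1))"
  proof (rule sum_mono2[OF _ sub])
    show "finite (vbox (\<lambda>j::'n. {- int L..int L}))" by (rule finite_vbox) simp
  qed (use r in \<open>auto intro!: prod_nonneg\<close>)
  also have "\<dots> = (1 + 2 * (\<Sum>k<L. r ^ k)) ^ CARD('n)"
    by (subst sum_vbox[where g = "\<lambda>_ i. r ^ nat (\<bar>i\<bar> - 1)"]) (auto simp: sum_power_abs)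
  also have "\<dots> \<le> (1 + 2 * (1 / (1 - r))) ^ CARD('n)"
  proof (intro power_mono add_left_mono mult_left_mono)
    show "(\<Sum>k<L. r ^ k) \<le> 1 / (1 - r)"
      using sum_le_suminf[of "\<lambda>k. r ^ k" "{..<L}"] r by (simp add: suminf_geometric summable_geometric)
    show "0 \<le> 1 + 2 * (\<Sum>k<L. r ^ k)" using r by (intro add_nonneg_nonneg mult_nonneg_nonneg sum_nonneg) auto
  qed simp
  finally show "(\<Sum>n\<in>F. ennreal (\<Prod>j\<in>UNIV. r ^ nat (\<bar>n $ j\<bar> - 1))) \<le> ennreal ((1 + 2 / (1 - r)) ^ CARD('n))"
    using r by (subst sum_ennreal) (auto intro!: prod_nonneg ennreal_leI)
qed

text \<open>For \<open>n $ j = 0\<close> the exponent is \<open>nat (-1) = 0\<close>.\<close>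

lemma inverse_decay:
  fixes act1 :: "(real^'n \<Rightarrow> complex) \<Rightarrow> ('x::complex_banach \<Rightarrow>\<^sub>L 'y::complex_banach) \<Rightarrow> ('x \<Rightarrow>\<^sub>L 'y)"
    and act2 :: "(real^'n \<Rightarrow> complex) \<Rightarrow> ('y \<Rightarrow>\<^sub>L 'x) \<Rightarrow> ('y \<Rightarrow>\<^sub>L 'x)"
  assumes M: "L1_mod T1 act1" "L1_mod T2 act2"
    and f: "frep f P" "\<And>l j. P l \<noteq> 0 \<Longrightarrow> \<bar>l $ j\<bar> \<le> 3 * w" and X: "X \<in> cblin" and A: "A = act1 f X"
    and B: "B \<in> cblin" "A o\<^sub>L B = id_blinfun" and inv: "\<And>t. T2 t B o\<^sub>L T1 t A = id_blinfun"
    and w: "w > 0" and be: "be > 0"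
    and q: "norm B * norm A * (exp (3 * be * real CARD('n)) - 1) \<le> q" "q < 1"
  shows "norm (act2 (ker w (w *\<^sub>R int_vec n)) B) \<le> norm B / (1 - q) * (\<Prod>j\<in>UNIV. exp (- be) ^ nat (\<bar>n $ j\<bar> - 1))"
proof -
  interpret M1: L1_mod T1 act1 by fact
  interpret M2: L1_mod T2 act2 by fact
  have Ac: "A \<in> cblin" unfolding A by (rule M1.act_cblin[OF frepD(1)[OF f(1)] X])
  \<comment> \<open>The direction points against n with coordinates of size be / w, so that the
    weight exp (l . v) at the frequency l = w n is the product of exp (- be |n j|); coordinates with
    n j = 0 are left alone.\<close>
  define v :: "real^'n" where "v = (\<chi> j. - sgn (real_of_int (n $ j)) * be / w)"
  have vj: "\<bar>v $ j\<bar> \<le> be / w" for j using w be by (auto simp: v_def abs_mult sgn_if)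
  \<comment> \<open>Bounds |l . v| on the spectrum of \<open>A\<close>: d coordinates, each at most
    3 w times be / w. The width cancels, so the decay rate per lattice step is independent of
    it.\<close>
  define s where "s = 3 * be * real CARD('n)"
  have s0: "0 \<le> s" using be by (simp add: s_def)
  have supp: "l \<bullet> v \<in> {0 - s..0 + s}" if "P l \<noteq> 0" for l
  proof -
    have "\<bar>l \<bullet> v\<bar> \<le> (\<Sum>j\<in>UNIV. \<bar>l $ j * v $ j\<bar>)" unfolding inner_vec_def by (simp add: sum_abs)
    also have "\<dots> \<le> (\<Sum>j\<in>(UNIV::'n set). 3 * w * (be / w))"
      unfolding abs_mult using f(2)[OF that] vj w by (intro sum_mono mult_mono) auto
    also have "\<dots> = s" using w by (simp add: s_def)
    finally show ?thesis by auto
  qed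
  obtain a where a: "M1.expands v A a" "\<And>n. norm (a n) \<le> s ^ n / fact n * norm A"
  proof (rule M1.expands_act[OF f(1) supp s0 X])
    fix a assume "M1.expands v (act1 f X) a" "\<And>n. norm (a n) \<le> (\<bar>0\<bar> + s) ^ n / fact n * norm (act1 f X)"
    then show thesis using that unfolding A by simp
  qed
  have as: "summable (\<lambda>n. norm (a n))" using a(1) by (simp add: M1.expands_def)
  have es: "summable (\<lambda>n. s ^ n / fact n)" by (rule exp_series_summable)
  have es1: "summable (\<lambda>n. s ^ Suc n / fact (Suc n))" using summable_Suc_iff[of "\<lambda>n. s ^ n / fact n"] es by simp
  have exp_s: "(\<Sum>n. s ^ Suc n / fact (Suc n)) = exp s - 1"
    using suminf_split_head[OF es] by (simp add: exp_def scaleR_conv_of_real divide_inverse mult.commute)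
  have "(\<Sum>n. norm (a (Suc n))) \<le> (\<Sum>n. s ^ Suc n / fact (Suc n) * norm A)"
    by (intro suminf_le a(2) summable_mult2 es1) (use as in \<open>simp only: summable_Suc_iff[of "\<lambda>n. norm (a n)"]\<close>)
  also have "\<dots> = (exp s - 1) * norm A" using suminf_mult2[OF es1, of "norm A"] exp_s by simp
  finally have "norm B * (\<Sum>n. norm (a (Suc n))) \<le> norm B * ((exp s - 1) * norm A)" by (rule mult_left_mono) simp
  also have "\<dots> \<le> q" using q(1) by (simp add: s_def mult_ac)
  finally have qa: "norm B * (\<Sum>n. norm (a (Suc n))) \<le> q" .
  obtain b where b: "M2.expands v B b" "(\<Sum>n. norm (b n)) \<le> norm B / (1 - q)"
    by (rule expands_inverse[OF M Ac a(1) B inv qa q(2)])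
  have bs: "summable (\<lambda>n. norm (b n))" using b(1) by (simp add: M2.expands_def)
  have ib: "norm (scaleCL (\<i> ^ n) (b n)) \<le> norm (b n)" for n
    using norm_scaleCL_le[of "\<i> ^ n" "b n"] by (simp add: norm_power)
  have ibs: "summable (\<lambda>n. norm (scaleCL (\<i> ^ n) (b n)))" by (rule summable_comparison_test'[OF bs]) (use ib in auto)
  define y where "y = (\<Sum>n. scaleCL (\<i> ^ n) (b n))"
  have y: "(\<lambda>n. scaleCL (\<i> ^ n) (b n)) sums y" unfolding y_def by (intro summable_sums summable_norm_cancel[OF ibs])
  have "norm y \<le> (\<Sum>n. norm (scaleCL (\<i> ^ n) (b n)))" unfolding y_def by (rule summable_norm[OF ibs])
  also have "\<dots> \<le> (\<Sum>n. norm (b n))" by (rule suminf_le[OF ib ibs bs])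
  finally have ny: "norm y \<le> norm B / (1 - q)" using b(2) by simp
  \<comment> \<open>Centre and, with \<open>u\<close>, half-width of the range of l . v over the
    support of the kernel. The half-width costs exp be per nonzero coordinate, whence |n j| - 1 in
    the exponent.\<close>
  define c where "c = (\<Sum>j\<in>UNIV. v $ j * (w * real_of_int (n $ j)))"
  define u where "u = (\<Sum>j\<in>UNIV. \<bar>v $ j\<bar> * w)"
  have u0: "0 \<le> u" using w by (auto simp: u_def intro!: sum_nonneg)
  have supp2: "l \<bullet> v \<in> {c - u..c + u}" if "ker_hat w (w *\<^sub>R int_vec n) l / complex_of_real ((2 * pi) ^ CARD('n)) \<noteq> 0" for l
  proof -
    have l: "\<bar>l $ j - w * real_of_int (n $ j)\<bar> \<le> w" for j
      using ker_hat_support[OF w, of "w *\<^sub>R int_vec n" l j] that by (auto simp: int_vec_def)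
    have "l \<bullet> v - c = (\<Sum>j\<in>UNIV. v $ j * (l $ j - w * real_of_int (n $ j)))"
      unfolding inner_vec_def c_def by (simp add: sum_subtractf right_diff_distrib mult.commute)
    also have "\<bar>\<dots>\<bar> \<le> (\<Sum>j\<in>UNIV. \<bar>v $ j * (l $ j - w * real_of_int (n $ j))\<bar>)" by (rule sum_abs)
    also have "\<dots> \<le> u" unfolding u_def abs_mult using l by (intro sum_mono mult_left_mono) auto
    finally show ?thesis by (auto simp: abs_le_iff)
  qed
  have "norm (act2 (ker w (w *\<^sub>R int_vec n)) B) \<le> exp (c + u) * L1norm (ker w (w *\<^sub>R int_vec n)) * norm y"
    by (rule M2.transfer_bound[OF frep_ker[OF w] supp2 u0 B(1) b(1) y])
  also have "\<dots> = norm y * exp (c + u)" by (simp add: L1norm_ker[OF w])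
  also have "exp (c + u) = (\<Prod>j\<in>UNIV. exp (- be) ^ nat (\<bar>n $ j\<bar> - 1))"
  proof -
    have "c + u = (\<Sum>j\<in>UNIV. v $ j * (w * real_of_int (n $ j)) + \<bar>v $ j\<bar> * w)" by (simp add: c_def u_def sum.distrib)
    also have "\<dots> = (\<Sum>j\<in>UNIV. real (nat (\<bar>n $ j\<bar> - 1)) * (- be))"
    proof (rule sum.cong[OF refl])
      fix j
      show "v $ j * (w * real_of_int (n $ j)) + \<bar>v $ j\<bar> * w = real (nat (\<bar>n $ j\<bar> - 1)) * (- be)"
      proof (cases "n $ j = 0")
        case False
        let ?r = "real_of_int (n $ j)"
        have e: "real (nat (\<bar>n $ j\<bar> - 1)) = \<bar>?r\<bar> - 1" using False by simp
        have v1: "v $ j * w = - sgn ?r * be" using w by (simp add: v_def)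
        have "\<bar>v $ j\<bar> * w = \<bar>v $ j * w\<bar>" using w by (simp add: abs_mult)
        also have "\<dots> = be" unfolding v1 using False be by (simp add: abs_mult abs_sgn_eq)
        finally have v2: "\<bar>v $ j\<bar> * w = be" .
        have "v $ j * (w * ?r) = (- sgn ?r * be) * ?r" unfolding v1[symmetric] by simp
        also have "\<dots> = - (\<bar>?r\<bar> * be)" by (simp add: abs_sgn[of ?r])
        finally show ?thesis unfolding v2 e by (simp add: algebra_simps)
      qed (simp add: v_def)
    qed
    finally show ?thesis by (simp only: exp_sum[OF finite_class.finite_UNIV] exp_of_nat_mult)
  qed
  also have "norm y * (\<Prod>j\<in>UNIV. exp (- be) ^ nat (\<bar>n $ j\<bar> - 1)) \<le> norm B / (1 - q) * (\<Prod>j\<in>UNIV. exp (- be) ^ nat (\<bar>n $ j\<bar> - 1))"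
    by (intro mult_right_mono ny prod_nonneg) auto
  finally show ?thesis .
qed

text \<open>With x = 1 / (4 kappa + 2) the definition of delta says delta^(3d) = 1 + x. For be = ln
  (delta^2) the quantity exp (3 be d) - 1 of \<open>inverse_decay\<close> is 2x + x^2, and kappa
  times it is at most 1/2. The last bound concerns the lattice sum with ratio 1 / delta^2; its
  factor 3 is an allowance for the perturbed inverse and for 1 / (1 - q).\<close>

lemma epsA_bounds:
  fixes kappa :: real and d :: nat
  assumes k: "kappa \<ge> 1" and d: "d \<ge> 1"
  defines "de \<equiv> deltaA d kappa" and "ep \<equiv> epsA d kappa"
  shows "1 < de" "0 < ep" "ep \<le> 1 / 100" "(de\<^sup>2) ^ (3 * d) - 1 \<le> 19/50" "kappa * ((de\<^sup>2) ^ (3 * d) - 1) \<le> 1/2"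
    "5 ^ d * (3 * (1 + 2 / (1 - 1 / de\<^sup>2)) ^ d) \<le> 1 / (2 * ep)"
proof -
  define x where "x = 1 / (4 * kappa + 2)"
  have x: "0 < x" "x \<le> 1/6" using k by (auto simp: x_def field_simps)
  have base: "(4 * kappa + 3) / (4 * kappa + 2) = 1 + x" using k by (simp add: x_def field_simps)
  have de: "de = (1 + x) powr (1 / (3 * real d))" unfolding de_def deltaA_def base ..
  show de1: "1 < de" unfolding de using x d by (intro gr_one_powr) auto
  have de3: "de ^ (3 * d) = 1 + x"
    unfolding de using x d by (simp add: powr_realpow[symmetric] powr_powr)
  have de6: "(de\<^sup>2) ^ (3 * d) - 1 = 2 * x + x\<^sup>2"
  proof -
    have "(de\<^sup>2) ^ (3 * d) = (de ^ (3 * d))\<^sup>2" by (simp add: power_mult[symmetric] mult.commute)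
    then show ?thesis unfolding de3 by (simp add: power2_eq_square algebra_simps)
  qed
  have x2: "x\<^sup>2 \<le> x / 6" using mult_left_mono[OF x(2), of x] x by (simp add: power2_eq_square)
  show "(de\<^sup>2) ^ (3 * d) - 1 \<le> 19/50" unfolding de6 using x x2 by linarith
  show "kappa * ((de\<^sup>2) ^ (3 * d) - 1) \<le> 1/2"
  proof -
    have "2 * (1 / y) + (1 / y)\<^sup>2 = (2 * y + 1) / y\<^sup>2" if "y > 0" for y :: real
      using that by (simp add: field_simps power2_eq_square)
    from this[of "4 * kappa + 2"] have "2 * x + x\<^sup>2 = (8 * kappa + 5) / (4 * kappa + 2)\<^sup>2"
      unfolding x_def using k by simp
    then have "kappa * (2 * x + x\<^sup>2) = kappa * (8 * kappa + 5) / (4 * kappa + 2)\<^sup>2" by simp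
    also have "\<dots> \<le> 1/2"
    proof -
      have "0 < (4 * kappa + 2)\<^sup>2" using k by (intro zero_less_power) simp
      moreover have "kappa * (8 * kappa + 5) \<le> 1/2 * (4 * kappa + 2)\<^sup>2"
        using k by (simp add: power2_eq_square algebra_simps)
      ultimately show ?thesis by (simp only: pos_divide_le_eq)
    qed
    finally show ?thesis unfolding de6 .
  qed
  define S where "S = (2 * de - 1) / (de - 1)"
  have S2: "2 \<le> S" using de1 by (simp add: S_def le_divide_eq)
  \<comment> \<open>Keeps 16 S^d - 12 at least 20 and later absorbs the constant 6.\<close>
  have Sd: "2 \<le> S ^ d" using power_increasing[OF d, of S] S2 by simp
  have ep: "ep = 1 / (5 ^ d * (16 * S ^ d - 12))"
    by (simp add: ep_def epsA_def S_def de_def Let_def field_simps)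
  have pos: "20 \<le> 16 * S ^ d - 12" using Sd by simp
  show "0 < ep" unfolding ep using pos by (intro divide_pos_pos mult_pos_pos) auto
  have "(5::real) \<le> 5 ^ d" using power_increasing[OF d, of "5::real"] by simp
  then have "5 * 20 \<le> 5 ^ d * (16 * S ^ d - 12)" using pos by (intro mult_mono) auto
  then show "ep \<le> 1 / 100" unfolding ep by (intro divide_left_mono) auto
  have sq: "1 < de\<^sup>2" using de1 by simp
  have "1 + 2 / (1 - 1 / z) = (3 * z - 1) / (z - 1)" if "z > 1" for z :: real
    using that by (simp add: field_simps)
  then have "1 + 2 / (1 - 1 / de\<^sup>2) = (3 * de\<^sup>2 - 1) / (de\<^sup>2 - 1)" using sq by simp
  also have "\<dots> \<le> de * S"
  proof -
    have f: "de\<^sup>2 - 1 = (de - 1) * (de + 1)" by (simp add: power2_eq_square algebra_simps)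
    have "0 \<le> 2 * de\<^sup>2 - 1" using sq by linarith
    \<comment> \<open>After clearing denominators the claim is the nonnegativity of this
      product.\<close>
    then have "0 \<le> (de - 1) * (2 * de\<^sup>2 - 1)" using de1 by (intro mult_nonneg_nonneg) auto
    then have "3 * de\<^sup>2 - 1 \<le> de * (2 * de - 1) * (de + 1)" by (simp add: power2_eq_square algebra_simps)
    then have "(3 * de\<^sup>2 - 1) / (de\<^sup>2 - 1) \<le> de * (2 * de - 1) * (de + 1) / (de\<^sup>2 - 1)"
      using sq by (intro divide_right_mono) auto
    also have "\<dots> = de * S" unfolding f S_def using de1 by simp
    finally show ?thesis .
  qed
  finally have "(1 + 2 / (1 - 1 / de\<^sup>2)) ^ d \<le> (de * S) ^ d"
  proof (rule power_mono)
    have "inverse (de\<^sup>2) \<le> 1" by (rule inverse_le_1_iff[THEN iffD2]) (use sq in linarith)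
    then have "1 / de\<^sup>2 \<le> 1" by (simp only: inverse_eq_divide)
    then show "0 \<le> 1 + 2 / (1 - 1 / de\<^sup>2)" by (intro add_nonneg_nonneg divide_nonneg_nonneg) auto
  qed
  also have "\<dots> = de ^ d * S ^ d" by (rule power_mult_distrib)
  also have "\<dots> \<le> (7/6) * S ^ d"
  proof (rule mult_right_mono)
    have "de ^ d \<le> de ^ (3 * d)" using de1 by (intro power_increasing) auto
    then show "de ^ d \<le> 7/6" unfolding de3 using x by simp
  qed (use S2 in auto)
  \<comment> \<open>3 times 7/6 is 7/2, and 7/2 S^d <= 8 S^d - 6 because S^d >= 2. The right side is
    half of 16 S^d - 12, which gives the 2 in 1 / (2 epsilon).\<close>
  finally have "3 * (1 + 2 / (1 - 1 / de\<^sup>2)) ^ d \<le> 8 * S ^ d - 6" using Sd by simp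
  then have "5 ^ d * (3 * (1 + 2 / (1 - 1 / de\<^sup>2)) ^ d) \<le> 5 ^ d * (8 * S ^ d - 6)" by (rule mult_left_mono) simp
  also have "\<dots> = 1 / (2 * ep)" unfolding ep by simp
  finally show "5 ^ d * (3 * (1 + 2 / (1 - 1 / de\<^sup>2)) ^ d) \<le> 1 / (2 * ep)" .
qed

section \<open>The inverse in the Wiener class\<close>

lemma norm_sums_le_ennreal:
  fixes x :: "nat \<Rightarrow> 'a::real_normed_vector"
  assumes "x sums s" shows "ennreal (norm s) \<le> (\<Sum>k. ennreal (norm (x k)))"
proof (rule tendsto_upperbound)
  show "(\<lambda>n. ennreal (norm (\<Sum>k<n. x k))) \<longlonglongrightarrow> ennreal (norm s)"
    using assms unfolding sums_def by (intro tendsto_intros)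
  show "\<forall>\<^sub>F n in sequentially. ennreal (norm (\<Sum>k<n. x k)) \<le> (\<Sum>k. ennreal (norm (x k)))"
  proof (intro always_eventually allI)
    fix n
    have "ennreal (norm (\<Sum>k<n. x k)) \<le> ennreal (\<Sum>k<n. norm (x k))" by (intro ennreal_leI norm_sum)
    also have "\<dots> = (\<Sum>k<n. ennreal (norm (x k)))" by simp
    also have "\<dots> \<le> (\<Sum>k. ennreal (norm (x k)))" by (intro sum_le_suminf summableI) auto
    finally show "ennreal (norm (\<Sum>k<n. x k)) \<le> (\<Sum>k. ennreal (norm (x k)))" .
  qed
qed simp

lemma (in L1_mod) norm1N_sums_le:
  assumes N: "N \<ge> 1" and C: "\<And>k. C k \<in> cblin" "C sums B"
  shows "norm1N act N B \<le> (\<Sum>k. norm1N act N (C k))"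
proof -
  have N0: "real N > 0" using N by simp
  let ?p = "\<lambda>m. act (ker (real N) (real N *\<^sub>R int_vec m))"
  have "nsum act (real N) B \<le> esum (\<lambda>m. \<Sum>k. ennreal (norm (?p m (C k))))"
    unfolding nsum_def
    by (intro nn_integral_mono norm_sums_le_ennreal act_sums ker_integrable N0 C)
  also have "\<dots> = (\<Sum>k. nsum act (real N) (C k))" unfolding nsum_def by (rule nn_integral_suminf) simp
  finally have "norm1N act N B \<le> 5 ^ CARD('n) * (\<Sum>k. nsum act (real N) (C k))"
    unfolding norm1N_eq_nsum by (rule mult_left_mono) simp
  then show ?thesis unfolding norm1N_eq_nsum by simp
qed

lemma norm1N_compose:
  assumes M: "L1_mod T1 act1" "L1_mod T2 act2" "L1_mod T3 act3"
    and mult: "\<And>t X Y. X \<in> cblin \<Longrightarrow> Y \<in> cblin \<Longrightarrow> T3 t (X o\<^sub>L Y) = T1 t X o\<^sub>L T2 t Y"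
    and X: "X \<in> cblin" and Y: "Y \<in> cblin" and N: "N \<ge> 1"
    and fin: "norm1N act1 N X < \<infinity>" "norm1N act2 N Y < \<infinity>"
  shows "norm1N act3 N (X o\<^sub>L Y) \<le> norm1N act1 N X * norm1N act2 N Y"
proof -
  have N0: "real N > 0" using N by simp
  have "nsum act1 (real N) X < \<infinity>" "nsum act2 (real N) Y < \<infinity>"
    using fin unfolding norm1N_eq_nsum by (auto simp: ennreal_mult_less_top)
  from mult_left_mono[OF nsum_compose[OF M mult X Y N0 this], of "5 ^ CARD('a)"]
  show ?thesis unfolding norm1N_eq_nsum by (simp add: mult_ac)
qed

lemma (in L1_mod) norm1N_uminus:
  assumes "N \<ge> 1" "x \<in> cblin" shows "norm1N act N (- x) = norm1N act N x"
proof -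
  have "act (ker (real N) c) (- x) = - act (ker (real N) c) x" for c
    using act_scaleR[OF ker_integrable assms(2), of "real N" c "-1"] assms(1) by simp
  then show ?thesis by (simp add: norm1N_eq_nsum nsum_def)
qed

text \<open>Centres up to 2N and width N reach to 3N; this 3 reappears in exp (3 be d) and in the
  exponent 1 / (3d) of delta.\<close>

lemma (in L1_mod) band_part:
  assumes N: "N \<ge> 1" and x: "x \<in> cblin"
  obtains f P where "frep f P" "\<And>l j. P l \<noteq> 0 \<Longrightarrow> \<bar>l $ j\<bar> \<le> 3 * real N"
    "(\<Sum>k\<in>{k :: int^'n. \<forall>j. \<bar>k $ j\<bar> \<le> 2}. act (phi_d N (int_vec k)) x) = act f x"
proof -
  have N0: "real N > 0" using N by simp
  define F where "F = {k :: int^'n. \<forall>j. \<bar>k $ j\<bar> \<le> 2}"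
  define f where "f = (\<lambda>t. \<Sum>k\<in>F. ker (real N) (real N *\<^sub>R int_vec k) t)"
  define P where "P = (\<lambda>l. \<Sum>k\<in>F. ker_hat (real N) (real N *\<^sub>R int_vec k) l / complex_of_real ((2 * pi) ^ CARD('n)))"
  have "frep f P" unfolding f_def P_def by (intro frep_sum frep_ker N0)
  moreover have "\<bar>l $ j\<bar> \<le> 3 * real N" if "P l \<noteq> 0" for l j
  proof -
    have "\<exists>k\<in>F. ker_hat (real N) (real N *\<^sub>R int_vec k) l \<noteq> 0"
    proof (rule ccontr)
      assume "\<not> ?thesis"
      then have "P l = 0" unfolding P_def by (intro sum.neutral) auto
      with that show False by simp
    qed
    then obtain k where k: "k \<in> F" "ker_hat (real N) (real N *\<^sub>R int_vec k) l \<noteq> 0" by blast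
    have "\<bar>l $ j - real N * real_of_int (k $ j)\<bar> < real N"
      using ker_hat_support[OF N0 k(2), of j] by (simp add: int_vec_def)
    moreover have "\<bar>real N * real_of_int (k $ j)\<bar> \<le> real N * 2"
      using k(1) by (auto simp: F_def abs_mult simp flip: of_int_abs intro!: mult_left_mono)
    ultimately show ?thesis by linarith
  qed
  moreover have "(\<Sum>k\<in>F. act (phi_d N (int_vec k)) x) = act f x"
    unfolding f_def phi_d_eq_ker by (rule act_sum_left[symmetric]) (auto intro!: ker_integrable N0 x)
  ultimately show ?thesis using that unfolding F_def by blast
qed

lemma one_le_condition_number:
  fixes A :: "'x::real_normed_vector \<Rightarrow>\<^sub>L 'y::real_normed_vector"
  assumes BA: "B o\<^sub>L A = id_blinfun" and "B \<noteq> 0" shows "1 \<le> norm A * norm B"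
proof -
  have "B = (B o\<^sub>L A) o\<^sub>L B" unfolding BA by (rule blinfun_eqI) simp
  then have "norm B \<le> norm (B o\<^sub>L A) * norm B" by (metis norm_blinfun_compose)
  then have "1 \<le> norm (B o\<^sub>L A)" using assms(2) by simp
  also have "\<dots> \<le> norm A * norm B" using norm_blinfun_compose[of B A] by (simp add: mult.commute)
  finally show ?thesis .
qed

text \<open>Two Neumann series run in opposite directions. From B to the inverse B' of the band part
  only operator norms are available; on the way back from B' to B every term has finite
  \<open>norm1N\<close>, because B' decays.\<close>

lemma inverse_norm1N_le:
  fixes TXY :: "real^'n \<Rightarrow> ('x::complex_banach \<Rightarrow>\<^sub>L 'y::complex_banach) \<Rightarrow> ('x \<Rightarrow>\<^sub>L 'y)"
    and aXY :: "(real^'n \<Rightarrow> complex) \<Rightarrow> ('x \<Rightarrow>\<^sub>L 'y) \<Rightarrow> ('x \<Rightarrow>\<^sub>L 'y)"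
    and A :: "'x \<Rightarrow>\<^sub>L 'y" and B :: "'y \<Rightarrow>\<^sub>L 'x"
  assumes M: "L1_mod TXY aXY" "L1_mod TYX aYX" "L1_mod TXX aXX"
    and m1: "\<And>t X Y. X \<in> cblin \<Longrightarrow> Y \<in> cblin \<Longrightarrow> TXX t (X o\<^sub>L Y) = TYX t X o\<^sub>L TXY t Y"
    and m2: "\<And>t X Y. X \<in> cblin \<Longrightarrow> Y \<in> cblin \<Longrightarrow> TYX t (X o\<^sub>L Y) = TXX t X o\<^sub>L TYX t Y"
    and coupled: "\<And>t A B. A \<in> cblin \<Longrightarrow> B \<in> cblin \<Longrightarrow> B o\<^sub>L A = id_blinfun \<Longrightarrow> A o\<^sub>L B = id_blinfun \<Longrightarrow>
        TYX t B o\<^sub>L TXY t A = id_blinfun"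
    and A: "A \<in> cblin" and B: "B \<in> cblin" and BA: "B o\<^sub>L A = id_blinfun" and AB: "A o\<^sub>L B = id_blinfun"
    and B0: "B \<noteq> 0" and N: "N \<ge> 1"
    and rem: "norm1N aXY N (A - (\<Sum>k\<in>{k :: int^'n. \<forall>j. \<bar>k $ j\<bar> \<le> 2}. aXY (phi_d N (int_vec k)) A))
       \<le> ennreal (epsA CARD('n) (norm A * norm B) / norm B)"
  shows "norm1N aYX N B \<le> ennreal (norm B / epsA CARD('n) (norm A * norm B))"
proof -
  interpret XY: L1_mod TXY aXY by fact
  interpret YX: L1_mod TYX aYX by fact
  interpret XX: L1_mod TXX aXX by fact
  have N0: "real N > 0" using N by simp
  have nB: "norm B > 0" using B0 by simp
  define kappa where "kappa = norm A * norm B"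
  have k1: "1 \<le> norm A * norm B" by (rule one_le_condition_number[OF BA B0])
  define de ep where "de = deltaA CARD('n) kappa" and "ep = epsA CARD('n) kappa"
  have d1: "CARD('n) \<ge> 1" by (simp add: Suc_le_eq)
  note K = epsA_bounds[OF k1[folded kappa_def] d1, folded de_def ep_def]
  obtain f P where f: "frep f P" "\<And>l j. P l \<noteq> 0 \<Longrightarrow> \<bar>l $ j\<bar> \<le> 3 * real N"
    "(\<Sum>k\<in>{k :: int^'n. \<forall>j. \<bar>k $ j\<bar> \<le> 2}. aXY (phi_d N (int_vec k)) A) = aXY f A"
    by (rule XY.band_part[OF N A]) (rule that)
  define A' where "A' = aXY f A"
  define R where "R = A - A'"
  have A'c: "A' \<in> cblin" unfolding A'_def by (rule XY.act_cblin[OF frepD(1)[OF f(1)] A])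
  have Rc: "R \<in> cblin" unfolding R_def by (rule cblin_diff[OF A A'c])
  have AR: "A - R = A'" by (simp add: R_def)
  have nR: "norm1N aXY N R \<le> ennreal (ep / norm B)" using rem unfolding f(3) R_def A'_def ep_def kappa_def .
  have Rle: "norm R \<le> ep / norm B"
  proof -
    have "ennreal (norm R) \<le> nsum aXY (real N) R" by (rule XY.norm_le_nsum[OF N0 Rc])
    also have "\<dots> \<le> norm1N aXY N R"
      unfolding norm1N_eq_nsum using mult_right_mono[of 1 "5 ^ CARD('n) :: ennreal" "nsum aXY (real N) R"]
      by (simp add: one_le_power)
    also note nR
    finally show ?thesis using K(2) nB by (simp add: ennreal_le_iff)
  qed
  have RB: "norm R * norm B \<le> ep" using mult_right_mono[OF Rle, of "norm B"] nB by simp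
  define C where "C = rec_nat B (\<lambda>_ c. (c o\<^sub>L R) o\<^sub>L B)"
  have ep1: "ep < 1" using K(3) by simp
  obtain B' where B': "A' o\<^sub>L B' = id_blinfun" "B' o\<^sub>L A' = id_blinfun" "norm B' \<le> norm B / (1 - ep)"
    by (rule neumann_inverse[OF AB BA RB ep1, of C, unfolded AR]) (auto simp: C_def intro: that)
  have B'c: "B' \<in> cblin" by (rule cblin_inverse[OF A'c B'(2,1)])
  have B'le: "norm B' \<le> norm B * (100/99)"
  proof -
    have "norm B / (1 - ep) \<le> norm B / (99/100)" using K(3) nB by (intro divide_left_mono) auto
    from order_trans[OF B'(3) this] show ?thesis by simp
  qed
  define y where "y = (de\<^sup>2) ^ (3 * CARD('n)) - 1"
  have de2: "1 < de\<^sup>2" using K(1) by simp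
  have y0: "0 \<le> y" unfolding y_def using one_le_power[of "de\<^sup>2" "3 * CARD('n)"] de2 by simp
  \<comment> \<open>The product of the perturbed norms is at most (100/99) (kappa + 1/100); with
    kappa y <= 1/2 and y <= 19/50 the result is below 0.51, so 53/100 leaves some room.\<close>
  have q: "norm B' * norm A' * y \<le> 53/100"
  proof -
    have "norm A' \<le> norm A + norm R" unfolding AR[symmetric] by (rule norm_triangle_ineq4)
    then have "norm B' * norm A' \<le> (norm B * (100/99)) * (norm A + norm R)" using B'le by (intro mult_mono) auto
    also have "\<dots> = (100/99) * (kappa + norm R * norm B)" by (simp add: kappa_def algebra_simps)
    also have "\<dots> \<le> (100/99) * (kappa + 1/100)" using RB K(3) by simp
    finally have "norm B' * norm A' * y \<le> (100/99) * (kappa + 1/100) * y" using y0 by (rule mult_right_mono)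
    also have "\<dots> = (100/99) * (kappa * y + y / 100)" by (simp add: algebra_simps)
    also have "\<dots> \<le> 53/100" using K(4,5) unfolding y_def[symmetric] by simp
    finally show ?thesis .
  qed
  define be where "be = ln (de\<^sup>2)"
  have be: "be > 0" unfolding be_def by (rule ln_gt_zero[OF de2])
  have ebe: "exp be = de\<^sup>2" unfolding be_def by (rule exp_ln) (use de2 in linarith)
  have e3: "exp (3 * be * real CARD('n)) = (de\<^sup>2) ^ (3 * CARD('n))"
    unfolding ebe[symmetric] by (simp add: exp_of_nat_mult[symmetric] mult_ac)
  have em: "exp (- be) = 1 / de\<^sup>2" by (simp add: exp_minus ebe divide_inverse)
  have ide: "1 / de\<^sup>2 < 1" using inverse_less_1_iff[THEN iffD2, OF disjI2[OF de2]] by (simp only: inverse_eq_divide)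
  define G where "G = (1 + 2 / (1 - 1 / de\<^sup>2)) ^ CARD('n)"
  have G0: "0 \<le> G" unfolding G_def using ide by (intro zero_le_power add_nonneg_nonneg divide_nonneg_nonneg) auto
  \<comment> \<open>Half of the target norm B / epsilon; the final Neumann series doubles
    it.\<close>
  define b where "b = norm B / (2 * ep)"
  have b0: "0 \<le> b" using nB K(2) by (simp add: b_def)
  have nB': "norm1N aYX N B' \<le> ennreal b"
  proof -
    have dec: "norm (aYX (ker (real N) (real N *\<^sub>R int_vec n)) B') \<le> norm B' / (1 - 53/100) * (\<Prod>j\<in>UNIV. (1 / de\<^sup>2) ^ nat (\<bar>n $ j\<bar> - 1))" for n
      using inverse_decay[OF M(1,2) f(1,2) A A'_def B'c B'(1) coupled[OF A'c B'c B'(2,1)] N0 be, of "53/100" n] q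
      unfolding e3 em y_def by simp
    \<comment> \<open>141/100 is 3 times 1 - 53/100, so the losses from B' and from 1 / (1 - q) are
      together covered by the factor 3 of \<open>epsA_bounds\<close>.\<close>
    have "norm B' * 100 \<le> 141 * norm B" using B'le norm_ge_zero[of B] by linarith
    then have "norm B' / (1 - 53/100) \<le> 3 * norm B" by simp
    then have "norm (aYX (ker (real N) (real N *\<^sub>R int_vec n)) B') \<le> 3 * norm B * (\<Prod>j\<in>UNIV. (1 / de\<^sup>2) ^ nat (\<bar>n $ j\<bar> - 1))" for n
      by (rule order_trans[OF dec mult_right_mono]) (auto intro: prod_nonneg)
    then have "nsum aYX (real N) B' \<le> esum (\<lambda>n::int^'n. ennreal (3 * norm B) * ennreal (\<Prod>j\<in>UNIV. (1 / de\<^sup>2) ^ nat (\<bar>n $ j\<bar> - 1)))"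
      unfolding nsum_def by (intro nn_integral_mono) (auto simp: ennreal_mult[symmetric] prod_nonneg intro!: ennreal_leI)
    also have "\<dots> = ennreal (3 * norm B) * esum (\<lambda>n::int^'n. ennreal (\<Prod>j\<in>UNIV. (1 / de\<^sup>2) ^ nat (\<bar>n $ j\<bar> - 1)))"
      by (rule nn_integral_cmult) simp
    also have "\<dots> \<le> ennreal (3 * norm B) * ennreal G"
      unfolding G_def by (intro mult_left_mono esum_decay_le) (use ide in auto)
    finally have "norm1N aYX N B' \<le> 5 ^ CARD('n) * (ennreal (3 * norm B) * ennreal G)"
      unfolding norm1N_eq_nsum by (rule mult_left_mono) simp
    also have "\<dots> = ennreal (norm B * (5 ^ CARD('n) * (3 * G)))"
    proof -
      have "(5::ennreal) ^ CARD('n) = ennreal (5 ^ CARD('n))" by (simp flip: ennreal_power)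
      then show ?thesis using G0 nB by (simp add: ennreal_mult[symmetric] mult_ac)
    qed
    also have "\<dots> \<le> ennreal b"
      using mult_left_mono[OF K(6), of "norm B"] nB unfolding b_def G_def by (intro ennreal_leI) simp
    finally show ?thesis .
  qed
  \<comment> \<open>The sign comes from writing A = A' - (- R), with A' now in the role of the
    operator whose inverse is known.\<close>
  define E where "E = rec_nat B' (\<lambda>_ c. (c o\<^sub>L (- R)) o\<^sub>L B')"
  have E: "E 0 = B'" "E (Suc k) = (E k o\<^sub>L (- R)) o\<^sub>L B'" for k by (simp_all add: E_def)
  have mRB': "norm (- R) * norm B' \<le> 1/2"
  proof -
    have "norm R * norm B' \<le> norm R * (norm B * (100/99))" using B'le by (intro mult_left_mono) auto
    also have "\<dots> \<le> 1/2" using RB K(3) by simp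
    finally show ?thesis by simp
  qed
  obtain B2 where "E sums B2" "(A' - (- R)) o\<^sub>L B2 = id_blinfun"
    by (rule neumann_inverse[OF B'(1,2) mRB', of E]) (auto simp: E intro: that)
  moreover have "A' - (- R) = A" by (simp add: R_def)
  ultimately have EB: "E sums B" using inverse_blinfun_unique[OF BA, of B2] by simp
  have Ec: "E k \<in> cblin" for k
    by (induction k) (auto simp: E B'c intro!: cblin_compose cblin_uminus Rc)
  have nE: "norm1N aYX N (E k) \<le> ennreal (b * (1/2) ^ k)" for k
  proof (induction k)
    case 0 then show ?case using nB' by (simp add: E)
  next
    case (Suc k)
    have mR: "norm1N aXY N (- R) \<le> ennreal (ep / norm B)" using nR XY.norm1N_uminus[OF N Rc] by simp
    have fE: "norm1N aYX N (E k) < \<infinity>" using Suc by (auto intro: le_less_trans)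
    have fR: "norm1N aXY N (- R) < \<infinity>" using mR by (auto intro: le_less_trans)
    have fB: "norm1N aYX N B' < \<infinity>" using nB' by (auto intro: le_less_trans)
    have 1: "norm1N aXX N (E k o\<^sub>L (- R)) \<le> norm1N aYX N (E k) * norm1N aXY N (- R)"
      by (rule norm1N_compose[OF M(2,1,3) m1 Ec cblin_uminus[OF Rc] N fE fR])
    have f1: "norm1N aXX N (E k o\<^sub>L (- R)) < \<infinity>"
      using fE fR by (intro le_less_trans[OF 1]) (simp add: ennreal_mult_less_top)
    have "norm1N aYX N (E (Suc k)) \<le> norm1N aXX N (E k o\<^sub>L (- R)) * norm1N aYX N B'"
      unfolding E by (rule norm1N_compose[OF M(3,2,2) m2 cblin_compose[OF Ec cblin_uminus[OF Rc]] B'c N f1 fB])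
    also have "\<dots> \<le> (ennreal (b * (1/2) ^ k) * ennreal (ep / norm B)) * ennreal b"
      using 1 Suc mR nB' by (intro mult_mono order_trans[OF 1]) auto
    also have "\<dots> = ennreal (b * (1/2) ^ k * (ep / norm B) * b)"
      using b0 K(2) nB by (simp add: ennreal_mult[symmetric])
    \<comment> \<open>(ep / norm B) times b is exactly 1/2: the calibration of epsilon.\<close>
    also have "b * (1/2) ^ k * (ep / norm B) * b = b * (1/2) ^ Suc k"
      using K(2) nB by (simp add: b_def)
    finally show ?case .
  qed
  have "norm1N aYX N B \<le> (\<Sum>k. norm1N aYX N (E k))" by (rule YX.norm1N_sums_le[OF N Ec EB])
  also have "\<dots> \<le> (\<Sum>k. ennreal (b * (1/2) ^ k))" by (intro suminf_le nE summableI)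
  also have "\<dots> = ennreal (\<Sum>k. b * (1/2) ^ k)"
    using b0 by (intro suminf_ennreal2 summable_mult summable_geometric) auto
  also have "(\<Sum>k. b * (1/2) ^ k) = norm B / ep"
    by (subst suminf_mult) (auto simp: suminf_geometric summable_geometric b_def)
  finally show "norm1N aYX N B \<le> ennreal (norm B / epsA CARD('n) (norm A * norm B))" by (simp add: ep_def kappa_def)
qed

theorem mainTheorem12:
  fixes TXY :: "real^'n \<Rightarrow> ('x::complex_banach \<Rightarrow>\<^sub>L 'y::complex_banach) \<Rightarrow> ('x \<Rightarrow>\<^sub>L 'y)"
    and aXY :: "(real^'n \<Rightarrow> complex) \<Rightarrow> ('x \<Rightarrow>\<^sub>L 'y) \<Rightarrow> ('x \<Rightarrow>\<^sub>L 'y)"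
    and TYX :: "real^'n \<Rightarrow> ('y \<Rightarrow>\<^sub>L 'x) \<Rightarrow> ('y \<Rightarrow>\<^sub>L 'x)"
    and aYX :: "(real^'n \<Rightarrow> complex) \<Rightarrow> ('y \<Rightarrow>\<^sub>L 'x) \<Rightarrow> ('y \<Rightarrow>\<^sub>L 'x)"
    and TXX :: "real^'n \<Rightarrow> ('x \<Rightarrow>\<^sub>L 'x) \<Rightarrow> ('x \<Rightarrow>\<^sub>L 'x)"
    and aXX :: "(real^'n \<Rightarrow> complex) \<Rightarrow> ('x \<Rightarrow>\<^sub>L 'x) \<Rightarrow> ('x \<Rightarrow>\<^sub>L 'x)"
    and TYY :: "real^'n \<Rightarrow> ('y \<Rightarrow>\<^sub>L 'y) \<Rightarrow> ('y \<Rightarrow>\<^sub>L 'y)"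
    and aYY :: "(real^'n \<Rightarrow> complex) \<Rightarrow> ('y \<Rightarrow>\<^sub>L 'y) \<Rightarrow> ('y \<Rightarrow>\<^sub>L 'y)"
    and A :: "'x \<Rightarrow>\<^sub>L 'y" and B :: "'y \<Rightarrow>\<^sub>L 'x"
  assumes setting: "operator_setting TXY aXY TYX aYX TXX aXX TYY aYY"
    and A_W: "A \<in> WienerClass aXY"
    and B_L: "B \<in> cblin"
    and BA: "B o\<^sub>L A = id_blinfun"
    and AB: "A o\<^sub>L B = id_blinfun"
  shows "B \<in> WienerClass aYX \<and>
    (let d = CARD('n);
         \<epsilon> = epsA d (norm A * norm B);
         N = psi aXY A (\<epsilon> / norm B)
     in norm1N aYX 1 B \<le> of_nat ((2 * N + 1) ^ d) * norm1N aYX N B \<and>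
        of_nat ((2 * N + 1) ^ d) * norm1N aYX N B
          \<le> ennreal (norm B / \<epsilon> * (2 * real N + 1) ^ d))"
proof -
  note S = setting[unfolded operator_setting_def]
  have XY: "L1_mod TXY aXY" and YX: "L1_mod TYX aYX" and XX: "L1_mod TXX aXX"
    using S by (auto intro: L1_mod.intro)
  interpret XY: L1_mod TXY aXY by (rule XY)
  interpret YX: L1_mod TYX aYX by (rule YX)
  have "\<forall>t. \<forall>B\<in>cblin. \<forall>A\<in>cblin. TXX t (B o\<^sub>L A) = TYX t B o\<^sub>L TXY t A" using S by (elim conjE)
  then have m1: "TXX t (X o\<^sub>L Y) = TYX t X o\<^sub>L TXY t Y" if "X \<in> cblin" "Y \<in> cblin" for t X Y using that by blast
  have "\<forall>t. \<forall>B\<in>cblin. \<forall>A\<in>cblin. TYX t (B o\<^sub>L A) = TXX t B o\<^sub>L TYX t A" using S by (elim conjE)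
  then have m2: "TYX t (X o\<^sub>L Y) = TXX t X o\<^sub>L TYX t Y" if "X \<in> cblin" "Y \<in> cblin" for t X Y using that by blast
  have "\<forall>A\<in>cblin. \<forall>B\<in>cblin.
        (B o\<^sub>L A = id_blinfun \<and> A o\<^sub>L B = id_blinfun) \<longleftrightarrow>
        (\<forall>t. TYX t B o\<^sub>L TXY t A = id_blinfun \<and> TXY t A o\<^sub>L TYX t B = id_blinfun)" using S by (elim conjE)
  then have coupled: "TYX t B o\<^sub>L TXY t A = id_blinfun"
    if "A \<in> cblin" "B \<in> cblin" "B o\<^sub>L A = id_blinfun" "A o\<^sub>L B = id_blinfun" for t A B using that by blast
  have A: "A \<in> cblin" and AW: "normW aXY A < \<infinity>" using A_W by (auto simp: WienerClass_def)
  define ep where "ep = epsA CARD('n) (norm A * norm B)"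
  define N where "N = psi aXY A (ep / norm B)"
  have "B \<in> WienerClass aYX \<and> norm1N aYX 1 B \<le> of_nat ((2 * N + 1) ^ CARD('n)) * norm1N aYX N B \<and>
        of_nat ((2 * N + 1) ^ CARD('n)) * norm1N aYX N B \<le> ennreal (norm B / ep * (2 * real N + 1) ^ CARD('n))"
  proof (cases "B = 0")
    \<comment> \<open>Now both spaces are trivial. \<open>ep / norm B\<close> is a division by zero,
      that is 0, so \<open>psi\<close> is evaluated outside (0, infinity); K = 1 still qualifies
      since A = 0, hence N >= 1 and all norms of B vanish.\<close>
    case True
    have k0: "aYX (phi_d n (c::real^'n)) 0 = 0" if "n \<ge> 1" for n c
      unfolding phi_d_eq_ker by (rule YX.act_zero[OF ker_integrable]) (use that in simp)
    have "normW aYX B = 0" unfolding normW_def True by (simp add: k0)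
    moreover have "norm1N aYX n B = 0" if "n \<ge> 1" for n unfolding norm1N_def True using that by (simp add: k0)
    moreover have "N \<ge> 1"
    proof -
      have "A = 0"
      proof (rule blinfun_eqI)
        fix v :: 'x
        have "v = 0" using arg_cong[OF BA, of "\<lambda>f. blinfun_apply f v"] True by simp
        then show "blinfun_apply A v = blinfun_apply 0 v" by (simp add: blinfun.zero_right)
      qed
      have a0: "aXY (phi_d 1 (c::real^'n)) 0 = 0" for c
        unfolding phi_d_eq_ker by (rule XY.act_zero[OF ker_integrable]) simp
      have "1 \<le> (1::nat) \<and> norm1N aXY 1 (A - (\<Sum>k\<in>{k :: int^'n. \<forall>j. \<bar>k $ j\<bar> \<le> 2}. aXY (phi_d 1 (int_vec k)) A)) \<le> ennreal (ep / norm B)"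
        unfolding \<open>A = 0\<close> by (simp add: a0[unfolded One_nat_def] norm1N_def)
      then show ?thesis unfolding N_def psi_def by (rule LeastI2) auto
    qed
    ultimately show ?thesis using B_L by (simp add: WienerClass_def)
  next
    case False
    have nB: "norm B > 0" using False by simp
    have fin: "nsum aXY 1 A < \<infinity>" by (rule XY.nsum_finite_if_normW[OF A AW])
    have k1: "1 \<le> norm A * norm B" by (rule one_le_condition_number[OF BA False])
    have ep0: "0 < ep" unfolding ep_def by (rule epsA_bounds(2)[OF k1]) (simp add: Suc_le_eq)
    \<comment> \<open>The witness makes \<open>LEAST\<close> meaningful: N satisfies both the
      positivity and the remainder bound.\<close>
    have "\<exists>K. 1 \<le> K \<and> norm1N aXY K (A - (\<Sum>k\<in>{k :: int^'n. \<forall>j. \<bar>k $ j\<bar> \<le> 2}. aXY (phi_d K (int_vec k)) A)) \<le> ennreal (ep / norm B)"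
      using XY.remainder_tail[OF A fin, of "ep / norm B"] ep0 nB by auto
    from LeastI_ex[OF this] have N: "1 \<le> N"
      and rem: "norm1N aXY N (A - (\<Sum>k\<in>{k :: int^'n. \<forall>j. \<bar>k $ j\<bar> \<le> 2}. aXY (phi_d N (int_vec k)) A)) \<le> ennreal (ep / norm B)"
      unfolding N_def psi_def by auto
    have main: "norm1N aYX N B \<le> ennreal (norm B / ep)"
      unfolding ep_def by (rule inverse_norm1N_le[OF XY YX XX m1 m2 coupled A B_L BA AB False N rem[unfolded ep_def]])
    have 1: "norm1N aYX 1 B \<le> of_nat ((2 * N + 1) ^ CARD('n)) * norm1N aYX N B"
      unfolding norm1N_eq_nsum using mult_left_mono[OF YX.nsum_1_le[OF N B_L], of "5 ^ CARD('n)"]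
      by (simp add: mult_ac)
    have "of_nat ((2 * N + 1) ^ CARD('n)) * norm1N aYX N B \<le> of_nat ((2 * N + 1) ^ CARD('n)) * ennreal (norm B / ep)"
      by (intro mult_left_mono main) simp
    also have "\<dots> = ennreal (real ((2 * N + 1) ^ CARD('n)) * (norm B / ep))"
      unfolding ennreal_of_nat_eq_real_of_nat by (rule ennreal_mult[symmetric]) (use ep0 nB in auto)
    also have "real ((2 * N + 1) ^ CARD('n)) * (norm B / ep) = norm B / ep * (2 * real N + 1) ^ CARD('n)" by (simp add: add.commute)
    finally have 2: "of_nat ((2 * N + 1) ^ CARD('n)) * norm1N aYX N B \<le> ennreal (norm B / ep * (2 * real N + 1) ^ CARD('n))" .
    \<comment> \<open>Finiteness passes from width N to width 1, and the unit lattice sum controls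
      the integral that defines the Wiener class.\<close>
    have "norm1N aYX 1 B < \<infinity>" using order_trans[OF 1 2] by (auto intro: le_less_trans)
    then have "nsum aYX 1 B < \<infinity>" unfolding norm1N_eq_nsum by (auto simp: ennreal_mult_less_top)
    then have "B \<in> WienerClass aYX" using YX.normW_finite_if_nsum[OF B_L] B_L by (simp add: WienerClass_def)
    then show ?thesis using 1 2 by blast
  qed
  then show ?thesis by (simp add: Let_def ep_def N_def)
qed

end
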